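(* Let $\mu$ be a probability measure on $\mathbb{R}^d$ and let $(\theta_s)_{s\ge0}$ be real constants such that for all $s\ge0$ $$\nabla^2\log Q_s\Bigl[\frac{\mu}{\gamma}\Bigr](x)=I+\nabla^2\log q_s^\mu(x)\preceq\theta_sI\qquad\text{for all }x\in\mathbb{R}^d,$$ and suppose that for every $y\in\mathbb{R}^d$ and $t>0$ the measure $\mu_{y,t}$ satisfies a log-Sobolev inequality with constant $\lambda_t$. Then for any probability measure $\nu$ on $\mathbb{R}^d$ (such that the Kim--Milman maps $T_{\rm KM}^\mu,T_{\rm KM}^\nu$ are well-defined), $$\|T_{\rm KM}^\mu-T_{\rm KM}^\nu\|_{L^\infty(\gamma)}\le\eta_\infty\sqrt{\mathrm{FI}_\infty(\nu\,\|\,\mu)},\qquad \eta_\infty:=\int_0^\infty\frac{e^T\lambda_T}{e^{2T}-1}\exp\Bigl(\int_0^T\theta_u\,\mathrm{d}u\Bigr)\mathrm{d}T .$$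
   Context: $\gamma=\mathcal N(0,I)$ is the standard Gaussian on $\mathbb{R}^d$; measures and their Lebesgue densities are denoted by the same symbol. $(Q_s)_{s\ge0}$ is the Ornstein--Uhlenbeck semigroup, $Q_sf(x)=\mathbb{E}f(e^{-s}x+\sqrt{1-e^{-2s}}\,Z)$, $Z\sim\gamma$. For a probability measure $\rho$, $q_s^\rho=\rho Q_s$ is the law of $e^{-s}X+\sqrt{1-e^{-2s}}\,Z$ with $X\sim\rho$ and $Z\sim\gamma$ independent (so $q_0^\rho=\rho$ and $q_s^\rho/\gamma=Q_s[\rho/\gamma]$). $\preceq$ is the Loewner order. For $y\in\mathbb{R}^d$ and $t>0$, $\mu_{y,t}$ is the probability measure with density $\mu_{y,t}(x)\propto q_t(y\mid x)\,\mu(x)$, where $q_t(\cdot\mid x)$ is the density of $\mathcal N(e^{-t}x,(1-e^{-2t})I)$. Fisher informations: $\mathrm{FI}(\nu\,\|\,\mu)=\int\|\nabla\log(\nu/\mu)\|^2\,\mathrm{d}\nu$ and $\mathrm{FI}_\infty(\nu\,\|\,\mu)=\|\nabla\log(\nu/\mu)\|_{L^\infty(\nu)}^2=\mathrm{ess\,sup}_\nu\|\nabla\log(\nu/\mu)\|^2$, with the usual convention that these are $+\infty$ if $\nu\not\ll\mu$ or $\sqrt{\mathrm{d}\nu/\mathrm{d}\mu}$ is not weakly differentiable. A probability measure $\rho$ satisfies a log-Sobolev inequality with constant $\lambda>0$ if $\mathrm{KL}(\nu\,\|\,\rho)=\int\log(\nu/\rho)\,\mathrm{d}\nu\le\frac\lambda2\mathrm{FI}(\nu\,\|\,\rho)$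 for all probability measures $\nu$. Kim--Milman map (probability flow ODE): for a probability measure $\rho$ and $T>0$, $T_{\rm KM}^{\rho,T}:\mathbb{R}^d\to\mathbb{R}^d$ sends $x$ to the terminal point $X_T$ of the ODE $\dot X_t=X_t+\nabla\log q^\rho_{T-t}(X_t)$, $0\le t\le T$, $X_0=x$; it satisfies $(T_{\rm KM}^{\rho,T})_\sharp q_T^\rho=\rho$. The Kim--Milman map is $T_{\rm KM}^\rho=\lim_{T\to\infty}T_{\rm KM}^{\rho,T}$. Standing assumption: $T_{\rm KM}^\mu$ and $T_{\rm KM}^\nu$ are well-defined, in the sense that the flow maps exist and $T_{\rm KM}^{\mu,T}\to T_{\rm KM}^\mu$ and $T_{\rm KM}^{\nu,T}\to T_{\rm KM}^\nu$ uniformly on compact sets as $T\to\infty$. The functions $s\mapsto\theta_s$ and $t\mapsto\lambda_t$ are such that the integrals are well-defined. *)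

theory Defs
  imports "HOL-Probability.Probability"
begin

section \<open>Gaussians and the Ornstein--Uhlenbeck semigroup\<close>

text \<open>The state space is a Euclidean space \<open>'a\<close>, with \<open>d = DIM('a)\<close>.\<close>

text \<open>Lebesgue density of the normal law with mean \<open>m\<close> and covariance \<open>v I\<close>.\<close>

definition gauss_density :: "'a::euclidean_space \<Rightarrow> real \<Rightarrow> 'a \<Rightarrow> real" where
  "gauss_density m v y =
     (2 * pi * v) powr (- (real DIM('a) / 2)) * exp (- (norm (y - m))\<^sup>2 / (2 * v))"

definition std_gauss :: "'a::euclidean_space measure" where
  "std_gauss = density lborel (\<lambda>x. ennreal (gauss_density 0 1 x))"

definition ou_semigroup :: "real \<Rightarrow> ('a::euclidean_space \<Rightarrow> real) \<Rightarrow> 'a \<Rightarrow> real" where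
  "ou_semigroup s f x =
     (\<integral>z. f (exp (- s) *\<^sub>R x + sqrt (1 - exp (- 2 * s)) *\<^sub>R z) \<partial>std_gauss)"

definition ou_law :: "real \<Rightarrow> 'a::euclidean_space measure \<Rightarrow> 'a measure" where
  "ou_law s \<rho> = distr (\<rho> \<Otimes>\<^sub>M std_gauss) borel
     (\<lambda>(x, z). exp (- s) *\<^sub>R x + sqrt (1 - exp (- 2 * s)) *\<^sub>R z)"

text \<open>The transition density \<open>q\<^sub>s(y | x)\<close>; meaningful for \<open>s > 0\<close>.\<close>

definition ou_kernel :: "real \<Rightarrow> 'a::euclidean_space \<Rightarrow> 'a \<Rightarrow> real" where
  "ou_kernel s x y = gauss_density (exp (- s) *\<^sub>R x) (1 - exp (- 2 * s)) y"

text \<open>The smooth version of the Lebesgue density of \<^term>\<open>ou_law s \<rho>\<close> for \<open>s > 0\<close>;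
  see \<open>ou_law_eq_density\<close> and \<open>ou_semigroup_eq_density_ratio\<close> below.\<close>

definition ou_density :: "real \<Rightarrow> 'a::euclidean_space measure \<Rightarrow> 'a \<Rightarrow> real" where
  "ou_density s \<rho> y = (\<integral>x. ou_kernel s x y \<partial>\<rho>)"

text \<open>The measure \<open>\<mu>\<^bsub>y,t\<^esub>\<close>, whose density is proportional to \<open>x \<mapsto> q\<^sub>t(y | x) \<mu>(x)\<close>.\<close>

definition ou_posterior :: "'a::euclidean_space measure \<Rightarrow> 'a \<Rightarrow> real \<Rightarrow> 'a measure" where
  "ou_posterior \<mu> y t = density \<mu> (\<lambda>x. ennreal (ou_kernel t x y / ou_density t \<mu> y))"


section \<open>Gradients, Hessians, the Loewner order\<close>

definition grad :: "('a::real_inner \<Rightarrow> real) \<Rightarrow> 'a \<Rightarrow> 'a" where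
  "grad f x = (THE D. GDERIV f x :> D)"

text \<open>Matrices are represented by linear maps.\<close>

definition has_hessian :: "('a::real_inner \<Rightarrow> real) \<Rightarrow> ('a \<Rightarrow> 'a) \<Rightarrow> 'a \<Rightarrow> bool" where
  "has_hessian f H x \<longleftrightarrow>
     (\<exists>g. (\<forall>\<^sub>F z in nhds x. GDERIV f z :> g z) \<and> (g has_derivative H) (at x))"

definition loewner_le :: "('a::real_inner \<Rightarrow> 'a) \<Rightarrow> ('a \<Rightarrow> 'a) \<Rightarrow> bool" where
  "loewner_le A B \<longleftrightarrow> (\<forall>v. v \<bullet> A v \<le> v \<bullet> B v)"


section \<open>Relative entropy, Fisher informations, log-Sobolev inequality\<close>

text \<open>The library's \<^const>\<open>KL_divergence\<close> is a Bochner integral and hence \<open>0\<close> if the integrand is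
  not integrable. The negative part of \<open>log (d\<nu>/d\<rho>)\<close> is always \<open>\<nu>\<close>-integrable (for probability
  measures \<open>\<nu> \<lless> \<rho>\<close>), so non-integrability means that the value is infinite.\<close>

definition KL :: "'a measure \<Rightarrow> 'a measure \<Rightarrow> ennreal" where
  "KL \<nu> \<rho> =
     (if absolutely_continuous \<rho> \<nu> \<and> integrable \<nu> (entropy_density (exp 1) \<rho> \<nu>)
      then ennreal (KL_divergence (exp 1) \<rho> \<nu>) else \<infinity>)"

text \<open>\<open>g\<close> is the weak gradient (with respect to Lebesgue measure) of \<open>h\<close>; the test functions are
  the compactly supported \<open>C\<^sup>1\<close> functions, which is the same as testing with smooth ones.\<close>

definition has_weak_gradient ::
    "('a::euclidean_space \<Rightarrow> real) \<Rightarrow> ('a \<Rightarrow> 'a) \<Rightarrow> bool" where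
  "has_weak_gradient h g \<longleftrightarrow>
     (\<forall>K. compact K \<longrightarrow> set_integrable lborel K h \<and> set_integrable lborel K g) \<and>
     (\<forall>\<phi> D\<phi>. (\<forall>x. GDERIV \<phi> x :> D\<phi> x) \<and> continuous_on UNIV D\<phi> \<and> compact (closure {x. \<phi> x \<noteq> 0})
        \<longrightarrow> (\<integral>x. h x *\<^sub>R D\<phi> x \<partial>lborel) = - (\<integral>x. \<phi> x *\<^sub>R g x \<partial>lborel))"

definition weakly_differentiable :: "('a::euclidean_space \<Rightarrow> real) \<Rightarrow> bool" where
  "weakly_differentiable h \<longleftrightarrow> (\<exists>g. has_weak_gradient h g)"

text \<open>Weak gradients are unique up to Lebesgue null sets.\<close>

definition weak_gradient :: "('a::euclidean_space \<Rightarrow> real) \<Rightarrow> 'a \<Rightarrow> 'a" where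
  "weak_gradient h = (SOME g. has_weak_gradient h g)"

definition sqrt_ratio :: "'a measure \<Rightarrow> 'a measure \<Rightarrow> 'a \<Rightarrow> real" where
  "sqrt_ratio \<nu> \<mu> x = sqrt (enn2real (RN_deriv \<mu> \<nu> x))"

text \<open>\<open>\<nabla>log (\<nu>/\<mu>) = 2 \<nabla>\<surd>(\<nu>/\<mu>) / \<surd>(\<nu>/\<mu>)\<close>, which makes sense \<open>\<nu>\<close>-almost everywhere as soon as the square
  root is weakly differentiable. The notion is meant for \<open>\<mu>\<close> equivalent to Lebesgue measure, so
  that the choice of the versions of the Radon--Nikodym derivative and of the weak
  gradient is immaterial.\<close>

definition grad_log_ratio :: "'a::euclidean_space measure \<Rightarrow> 'a measure \<Rightarrow> 'a \<Rightarrow> 'a" where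
  "grad_log_ratio \<nu> \<mu> x = (2 / sqrt_ratio \<nu> \<mu> x) *\<^sub>R weak_gradient (sqrt_ratio \<nu> \<mu>) x"

definition FI :: "'a::euclidean_space measure \<Rightarrow> 'a measure \<Rightarrow> ennreal" where
  "FI \<nu> \<mu> =
     (if absolutely_continuous \<mu> \<nu> \<and> weakly_differentiable (sqrt_ratio \<nu> \<mu>)
      then (\<integral>\<^sup>+x. ennreal ((norm (grad_log_ratio \<nu> \<mu> x))\<^sup>2) \<partial>\<nu>) else \<infinity>)"

definition Linf_norm :: "'a measure \<Rightarrow> ('a \<Rightarrow> 'b::real_normed_vector) \<Rightarrow> ennreal" where
  "Linf_norm M f = esssup M (\<lambda>x. ennreal (norm (f x)))"

definition FI_infty :: "'a::euclidean_space measure \<Rightarrow> 'a measure \<Rightarrow> ennreal" where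
  "FI_infty \<nu> \<mu> =
     (if absolutely_continuous \<mu> \<nu> \<and> weakly_differentiable (sqrt_ratio \<nu> \<mu>)
      then (Linf_norm \<nu> (grad_log_ratio \<nu> \<mu>))\<^sup>2 else \<infinity>)"

definition ennreal_sqrt :: "ennreal \<Rightarrow> ennreal" where
  "ennreal_sqrt a = (if a = \<infinity> then \<infinity> else ennreal (sqrt (enn2real a)))"

definition log_sobolev :: "'a::euclidean_space measure \<Rightarrow> real \<Rightarrow> bool" where
  "log_sobolev \<rho> c \<longleftrightarrow> 0 < c \<and>
     (\<forall>\<nu>. prob_space \<nu> \<and> sets \<nu> = sets borel \<longrightarrow> KL \<nu> \<rho> \<le> ennreal (c / 2) * FI \<nu> \<rho>)"


section \<open>The Kim--Milman map\<close>

text \<open>At the final time \<open>t = T\<close> the drift would involve the density of \<open>\<rho>\<close> itself, which need not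
  exist and has no canonical version; there only continuity of the trajectory is required, so the
  terminal point is \<open>X T = lim\<^bsub>t \<rightarrow> T\<^esub> X t\<close>.\<close>

definition km_ode :: "'a::euclidean_space measure \<Rightarrow> real \<Rightarrow> (real \<Rightarrow> 'a) \<Rightarrow> bool" where
  "km_ode \<rho> T X \<longleftrightarrow> continuous_on {0..T} X \<and>
     (\<forall>t\<in>{0..<T}. (X has_vector_derivative
        X t + grad (\<lambda>x. ln (ou_density (T - t) \<rho> x)) (X t)) (at t within {0..T}))"

definition km_endpoint :: "'a::euclidean_space measure \<Rightarrow> real \<Rightarrow> 'a \<Rightarrow> 'a \<Rightarrow> bool" where
  "km_endpoint \<rho> T x y \<longleftrightarrow> (\<exists>X. km_ode \<rho> T X \<and> X 0 = x \<and> X T = y)"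

definition km_map_upto :: "'a::euclidean_space measure \<Rightarrow> real \<Rightarrow> 'a \<Rightarrow> 'a" where
  "km_map_upto \<rho> T x = (THE y. km_endpoint \<rho> T x y)"

definition km_map :: "'a::euclidean_space measure \<Rightarrow> 'a \<Rightarrow> 'a" where
  "km_map \<rho> x = Lim at_top (\<lambda>T. km_map_upto \<rho> T x)"

definition km_well_defined :: "'a::euclidean_space measure \<Rightarrow> bool" where
  "km_well_defined \<rho> \<longleftrightarrow>
     (\<forall>T>0. \<forall>x. \<exists>!y. km_endpoint \<rho> T x y) \<and>
     (\<forall>K. compact K \<longrightarrow> uniform_limit K (km_map_upto \<rho>) (km_map \<rho>) at_top)"


section \<open>The constant\<close>

definition eta_infty :: "(real \<Rightarrow> real) \<Rightarrow> (real \<Rightarrow> real) \<Rightarrow> ennreal" where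
  "eta_infty \<theta> lam =
     (\<integral>\<^sup>+T. ennreal (exp T * lam T / (exp (2 * T) - 1) * exp (integral {0..T} \<theta>))
        \<partial>lebesgue_on {0<..})"


section \<open>Consistency of the explicit densities\<close>

lemma gauss_density_nonneg: "0 \<le> gauss_density m v y"
  by (simp add: gauss_density_def)

lemma gauss_density_measurable [measurable]:
  "gauss_density m v \<in> borel_measurable (borel :: 'a::euclidean_space measure)"
  unfolding gauss_density_def by measurable

lemma sets_std_gauss [measurable_cong, simp]: "sets std_gauss = sets borel"
  by (simp add: std_gauss_def)

lemma space_std_gauss [simp]: "space std_gauss = UNIV"
  by (simp add: std_gauss_def)

lemma gauss_density_std_prod:
  fixes x :: "'a::euclidean_space"
  shows "gauss_density 0 1 x = (\<Prod>b\<in>Basis. normal_density 0 1 (x \<bullet> b))"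
proof -
  have "(\<Prod>b\<in>(Basis::'a set). normal_density 0 1 (x \<bullet> b))
      = (1 / sqrt (2 * pi)) ^ DIM('a) * exp (\<Sum>b\<in>Basis. - (x \<bullet> b)\<^sup>2 / 2)"
    proof -
    have "normal_density 0 1 u = (1 / sqrt (2 * pi)) * exp (- u\<^sup>2 / 2)" for u
      by (simp add: normal_density_def)
    then show ?thesis
      by (simp only: prod.distrib prod_constant exp_sum[OF finite_Basis])
  qed
  also have "(\<Sum>b\<in>Basis. - (x \<bullet> b)\<^sup>2 / 2) = - (norm x)\<^sup>2 / 2"
    unfolding power2_norm_eq_inner euclidean_inner[of x x]
    by (simp add: power2_eq_square sum_negf sum_divide_distrib[symmetric])
  also have "(1 / sqrt (2 * pi)) ^ DIM('a) = (2 * pi) powr (- (real DIM('a) / 2))"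
  proof -
    have "(1 / sqrt (2 * pi)) = (2 * pi) powr (- (1/2))"
      by (simp add: powr_minus powr_half_sqrt divide_simps)
    then show ?thesis
      by (simp add: powr_powr flip: powr_realpow)
  qed
  finally show ?thesis
    by (simp add: gauss_density_def)
qed

lemma prob_space_std_gauss: "prob_space (std_gauss :: 'a::euclidean_space measure)"
proof
  have "emeasure (std_gauss :: 'a measure) (space std_gauss)
      = (\<integral>\<^sup>+x. ennreal (gauss_density 0 1 x) \<partial>(lborel :: 'a measure))"
    by (simp add: std_gauss_def emeasure_density)
  also have "\<dots> = (\<integral>\<^sup>+x. (\<Prod>b\<in>Basis. ennreal (normal_density 0 1 (x \<bullet> b))) \<partial>(lborel :: 'a measure))"
    by (simp add: gauss_density_std_prod prod_ennreal)
  also have "\<dots> = (\<Prod>b\<in>(Basis::'a set). (\<integral>\<^sup>+x. ennreal (normal_density 0 1 x) \<partial>lborel))"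
    by (rule nn_integral_lborel_prod) auto
  also have "\<dots> = 1"
    using prob_space.emeasure_space_1[OF prob_space_normal_density[of 1 0]]
    by (simp add: emeasure_density)
  finally show "emeasure (std_gauss :: 'a measure) (space std_gauss) = 1" .
qed

lemma gauss_density_affine:
  fixes m :: "'a::euclidean_space"
  assumes "0 < \<sigma>"
  shows "\<sigma> ^ DIM('a) * gauss_density m (\<sigma>\<^sup>2) (m + \<sigma> *\<^sub>R z) = gauss_density 0 1 z"
proof -
  have "(2 * pi * \<sigma>\<^sup>2) powr (- (real DIM('a) / 2))
      = (2 * pi) powr (- (real DIM('a) / 2)) * (\<sigma> ^ 2) powr (- (real DIM('a) / 2))"
    by (simp add: powr_mult)
  also have "(\<sigma> ^ 2) powr (- (real DIM('a) / 2)) = inverse (\<sigma> ^ DIM('a))"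
    using assms by (simp add: powr_powr powr_minus powr_realpow flip: powr_numeral)
  finally show ?thesis
    using assms by (simp add: gauss_density_def power_mult_distrib field_simps)
qed

lemma distr_std_gauss_affine:
  fixes m :: "'a::euclidean_space"
  assumes "0 < \<sigma>"
  shows "distr std_gauss borel (\<lambda>z. m + \<sigma> *\<^sub>R z) = density lborel (\<lambda>y. ennreal (gauss_density m (\<sigma>\<^sup>2) y))"
proof (rule measure_eqI)
  fix A :: "'a set"
  assume "A \<in> sets (distr std_gauss borel (\<lambda>z. m + \<sigma> *\<^sub>R z))"
  then have A [measurable]: "A \<in> sets borel" by simp
  have "emeasure (density lborel (\<lambda>y. ennreal (gauss_density m (\<sigma>\<^sup>2) y))) A
      = (\<integral>\<^sup>+y. ennreal (gauss_density m (\<sigma>\<^sup>2) y) * indicator A y \<partial>lborel)"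
    by (simp add: emeasure_density)
  also have "\<dots> = (\<integral>\<^sup>+z. ennreal (\<sigma> ^ DIM('a)) * (ennreal (gauss_density m (\<sigma>\<^sup>2) (m + \<sigma> *\<^sub>R z))
      * indicator A (m + \<sigma> *\<^sub>R z)) \<partial>lborel)"
    using assms by (subst lborel_affine[of \<sigma> m]) (auto simp: nn_integral_density nn_integral_distr)
  also have "\<dots> = (\<integral>\<^sup>+z. ennreal (gauss_density 0 1 z) * indicator A (m + \<sigma> *\<^sub>R z) \<partial>lborel)"
    using assms
    by (intro nn_integral_cong)
      (simp add: gauss_density_affine[of \<sigma> m, symmetric] ennreal_mult gauss_density_nonneg mult.assoc)
  also have "\<dots> = emeasure (distr std_gauss borel (\<lambda>z. m + \<sigma> *\<^sub>R z)) A"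
    proof -
    have "emeasure (distr std_gauss borel (\<lambda>z. m + \<sigma> *\<^sub>R z)) A
        = (\<integral>\<^sup>+y. indicator A y \<partial>distr std_gauss borel (\<lambda>z. m + \<sigma> *\<^sub>R z))"
      by simp
    also have "\<dots> = (\<integral>\<^sup>+z. indicator A (m + \<sigma> *\<^sub>R z) \<partial>std_gauss)"
      by (subst nn_integral_distr) auto
    also have "\<dots> = (\<integral>\<^sup>+z. ennreal (gauss_density 0 1 z) * indicator A (m + \<sigma> *\<^sub>R z) \<partial>lborel)"
      unfolding std_gauss_def by (subst nn_integral_density) auto
    finally show ?thesis by simp
  qed
  finally show "emeasure (distr std_gauss borel (\<lambda>z. m + \<sigma> *\<^sub>R z)) A
      = emeasure (density lborel (\<lambda>y. ennreal (gauss_density m (\<sigma>\<^sup>2) y))) A" by simp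
qed simp

lemma ou_kernel_measurable [measurable]:
  "(\<lambda>(x, y). ou_kernel s x y) \<in> borel_measurable (borel \<Otimes>\<^sub>M (borel :: 'a::euclidean_space measure))"
  unfolding ou_kernel_def gauss_density_def by measurable

lemma distr_ou_kernel:
  assumes "0 < s"
  shows "distr std_gauss borel (\<lambda>z. exp (- s) *\<^sub>R x + sqrt (1 - exp (- 2 * s)) *\<^sub>R z)
    = density lborel (\<lambda>y. ennreal (ou_kernel s x y))"
  using distr_std_gauss_affine[of "sqrt (1 - exp (- 2 * s))" "exp (- s) *\<^sub>R x"] assms
  by (simp add: ou_kernel_def)

lemma ou_kernel_bound:
  fixes x y :: "'a::euclidean_space"
  assumes "0 < s"
  shows "0 \<le> ou_kernel s x y"
    and "ou_kernel s x y \<le> (2 * pi * (1 - exp (- 2 * s))) powr (- (real DIM('a) / 2))"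
  using assms by (auto simp: ou_kernel_def gauss_density_def intro!: mult_left_le)

theorem ou_law_eq_density:
  fixes \<rho> :: "'a::euclidean_space measure"
  assumes "prob_space \<rho>" and [measurable_cong, simp]: "sets \<rho> = sets borel" and s: "0 < s"
  shows "ou_law s \<rho> = density lborel (\<lambda>y. ennreal (ou_density s \<rho> y))"
proof (rule measure_eqI)
  interpret \<rho>: prob_space \<rho> by fact
  interpret G: prob_space "std_gauss :: 'a measure" by (rule prob_space_std_gauss)
  interpret PL: pair_sigma_finite \<rho> "lborel :: 'a measure" ..
  have [measurable]: "ou_density s \<rho> \<in> borel_measurable borel"
    unfolding ou_density_def by measurable
  fix A assume "A \<in> sets (ou_law s \<rho>)"
  then have A [measurable]: "A \<in> sets borel" by (simp add: ou_law_def)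
  have dens: "ennreal (ou_density s \<rho> y) = (\<integral>\<^sup>+x. ennreal (ou_kernel s x y) \<partial>\<rho>)" for y
    unfolding ou_density_def
    by (intro nn_integral_eq_integral[symmetric] \<rho>.integrable_const_bound[where B =
          "(2 * pi * (1 - exp (- 2 * s))) powr (- (real DIM('a) / 2))"])
      (auto simp: ou_kernel_bound[OF s] ou_kernel_bound(2)[OF s, simplified] abs_of_nonneg)
  have "emeasure (ou_law s \<rho>) A = (\<integral>\<^sup>+w. indicator A (case w of (x, z) \<Rightarrow>
      exp (- s) *\<^sub>R x + sqrt (1 - exp (- 2 * s)) *\<^sub>R z) \<partial>(\<rho> \<Otimes>\<^sub>M std_gauss))"
  proof -
    have "emeasure (ou_law s \<rho>) A = (\<integral>\<^sup>+y. indicator A y \<partial>ou_law s \<rho>)"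
      by (simp add: ou_law_def)
    then show ?thesis
      unfolding ou_law_def by (subst (asm) nn_integral_distr) auto
  qed
  also have "\<dots> = (\<integral>\<^sup>+x. \<integral>\<^sup>+z. indicator A
      (exp (- s) *\<^sub>R x + sqrt (1 - exp (- 2 * s)) *\<^sub>R z) \<partial>std_gauss \<partial>\<rho>)"
    by (subst G.nn_integral_fst[symmetric]) auto
  also have "\<dots> = (\<integral>\<^sup>+x. \<integral>\<^sup>+y. ennreal (ou_kernel s x y) * indicator A y \<partial>lborel \<partial>\<rho>)"
  proof (intro nn_integral_cong)
    fix x
    have "(\<integral>\<^sup>+z. indicator A (exp (- s) *\<^sub>R x + sqrt (1 - exp (- 2 * s)) *\<^sub>R z) \<partial>std_gauss)
      = (\<integral>\<^sup>+y. indicator A y \<partial>distr std_gauss borel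
           (\<lambda>z. exp (- s) *\<^sub>R x + sqrt (1 - exp (- 2 * s)) *\<^sub>R z))"
      by (subst nn_integral_distr) auto
    also have "\<dots> = (\<integral>\<^sup>+y. ennreal (ou_kernel s x y) * indicator A y \<partial>lborel)"
      unfolding distr_ou_kernel[OF s] by (subst nn_integral_density) auto
    finally show "(\<integral>\<^sup>+z. indicator A (exp (- s) *\<^sub>R x + sqrt (1 - exp (- 2 * s)) *\<^sub>R z) \<partial>std_gauss)
      = (\<integral>\<^sup>+y. ennreal (ou_kernel s x y) * indicator A y \<partial>lborel)" .
  qed
  also have "\<dots> = (\<integral>\<^sup>+y. \<integral>\<^sup>+x. ennreal (ou_kernel s x y) * indicator A y \<partial>\<rho> \<partial>lborel)"
    by (subst PL.Fubini') auto
  also have "\<dots> = (\<integral>\<^sup>+y. ennreal (ou_density s \<rho> y) * indicator A y \<partial>lborel)"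
    by (simp add: dens nn_integral_multc)
  also have "\<dots> = emeasure (density lborel (\<lambda>y. ennreal (ou_density s \<rho> y))) A"
    by (simp add: emeasure_density)
  finally show "emeasure (ou_law s \<rho>) A
      = emeasure (density lborel (\<lambda>y. ennreal (ou_density s \<rho> y))) A" .
qed (simp add: ou_law_def)

text \<open>Reversibility of the Ornstein--Uhlenbeck kernel with respect to the Gaussian.\<close>

lemma ou_kernel_reversible:
  assumes "0 < s"
  shows "gauss_density 0 1 x * ou_kernel s x y = gauss_density 0 1 y * ou_kernel s y x"
proof -
  define a where "a = exp (- s)"
  have a2: "exp (- 2 * s) = a\<^sup>2" unfolding a_def by (simp flip: exp_of_nat_mult)
  have "a < 1" "0 < a" using assms by (auto simp: a_def)
  then have v: "1 - a\<^sup>2 > 0" by (simp add: power_less_one_iff)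
  have "- (norm x)\<^sup>2 / 2 + - (norm (y - a *\<^sub>R x))\<^sup>2 / (2 * (1 - a\<^sup>2))
      = - (norm y)\<^sup>2 / 2 + - (norm (x - a *\<^sub>R y))\<^sup>2 / (2 * (1 - a\<^sup>2))"
    using v unfolding power2_norm_eq_inner
    by (simp add: inner_diff inner_commute field_simps power2_eq_square)
  then have "exp (- (norm x)\<^sup>2 / 2) * exp (- (norm (y - a *\<^sub>R x))\<^sup>2 / (2 * (1 - a\<^sup>2)))
      = exp (- (norm y)\<^sup>2 / 2) * exp (- (norm (x - a *\<^sub>R y))\<^sup>2 / (2 * (1 - a\<^sup>2)))"
    unfolding exp_add[symmetric] by simp
  then show ?thesis
    unfolding ou_kernel_def gauss_density_def a2 a_def[symmetric] by simp
qed

text \<open>\<open>q\<^sub>s\<^sup>\<mu> / \<gamma> = Q\<^sub>s [\<mu>/\<gamma>]\<close>, so that \<open>\<nabla>\<^sup>2 log Q\<^sub>s [\<mu>/\<gamma>] = I + \<nabla>\<^sup>2 log q\<^sub>s\<^sup>\<mu>\<close>.\<close>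

theorem ou_semigroup_eq_density_ratio:
  fixes f :: "'a::euclidean_space \<Rightarrow> real"
  assumes [measurable]: "f \<in> borel_measurable borel" and f: "\<And>x. 0 \<le> f x" and s: "0 < s"
  shows "ou_semigroup s f x
    = ou_density s (density std_gauss (\<lambda>x. ennreal (f x))) x / gauss_density 0 1 x"
proof -
  have pos: "gauss_density 0 1 x > 0" by (simp add: gauss_density_def)
  have "ou_semigroup s f x = (\<integral>y. f y \<partial>distr std_gauss borel
      (\<lambda>z. exp (- s) *\<^sub>R x + sqrt (1 - exp (- 2 * s)) *\<^sub>R z))"
    unfolding ou_semigroup_def by (subst integral_distr) auto
  also have "\<dots> = (\<integral>y. ou_kernel s x y * f y \<partial>lborel)"
    unfolding distr_ou_kernel[OF s]
    by (subst integral_density) (auto simp: ou_kernel_bound[OF s])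
  also have "\<dots> = (\<integral>y. gauss_density 0 1 y * (f y * ou_kernel s y x) / gauss_density 0 1 x \<partial>lborel)"
    using pos by (intro Bochner_Integration.integral_cong refl)
      (simp add: field_simps ou_kernel_reversible[OF s, of x])
  also have "\<dots> = (\<integral>y. gauss_density 0 1 y * (f y * ou_kernel s y x) \<partial>lborel) / gauss_density 0 1 x"
    by simp
  also have "(\<integral>y. gauss_density 0 1 y * (f y * ou_kernel s y x) \<partial>lborel)
      = ou_density s (density std_gauss (\<lambda>x. ennreal (f x))) x"
    unfolding ou_density_def using f
    by (subst integral_density)
      (auto simp: std_gauss_def integral_density gauss_density_nonneg)
  finally show ?thesis .
qed

end

theory Submission
  imports Defs
begin

text \<open>
  Fix a starting point \<open>x\<close> and a horizon \<open>T\<close>, and let \<open>X\<close> and \<open>Y\<close> be the trajectories of the two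
  probability flow equations started at \<open>x\<close>. Write \<open>s = T - t\<close> for the noise level at time \<open>t\<close>. The
  difference of the two drifts splits as the drift of \<open>\<mu>\<close> taken at \<open>X\<close> and at \<open>Y\<close>, plus the difference
  of the two scores at \<open>Y\<close>. The first part is controlled by the Hessian bound: it says that the drift
  \<open>\<nabla> log Q\<^sub>s[\<mu>/\<gamma>]\<close> is one-sided Lipschitz with constant \<open>\<theta>\<^sub>s\<close> (\<open>drift_one_sided_lipschitz\<close>). If the
  second part is at most \<open>e\<^sup>s \<lambda>\<^sub>s L / (e\<^sup>2\<^sup>s - 1)\<close> with \<open>L\<^sup>2 = FI\<^sub>\<infinity>\<close> (\<open>score_difference\<close>), then Gronwall's
  inequality bounds \<open>|X\<^sub>T - Y\<^sub>T|\<close> by the part of \<open>\<eta>\<^sub>\<infinity> L\<close> that comes from \<open>[0,T]\<close>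
  (\<open>km_map_upto_difference\<close>), uniformly in \<open>x\<close>, and \<open>T \<rightarrow> \<infinity>\<close> gives the claim.

  The bound on the scores comes from Tweedie's formula: \<open>\<nabla> log q\<^sub>s\<^sup>\<rho> (y)\<close> is affine in the mean of the
  posterior \<open>\<rho>\<^bsub>y,s\<^esub>\<close> (\<open>GDERIV_ln_ou_density\<close>), so that the difference of the scores is
  \<open>e\<^sup>-\<^sup>s / (1 - e\<^sup>-\<^sup>2\<^sup>s)\<close> times the difference of the means of \<open>\<nu>\<^bsub>y,s\<^esub>\<close> and \<open>\<mu>\<^bsub>y,s\<^esub>\<close>. The ratio of these two
  posteriors is a constant multiple of \<open>\<nu>/\<mu>\<close>; hence it has the same logarithmic gradient, and their
  relative Fisher information is at most \<open>L\<^sup>2\<close> (\<open>FI_ou_posterior_le\<close>). The log-Sobolev inequality is then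
  used twice: it bounds the relative entropy of the posteriors by \<open>\<lambda>\<^sub>s L\<^sup>2 / 2\<close>, and, through the Herbst
  argument, it bounds the Laplace transform of linear functions under \<open>\<mu>\<^bsub>y,s\<^esub>\<close>. The Donsker--Varadhan
  duality combines the two into a bound \<open>\<lambda>\<^sub>s L\<close> on the difference of means (\<open>linear_mean_difference\<close>);
  this is the transport inequality of Otto and Villani, restricted to linear test functions.

  Two technical points need work. The Fisher information is defined through an arbitrary choice of
  a weak gradient, so that computing it requires the uniqueness of weak gradients
  (\<open>has_weak_gradient_unique\<close>). And the essential supremum of a function that is not measurable is
  infinite, so that the Kim--Milman maps have to be shown measurable (\<open>km_map_measurable\<close>): they are
  pointwise limits of flow maps up to times \<open>t < T\<close>, and these are continuous because the scores are
  locally Lipschitz at positive noise levels.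
\<close>


section \<open>Differentiation under the integral and Gronwall inequalities\<close>

text \<open>The difference quotients of the integrand are dominated by the bound on its gradient, by the mean
  value theorem, so that dominated convergence applies along every sequence that tends to the point.\<close>

lemma GDERIV_integral:
  fixes F :: "'b \<Rightarrow> 'a::euclidean_space \<Rightarrow> real"
  assumes r: "0 < r"
    and int: "\<And>y. y \<in> ball y0 r \<Longrightarrow> integrable M (\<lambda>x. F x y)"
    and deriv: "\<And>x y. x \<in> space M \<Longrightarrow> y \<in> ball y0 r \<Longrightarrow> GDERIV (F x) y :> G x y"
    and bound: "\<And>x y. x \<in> space M \<Longrightarrow> y \<in> ball y0 r \<Longrightarrow> norm (G x y) \<le> w x"
    and w: "integrable M w"
    and meas: "(\<lambda>x. G x y0) \<in> borel_measurable M"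
  shows "GDERIV (\<lambda>y. \<integral>x. F x y \<partial>M) y0 :> (\<integral>x. G x y0 \<partial>M)"
proof -
  have y0: "y0 \<in> ball y0 r" using r by simp
  have intG: "integrable M (\<lambda>x. G x y0)"
    by (rule Bochner_Integration.integrable_bound[OF w meas])
       (auto intro!: AE_I2 order_trans[OF bound[OF _ y0]])
  \<comment> \<open>the first-order Taylor remainder of the integrand\<close>
  define R where "R x y = F x y - F x y0 - (y - y0) \<bullet> G x y0" for x y
  have R_bound: "\<bar>R x y\<bar> \<le> 2 * w x * norm (y - y0)" if x: "x \<in> space M" and y: "y \<in> ball y0 r" for x y
  proof -
    have "norm (F x y - F x y0) \<le> w x * norm (y - y0)"
    proof (rule differentiable_bound[of "ball y0 r" "F x" "\<lambda>z h. h \<bullet> G x z"])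
      fix z assume z: "z \<in> ball y0 r"
      show "(F x has_derivative (\<lambda>h. h \<bullet> G x z)) (at z within ball y0 r)"
        using deriv[OF x z] unfolding gderiv_def by (rule has_derivative_at_withinI)
      show "onorm (\<lambda>h. h \<bullet> G x z) \<le> w x"
      proof (rule onorm_bound)
        show "0 \<le> w x" using bound[OF x z] norm_ge_zero order_trans by blast
        fix h
        have "norm (h \<bullet> G x z) \<le> norm h * norm (G x z)"
          by (simp add: Cauchy_Schwarz_ineq2)
        also have "\<dots> \<le> w x * norm h"
          using bound[OF x z] by (simp add: mult.commute mult_left_mono)
        finally show "norm (h \<bullet> G x z) \<le> w x * norm h" .
      qed
    qed (use y y0 in auto)
    moreover have "\<bar>(y - y0) \<bullet> G x y0\<bar> \<le> norm (y - y0) * w x"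
      using Cauchy_Schwarz_ineq2[of "y - y0" "G x y0"] bound[OF x y0]
      by (meson mult_left_mono norm_ge_zero order_trans)
    ultimately show ?thesis
      unfolding R_def by (simp add: algebra_simps)
  qed
  have key: "((\<lambda>y. (\<integral>x. R x y / norm (y - y0) \<partial>M)) \<longlongrightarrow> 0) (at y0 within ball y0 r)"
    unfolding tendsto_at_iff_sequentially comp_def
  proof (intro allI impI)
    fix Y :: "nat \<Rightarrow> 'a" assume Y: "\<forall>i. Y i \<in> ball y0 r - {y0}" and lim: "Y \<longlonglongrightarrow> y0"
    have "(\<lambda>n. \<integral>x. R x (Y n) / norm (Y n - y0) \<partial>M) \<longlonglongrightarrow> (\<integral>x. 0 \<partial>M)"
    proof (rule integral_dominated_convergence)
      show "integrable M (\<lambda>x. 2 * w x)" using w by simp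
      show "(\<lambda>x. R x (Y n) / norm (Y n - y0)) \<in> borel_measurable M" for n
        unfolding R_def using int[OF y0] int[of "Y n"] intG Y by auto
      show "AE x in M. norm (R x (Y n) / norm (Y n - y0)) \<le> 2 * w x" for n
        using R_bound[of _ "Y n"] Y by (intro AE_I2) (auto simp: divide_simps)
      show "AE x in M. (\<lambda>n. R x (Y n) / norm (Y n - y0)) \<longlonglongrightarrow> 0"
      proof (rule AE_I2)
        fix x assume x: "x \<in> space M"
        have "((\<lambda>y. norm (R x y) / norm (y - y0)) \<longlongrightarrow> 0) (at y0 within ball y0 r)"
          using deriv[OF x y0, unfolded gderiv_def, THEN has_derivative_at_withinI[of _ _ _ "ball y0 r"]]
          unfolding has_derivative_iff_norm R_def by simp
        then have "(\<lambda>n. norm (R x (Y n)) / norm (Y n - y0)) \<longlonglongrightarrow> 0"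
          using Y lim unfolding tendsto_at_iff_sequentially comp_def by auto
        then show "(\<lambda>n. R x (Y n) / norm (Y n - y0)) \<longlonglongrightarrow> 0"
          by (subst tendsto_norm_zero_iff[symmetric]) simp
      qed
    qed simp
    then show "(\<lambda>n. \<integral>x. R x (Y n) / norm (Y n - y0) \<partial>M) \<longlonglongrightarrow> 0" by simp
  qed
  have eq: "norm ((\<integral>x. F x y \<partial>M) - (\<integral>x. F x y0 \<partial>M) - (y - y0) \<bullet> (\<integral>x. G x y0 \<partial>M)) / norm (y - y0)
    = norm (\<integral>x. R x y / norm (y - y0) \<partial>M)" if "y \<in> ball y0 r" for y
  proof -
    have "(\<integral>x. R x y \<partial>M) = (\<integral>x. F x y \<partial>M) - (\<integral>x. F x y0 \<partial>M) - (y - y0) \<bullet> (\<integral>x. G x y0 \<partial>M)"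
      unfolding R_def using int[OF that] int[OF y0] intG by simp
    then show ?thesis by simp
  qed
  have "((\<lambda>y. norm ((\<integral>x. F x y \<partial>M) - (\<integral>x. F x y0 \<partial>M) - (y - y0) \<bullet> (\<integral>x. G x y0 \<partial>M)) / norm (y - y0))
     \<longlongrightarrow> 0) (at y0 within ball y0 r)"
    using tendsto_norm_zero[OF key]
    by (rule Lim_transform_eventually)
      (unfold eventually_at_filter, intro always_eventually allI impI, rule eq[symmetric])
  then have "((\<lambda>y. \<integral>x. F x y \<partial>M) has_derivative (\<lambda>h. h \<bullet> (\<integral>x. G x y0 \<partial>M))) (at y0 within ball y0 r)"
    unfolding has_derivative_iff_norm by (simp add: bounded_linear_inner_left)
  then show ?thesis
    unfolding gderiv_def using y0 by (simp add: at_within_open[OF y0 open_ball])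
qed

lemma absolutely_integrable_continuous_mult:
  fixes f g :: "real \<Rightarrow> real"
  assumes f: "continuous_on {a..b} f" and g: "g absolutely_integrable_on {a..b}"
  shows "(\<lambda>u. f u * g u) absolutely_integrable_on {a..b}"
  using absolutely_integrable_bounded_measurable_product_real[OF _ _ _ g, of f]
    continuous_imp_measurable_on_sets_lebesgue[OF f] compact_continuous_image[OF f]
  by (auto intro: compact_imp_bounded)

lemma locally_nonincreasing_imp_le:
  fixes g :: "real \<Rightarrow> real"
  assumes "0 \<le> T" "0 < \<delta>"
    and step: "\<And>r t. 0 \<le> r \<Longrightarrow> r \<le> t \<Longrightarrow> t \<le> T \<Longrightarrow> t - r < \<delta> \<Longrightarrow> g t \<le> g r"
  shows "g T \<le> g 0"
proof -
  obtain n :: nat where n: "T / \<delta> < real n" "0 < n"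
    using reals_Archimedean2[of "max 1 (T/\<delta>)"] by (auto intro: gr0I)
  have Tn: "T / n < \<delta>" using n assms by (simp add: field_simps)
  have "k \<le> n \<Longrightarrow> g (T / n * k) \<le> g 0" for k
  proof (induction k)
    case (Suc k)
    have "g (T / n * Suc k) \<le> g (T / n * k)"
    proof (rule step)
      show "T / n * Suc k \<le> T" using Suc.prems n assms(1)
        by (simp add: field_simps mult_left_mono flip: of_nat_Suc)
    qed (use n assms Tn in \<open>auto simp: field_simps\<close>)
    then show ?case using Suc by simp
  qed simp
  from this[of n] show ?thesis using n by simp
qed

text \<open>The coefficient \<open>a\<close> is only integrable, so that the integrating factor
  \<open>E(t) = exp (\<integral>\<^sub>t\<^sup>T a)\<close> is merely absolutely continuous. Instead of differentiating \<open>E p\<close>, its increment over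
  a short interval is estimated with the convexity of the exponential; the error is at most \<open>\<epsilon>\<close> times
  an integral over that interval, and hence adds up to a multiple of \<open>\<epsilon>\<close> over a partition.\<close>

lemma gronwall_integral:
  fixes p a b :: "real \<Rightarrow> real"
  assumes T: "0 \<le> T" and p: "continuous_on {0..T} p"
    and a: "a absolutely_integrable_on {0..T}" and b: "b absolutely_integrable_on {0..T}"
    and b_nonneg: "\<And>t. 0 \<le> b t" and p_nonneg: "\<And>t. 0 \<le> p t"
    and ineq: "\<And>r t. 0 \<le> r \<Longrightarrow> r \<le> t \<Longrightarrow> t \<le> T \<Longrightarrow> p t - p r \<le> integral {r..t} (\<lambda>u. a u * p u + b u)"
  shows "p T \<le> exp (integral {0..T} a) * p 0 + integral {0..T} (\<lambda>u. exp (integral {u..T} a) * b u)"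
proof -
  define A where "A t = integral {0..t} a" for t
  define E where "E t = exp (A T - A t)" for t
  have sub: "f absolutely_integrable_on {r..t}" if "f absolutely_integrable_on {0..T}" "0 \<le> r" "t \<le> T"
    for f :: "real \<Rightarrow> real" and r t
    using that by (auto intro: set_integrable_subset)
  have ai: "a integrable_on {r..t}" "b integrable_on {r..t}" if "0 \<le> r" "t \<le> T" for r t
    using sub[OF a that] sub[OF b that] by (auto intro: set_lebesgue_integral_eq_integral(1))
  have A_cont: "continuous_on {0..T} A"
    unfolding A_def by (rule indefinite_integral_continuous_1) (use ai in auto)
  then have E_cont: "continuous_on {0..T} E"
    unfolding E_def by (intro continuous_intros)
  have A_diff: "A t - A r = integral {r..t} a" if "0 \<le> r" "r \<le> t" "t \<le> T" for r t
    unfolding A_def using Henstock_Kurzweil_Integration.integral_combine[of 0 r t a] that ai[of 0 t] by simp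
  have E_eq: "E t = exp (integral {t..T} a)" if "0 \<le> t" "t \<le> T" for t
    unfolding E_def using A_diff[OF that] by simp
  obtain M where M: "\<And>t. t \<in> {0..T} \<Longrightarrow> E t \<le> M" "0 \<le> M"
  proof -
    have "bounded (E ` {0..T})"
      using compact_continuous_image[OF E_cont] by (auto intro: compact_imp_bounded)
    then obtain K where "\<And>x. x \<in> E ` {0..T} \<Longrightarrow> norm x \<le> K" unfolding bounded_iff by blast
    then have "E t \<le> max K 0" if "t \<in> {0..T}" for t using that by force
    then show ?thesis using that by (meson max.cobounded2)
  qed
  have E_pos: "0 < E t" for t by (simp add: E_def)
  define I where "I = integral {0..T} (\<lambda>u. E u * b u)"
  define J where "J = integral {0..T} (\<lambda>u. M * \<bar>a u\<bar> + b u)"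
  have Eb: "(\<lambda>u. E u * b u) absolutely_integrable_on {0..T}" by (rule absolutely_integrable_continuous_mult[OF E_cont b])
  have abs_a: "(\<lambda>u. \<bar>a u\<bar>) absolutely_integrable_on {0..T}" using set_integrable_abs[OF a] .
  have Mab: "(\<lambda>u. M * \<bar>a u\<bar> + b u) absolutely_integrable_on {0..T}"
    using abs_a b by (intro set_integral_add(1) set_integrable_mult_right) auto
  have ap: "(\<lambda>u. a u * p u) absolutely_integrable_on {0..T}"
    using absolutely_integrable_continuous_mult[OF p a] by (simp add: mult.commute)
  have main: "E T * p T - E 0 * p 0 \<le> I + \<epsilon> * J" if eps: "0 < \<epsilon>" for \<epsilon>
  proof -
    have "uniformly_continuous_on {0..T} p" "uniformly_continuous_on {0..T} E"
      using p E_cont by (auto intro: compact_uniformly_continuous)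
    then obtain d1 d2 where d: "0 < d1" "0 < d2"
      and d1: "\<And>u r. u \<in> {0..T} \<Longrightarrow> r \<in> {0..T} \<Longrightarrow> dist u r < d1 \<Longrightarrow> dist (p u) (p r) < \<epsilon>"
      and d2: "\<And>u r. u \<in> {0..T} \<Longrightarrow> r \<in> {0..T} \<Longrightarrow> dist u r < d2 \<Longrightarrow> dist (E u) (E r) < \<epsilon>"
      unfolding uniformly_continuous_on_def using eps by metis
    \<comment> \<open>a density that dominates every increment of \<open>E p\<close> over an interval shorter than \<open>d1\<close> and \<open>d2\<close>\<close>
    define h where "h u = E u * b u + \<epsilon> * (M * \<bar>a u\<bar> + b u)" for u
    have h: "h absolutely_integrable_on {0..T}"
      unfolding h_def using Eb abs_a b by (intro set_integral_add(1) set_integrable_mult_right) auto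
    then have hi: "h integrable_on {r..t}" if "0 \<le> r" "t \<le> T" for r t
      using sub[OF h that] by (auto intro: set_lebesgue_integral_eq_integral(1))
    have "E T * p T - integral {0..T} h \<le> E 0 * p 0 - integral {0..0} h"
    proof (rule locally_nonincreasing_imp_le[of T "min d1 d2"])
      fix r t assume rt: "0 \<le> r" "r \<le> t" "t \<le> T" "t - r < min d1 d2"
      have ap': "(\<lambda>u. a u * p u) integrable_on {r..t}"
        using sub[OF ap, of r t] rt by (auto intro: set_lebesgue_integral_eq_integral(1))
      \<comment> \<open>convexity of the exponential, in the direction that the sign of \<open>p r\<close> requires\<close>
      have "E t - E r \<le> - E t * (A t - A r)"
      proof -
        have "E t * (1 + (A t - A r)) \<le> E t * exp (A t - A r)"
          using E_pos[of t] by (intro mult_left_mono) (auto simp: less_imp_le)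
        also have "\<dots> = E r" by (simp add: E_def flip: exp_add)
        finally show ?thesis by (simp add: algebra_simps)
      qed
      then have "p r * (E t - E r) \<le> p r * (- E t * (A t - A r))"
        using p_nonneg rt by (intro mult_left_mono) auto
      then have "E t * p t - E r * p r \<le> E t * (p t - p r - p r * (A t - A r))"
        by (simp add: algebra_simps)
      also have "\<dots> \<le> E t * (integral {r..t} (\<lambda>u. a u * p u + b u) - p r * integral {r..t} a)"
        using ineq[of r t] A_diff[of r t] rt E_pos[of t] by (intro mult_left_mono) auto
      also have "\<dots> = integral {r..t} (\<lambda>u. E t * (a u * (p u - p r) + b u))"
      proof -
        have "integral {r..t} (\<lambda>u. a u * p u + b u) - p r * integral {r..t} a
          = integral {r..t} (\<lambda>u. (a u * p u + b u) - p r * a u)"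
          using ap' ai[of r t] rt
          by (subst integral_diff)
             (auto intro!: integrable_add integrable_on_mult_right)
        also have "\<dots> = integral {r..t} (\<lambda>u. a u * (p u - p r) + b u)"
          by (intro integral_cong) (simp add: algebra_simps)
        finally show ?thesis by simp
      qed
      also have "\<dots> \<le> integral {r..t} h"
      proof (rule integral_le)
        have "(\<lambda>u. E t * ((a u * p u + b u) - p r * a u)) integrable_on {r..t}"
          using ap' ai[of r t] rt
          by (intro integrable_on_mult_right integrable_diff integrable_add) auto
        then show "(\<lambda>u. E t * (a u * (p u - p r) + b u)) integrable_on {r..t}"
          by (rule integrable_eq) (simp add: algebra_simps)
        show "h integrable_on {r..t}" using hi rt by auto
        fix u assume u: "u \<in> {r..t}"
        have "\<bar>p u - p r\<bar> < \<epsilon>" "\<bar>E t - E u\<bar> < \<epsilon>"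
          using d1[of u r] d2[of t u] u rt by (auto simp: dist_real_def)
        have "a u * (p u - p r) \<le> \<bar>a u\<bar> * \<epsilon>"
          using \<open>\<bar>p u - p r\<bar> < \<epsilon>\<close>
          by (metis abs_ge_self abs_ge_zero abs_mult less_imp_le mult_left_mono order_trans)
        then have "E t * (a u * (p u - p r)) \<le> E t * (\<bar>a u\<bar> * \<epsilon>)"
          using E_pos[of t] by (intro mult_left_mono) auto
        also have "\<dots> \<le> M * (\<bar>a u\<bar> * \<epsilon>)"
          using M(1)[of t] rt eps by (intro mult_right_mono) auto
        finally have 1: "E t * (a u * (p u - p r)) \<le> \<epsilon> * (M * \<bar>a u\<bar>)" by (simp add: mult_ac)
        have "E t * b u \<le> (E u + \<epsilon>) * b u"
          using \<open>\<bar>E t - E u\<bar> < \<epsilon>\<close> b_nonneg by (intro mult_right_mono) auto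
        with 1 show "E t * (a u * (p u - p r) + b u) \<le> h u"
          unfolding h_def by (simp add: algebra_simps)
      qed
      finally have "E t * p t - E r * p r \<le> integral {r..t} h" .
      then show "E t * p t - integral {0..t} h \<le> E r * p r - integral {0..r} h"
        using Henstock_Kurzweil_Integration.integral_combine[of 0 r t h] rt hi[of 0 t] by simp
    qed (use T d in auto)
    then have "E T * p T - E 0 * p 0 \<le> integral {0..T} h" by simp
    also have "\<dots> = I + \<epsilon> * J"
      unfolding h_def I_def J_def
      using Eb[THEN set_lebesgue_integral_eq_integral(1)] Mab[THEN set_lebesgue_integral_eq_integral(1)]
      by (subst integral_add) (auto intro: integrable_on_mult_right)
    finally show ?thesis .
  qed
  have "E T * p T - E 0 * p 0 \<le> I"
  proof (rule field_le_epsilon)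
    fix e :: real assume e: "0 < e"
    have "E T * p T - E 0 * p 0 \<le> I + e / (\<bar>J\<bar> + 1) * J" using e by (intro main) auto
    also have "e / (\<bar>J\<bar> + 1) * J \<le> e"
    proof -
      have "e * J \<le> e * (\<bar>J\<bar> + 1)" using e by (intro mult_left_mono) auto
      then show ?thesis by (simp add: divide_simps)
    qed
    finally show "E T * p T - E 0 * p 0 \<le> I + e" by simp
  qed
  moreover have "E T = 1" by (simp add: E_def)
  moreover have "E 0 = exp (integral {0..T} a)" using E_eq[of 0] T by simp
  moreover have "I = integral {0..T} (\<lambda>u. exp (integral {u..T} a) * b u)"
    unfolding I_def by (intro integral_cong) (simp add: E_eq)
  ultimately show ?thesis by simp
qed

text \<open>The norm of \<open>w\<close> need not be differentiable where \<open>w\<close> vanishes, so the estimate is applied to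
  \<open>\<surd>(|w|\<^sup>2 + \<delta>\<^sup>2)\<close>, and then \<open>\<delta> \<rightarrow> 0\<close>. The increments are recovered from the
  derivative by the gauge integral, since the derivative may fail to be Lebesgue integrable near the endpoints.\<close>

lemma gronwall_norm:
  fixes w :: "real \<Rightarrow> 'a::euclidean_space" and a b :: "real \<Rightarrow> real"
  assumes T: "0 \<le> T" and w: "continuous_on {0..T} w"
    and w': "\<And>t. 0 < t \<Longrightarrow> t < T \<Longrightarrow> (w has_vector_derivative w' t) (at t)"
    and a: "a absolutely_integrable_on {0..T}" and b: "b absolutely_integrable_on {0..T}"
    and b_nonneg: "\<And>t. 0 \<le> b t"
    and ineq: "\<And>t. 0 < t \<Longrightarrow> t < T \<Longrightarrow> w t \<bullet> w' t \<le> a t * (norm (w t))\<^sup>2 + b t * norm (w t)"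
  shows "norm (w T) \<le> exp (integral {0..T} a) * norm (w 0)
    + integral {0..T} (\<lambda>u. exp (integral {u..T} a) * b u)"
proof -
  let ?E = "\<lambda>u. exp (integral {u..T} a)"
  have E_cont: "continuous_on {0..T} ?E"
    using a by (intro continuous_intros indefinite_integral_continuous_1')
      (auto intro: set_lebesgue_integral_eq_integral(1))
  have abs_a: "(\<lambda>u. \<bar>a u\<bar>) absolutely_integrable_on {0..T}" using set_integrable_abs[OF a] .
  define C where "C = exp (integral {0..T} a) + integral {0..T} (\<lambda>u. ?E u * \<bar>a u\<bar>)"
  define B where "B = exp (integral {0..T} a) * norm (w 0) + integral {0..T} (\<lambda>u. ?E u * b u)"
  have est: "norm (w T) \<le> B + \<delta> * C" if d: "0 < \<delta>" for \<delta>
  proof -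
    define m where "m t = sqrt ((norm (w t))\<^sup>2 + \<delta>\<^sup>2)" for t
    \<comment> \<open>at \<open>t = T\<close>, where \<open>w\<close> need not be differentiable, \<open>m'\<close> takes the value of its upper bound\<close>
    define m' where "m' t = (if t < T then (w t \<bullet> w' t) / m t else a t * m t + (b t + \<delta> * \<bar>a t\<bar>))" for t
    have m_pos: "0 < m t" and m_ge: "\<delta> \<le> m t" "norm (w t) \<le> m t" for t
      using d unfolding m_def by (auto intro!: real_le_rsqrt add_nonneg_pos)
    have m_cont: "continuous_on {0..T} m"
      unfolding m_def by (intro continuous_intros w)
    have m_sq: "(norm (w t))\<^sup>2 = (m t)\<^sup>2 - \<delta>\<^sup>2" for t
      unfolding m_def by simp
    have m_deriv: "(m has_vector_derivative m' t) (at t)" if t: "0 < t" "t < T" for t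
    proof -
      have "((\<lambda>t. w t \<bullet> w t) has_real_derivative (2 * (w t \<bullet> w' t))) (at t)"
        using has_derivative_inner[OF w'[OF t, unfolded has_vector_derivative_def] w'[OF t, unfolded has_vector_derivative_def]]
        unfolding has_field_derivative_def
        by (rule has_derivative_eq_rhs) (auto simp: fun_eq_iff inner_commute algebra_simps)
      then have "((\<lambda>t. w t \<bullet> w t + \<delta>\<^sup>2) has_real_derivative (2 * (w t \<bullet> w' t))) (at t)"
        by (auto intro!: derivative_eq_intros)
      from DERIV_chain2[OF DERIV_real_sqrt this] 
      have "((\<lambda>t. sqrt (w t \<bullet> w t + \<delta>\<^sup>2)) has_real_derivative
          (inverse (sqrt (w t \<bullet> w t + \<delta>\<^sup>2)) / 2 * (2 * (w t \<bullet> w' t)))) (at t)"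
        using add_nonneg_pos[OF inner_ge_zero[of "w t"], of "\<delta>\<^sup>2"] d by simp
      moreover have "inverse (sqrt (w t \<bullet> w t + \<delta>\<^sup>2)) / 2 * (2 * (w t \<bullet> w' t)) = m' t"
        using t unfolding m'_def m_def power2_norm_eq_inner by (simp add: inverse_eq_divide)
      ultimately show ?thesis
        unfolding has_real_derivative_iff_has_vector_derivative m_def[abs_def] power2_norm_eq_inner by simp
    qed
    have m'_le: "m' t \<le> a t * m t + (b t + \<delta> * \<bar>a t\<bar>)" if t: "0 < t" "t \<le> T" for t
    proof (cases "t < T")
      case True
      have "w t \<bullet> w' t \<le> a t * (m t)\<^sup>2 - a t * \<delta>\<^sup>2 + b t * norm (w t)"
        using ineq[OF t(1) True] unfolding m_sq by (simp add: algebra_simps)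
      \<comment> \<open>where \<open>a\<close> is negative, replacing \<open>|w|\<close> by the larger \<open>m\<close> costs \<open>|a| \<delta>\<close>, which is absorbed into \<open>b\<close>\<close>
      also have "\<dots> \<le> a t * (m t)\<^sup>2 + \<bar>a t\<bar> * \<delta> * m t + b t * m t"
      proof -
        have "- a t * \<delta>\<^sup>2 \<le> \<bar>a t\<bar> * \<delta>\<^sup>2" by (rule mult_right_mono) auto
        also have "\<dots> = \<bar>a t\<bar> * (\<delta> * \<delta>)" by (simp add: power2_eq_square)
        also have "\<dots> \<le> \<bar>a t\<bar> * (\<delta> * m t)"
          using d m_ge[of t] by (intro mult_left_mono) auto
        finally have "- a t * \<delta>\<^sup>2 \<le> \<bar>a t\<bar> * (\<delta> * m t)" .
        then show ?thesis
          using mult_left_mono[OF m_ge(2)[of t] b_nonneg[of t]]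
          by (simp add: power2_eq_square mult.assoc)
      qed
      also have "\<dots> = (a t * m t + (b t + \<delta> * \<bar>a t\<bar>)) * m t"
        by (simp add: algebra_simps power2_eq_square)
      finally show ?thesis
        using True m_pos[of t] by (simp add: m'_def pos_divide_le_eq)
    qed (simp add: m'_def)
    have "m T \<le> exp (integral {0..T} a) * m 0 + integral {0..T} (\<lambda>u. ?E u * (b u + \<delta> * \<bar>a u\<bar>))"
    proof (rule gronwall_integral[OF T m_cont a])
      show ab: "(\<lambda>t. b t + \<delta> * \<bar>a t\<bar>) absolutely_integrable_on {0..T}"
        using abs_a b by (intro set_integral_add(1) set_integrable_mult_right) auto
      show "0 \<le> b t + \<delta> * \<bar>a t\<bar>" for t using b_nonneg d by simp
      show "0 \<le> m t" for t using m_pos[of t] by simp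
      fix r t assume rt: "0 \<le> r" "r \<le> t" "t \<le> T"
      have "(m' has_integral (m t - m r)) {r..t}"
        using rt by (intro fundamental_theorem_of_calculus_interior m_deriv)
          (auto intro: continuous_on_subset[OF m_cont])
      then have m'_int: "((\<lambda>u. if u = 0 then a u * m u + (b u + \<delta> * \<bar>a u\<bar>) else m' u) has_integral (m t - m r)) {r..t}"
        by (rule has_integral_spike[of "{0}", rotated -1]) auto
      have ap: "(\<lambda>u. a u * m u) absolutely_integrable_on {0..T}"
        using absolutely_integrable_continuous_mult[OF m_cont a] by (simp add: mult.commute)
      have "(\<lambda>u. a u * m u + (b u + \<delta> * \<bar>a u\<bar>)) absolutely_integrable_on {r..t}"
        using set_integral_add(1)[OF ap ab] rt by (auto intro: set_integrable_subset)
      then have "(\<lambda>u. a u * m u + (b u + \<delta> * \<bar>a u\<bar>)) integrable_on {r..t}"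
        by (rule set_lebesgue_integral_eq_integral(1))
      from has_integral_le[OF m'_int integrable_integral[OF this]]
      show "m t - m r \<le> integral {r..t} (\<lambda>u. a u * m u + (b u + \<delta> * \<bar>a u\<bar>))"
        using m'_le rt by (auto simp: less_le)
    qed
    also have "exp (integral {0..T} a) * m 0 \<le> exp (integral {0..T} a) * (norm (w 0) + \<delta>)"
      unfolding m_def using d by (intro mult_left_mono order_trans[OF sqrt_sum_squares_le_sum_abs]) auto
    also have "integral {0..T} (\<lambda>u. ?E u * (b u + \<delta> * \<bar>a u\<bar>))
       = integral {0..T} (\<lambda>u. ?E u * b u) + \<delta> * integral {0..T} (\<lambda>u. ?E u * \<bar>a u\<bar>)"
      using absolutely_integrable_continuous_mult[OF E_cont b, THEN set_lebesgue_integral_eq_integral(1)]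
        absolutely_integrable_continuous_mult[OF E_cont abs_a, THEN set_lebesgue_integral_eq_integral(1)]
      by (simp add: algebra_simps integral_add integrable_on_mult_right flip: integral_mult_right)
    finally show ?thesis
      using m_ge(2)[of T] by (simp add: B_def C_def algebra_simps)
  qed
  have "norm (w T) \<le> B"
  proof (rule field_le_epsilon)
    fix e :: real assume e: "0 < e"
    have "norm (w T) \<le> B + e / (\<bar>C\<bar> + 1) * C" using e by (intro est) auto
    also have "e / (\<bar>C\<bar> + 1) * C \<le> e"
    proof -
      have "e * C \<le> e * (\<bar>C\<bar> + 1)" using e by (intro mult_left_mono) auto
      then show ?thesis by (simp add: divide_simps)
    qed
    finally show "norm (w T) \<le> B + e" by simp
  qed
  then show ?thesis by (simp add: B_def)
qed

section \<open>Uniqueness and calculus of weak gradients\<close>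

text \<open>The test functions in the definition of weak gradients, together with their gradients.\<close>

definition C1_test :: "('a::euclidean_space \<Rightarrow> real) \<Rightarrow> ('a \<Rightarrow> 'a) \<Rightarrow> bool" where
  "C1_test \<phi> D \<longleftrightarrow>
     (\<forall>x. GDERIV \<phi> x :> D x) \<and> continuous_on UNIV D \<and> compact (closure {x. \<phi> x \<noteq> 0})"

lemma GDERIV_imp_continuous: "(\<And>x. GDERIV f x :> D x) \<Longrightarrow> continuous_on UNIV f"
  unfolding gderiv_def
  by (rule continuous_at_imp_continuous_on) (blast intro: has_derivative_continuous)

lemma C1_testD:
  assumes "C1_test \<phi> D"
  shows "GDERIV \<phi> x :> D x" "continuous_on UNIV \<phi>" "continuous_on UNIV D"
  using assms GDERIV_imp_continuous unfolding C1_test_def by blast+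

lemma C1_test_support:
  assumes "C1_test \<phi> D"
  obtains R where "0 < R" "\<And>x. x \<notin> cball 0 R \<Longrightarrow> \<phi> x = 0" "\<And>x. x \<notin> cball 0 R \<Longrightarrow> D x = 0"
proof -
  obtain R where R: "0 < R" "closure {x. \<phi> x \<noteq> 0} \<subseteq> cball 0 R"
  proof -
    have "bounded {x. \<phi> x \<noteq> 0}" using assms by (simp add: C1_test_def compact_closure)
    then obtain R where "0 < R" "{x. \<phi> x \<noteq> 0} \<subseteq> cball 0 R"
      unfolding bounded_pos by (metis mem_Collect_eq mem_cball_0 subsetI)
    then show ?thesis using that[of R] closure_minimal[of _ "cball 0 R"] by blast
  qed
  have D0: "D x = 0" if "x \<notin> cball 0 R" for x
  proof -
    have op: "open (- closure {x. \<phi> x \<noteq> 0})" and x: "x \<in> - closure {x. \<phi> x \<noteq> 0}"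
      using R that by auto
    have z: "0 = \<phi> z" if "z \<in> - closure {x. \<phi> x \<noteq> 0}" for z
      using that closure_subset[of "{x. \<phi> x \<noteq> 0}"] by auto
    have "GDERIV \<phi> x :> 0"
      using has_derivative_transform_within_open[OF has_derivative_const op x z]
      unfolding gderiv_def by simp
    then have "(\<lambda>h. h \<bullet> D x) = (\<lambda>h. h \<bullet> 0)"
      using has_derivative_unique[OF C1_testD(1)[OF assms, of x, unfolded gderiv_def]]
      unfolding gderiv_def by simp
    then show ?thesis by (metis inner_eq_zero_iff inner_zero_right)
  qed
  show ?thesis
  proof (rule that[of R])
    show "\<phi> x = 0" if "x \<notin> cball 0 R" for x
      using that R(2) closure_subset[of "{x. \<phi> x \<noteq> 0}"] by blast
  qed (use R D0 in auto)
qed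

lemma C1_test_mult:
  assumes \<phi>: "C1_test \<phi> D" and u: "\<And>x. GDERIV u x :> G x" "continuous_on UNIV G"
  shows "C1_test (\<lambda>x. \<phi> x * u x) (\<lambda>x. \<phi> x *\<^sub>R G x + u x *\<^sub>R D x)"
  unfolding C1_test_def
proof (intro conjI allI)
  show "GDERIV (\<lambda>x. \<phi> x * u x) x :> \<phi> x *\<^sub>R G x + u x *\<^sub>R D x" for x
    by (rule GDERIV_mult[OF C1_testD(1)[OF \<phi>] u(1)])
  show "continuous_on UNIV (\<lambda>x. \<phi> x *\<^sub>R G x + u x *\<^sub>R D x)"
    by (intro continuous_intros C1_testD[OF \<phi>] u GDERIV_imp_continuous[OF u(1)])
  have "bounded {x. \<phi> x \<noteq> 0}" using \<phi> by (simp add: C1_test_def compact_closure)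
  then have "bounded {x. \<phi> x * u x \<noteq> 0}" by (rule bounded_subset) auto
  then show "compact (closure {x. \<phi> x * u x \<noteq> 0})" by (simp add: compact_closure)
qed

text \<open>Stated for a general bilinear product, since weak gradients involve both the product of a scalar
  function with a vector-valued test gradient and the product of a scalar test function with a vector field.\<close>

lemma integrable_locally_times_compact_support:
  fixes f :: "'a::euclidean_space \<Rightarrow> 'b::{banach, second_countable_topology}"
    and p :: "'a \<Rightarrow> 'c::{banach, second_countable_topology}"
  assumes f: "\<And>K. compact K \<Longrightarrow> set_integrable lborel K f"
    and p: "continuous_on UNIV p" "\<And>x. x \<notin> cball 0 R \<Longrightarrow> p x = 0"
    and bil: "bounded_bilinear B" 
  shows "integrable lborel (\<lambda>x. B (f x) (p x) :: 'd::{banach, second_countable_topology})"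
proof -
  interpret bounded_bilinear B by fact
  obtain C where C: "\<And>x. x \<in> cball 0 R \<Longrightarrow> norm (p x) \<le> C"
  proof -
    have "bounded (p ` cball 0 R)"
      using p(1) by (intro compact_imp_bounded compact_continuous_image compact_cball)
        (rule continuous_on_subset, auto)
    then show ?thesis using that unfolding bounded_iff by blast
  qed
  obtain N where N: "\<And>a b. norm (B a b) \<le> norm a * norm b * N" "0 \<le> N"
    using nonneg_bounded by auto
  have fi: "integrable lborel (\<lambda>x. indicator (cball 0 R) x *\<^sub>R f x)"
    using f[of "cball 0 R"] unfolding set_integrable_def by simp
  have eq: "B (f x) (p x) = B (indicator (cball 0 R) x *\<^sub>R f x) (p x)" for x
    using p(2)[of x] by (cases "x \<in> cball 0 R") (auto simp: zero_right)
  have pm: "p \<in> borel_measurable lborel" using p(1) by (simp add: borel_measurable_continuous_onI)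
  have Bm: "(\<lambda>z. B (fst z) (snd z)) \<in> borel_measurable borel"
    by (intro borel_measurable_continuous_onI bounded_bilinear.continuous_on[OF bil] continuous_intros)
  have "integrable lborel (\<lambda>x. B (indicator (cball 0 R) x *\<^sub>R f x) (p x))"
  proof (rule Bochner_Integration.integrable_bound)
    show "integrable lborel (\<lambda>x. norm (indicator (cball 0 R) x *\<^sub>R f x) * (max C 0 * N))"
      using fi by (intro integrable_mult_left integrable_norm)
    have "(\<lambda>x. (indicator (cball 0 R) x *\<^sub>R f x, p x)) \<in> borel_measurable lborel"
      using borel_measurable_integrable[OF fi] pm by (rule borel_measurable_Pair)
    from measurable_compose[OF this Bm]
    show "(\<lambda>x. B (indicator (cball 0 R) x *\<^sub>R f x) (p x)) \<in> borel_measurable lborel" by simp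
    show "AE x in lborel. norm (B (indicator (cball 0 R) x *\<^sub>R f x) (p x))
       \<le> norm (norm (indicator (cball 0 R) x *\<^sub>R f x) * (max C 0 * N))"
    proof (rule AE_I2)
      fix x :: 'a
      have "norm (B (indicator (cball 0 R) x *\<^sub>R f x) (p x))
         \<le> norm (indicator (cball 0 R) x *\<^sub>R f x) * norm (p x) * N" by (rule N)
      also have "\<dots> \<le> norm (indicator (cball 0 R) x *\<^sub>R f x) * max C 0 * N"
        using C[of x] p(2)[of x] N(2)
        by (intro mult_right_mono mult_left_mono) (cases "x \<in> cball 0 R"; force)+
      finally show "norm (B (indicator (cball 0 R) x *\<^sub>R f x) (p x))
       \<le> norm (norm (indicator (cball 0 R) x *\<^sub>R f x) * (max C 0 * N))" 
        using N(2) by (simp add: abs_mult mult.assoc)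
    qed
  qed
  then show ?thesis using eq by simp
qed

lemma borel_measurable_locally_integrable:
  fixes f :: "'a::euclidean_space \<Rightarrow> 'b::{banach, second_countable_topology}"
  assumes f: "\<And>K. compact K \<Longrightarrow> set_integrable lborel K f"
  shows "f \<in> borel_measurable borel"
proof (rule borel_measurable_LIMSEQ_metric)
  show "(\<lambda>x. indicator (cball 0 (real n)) x *\<^sub>R f x) \<in> borel_measurable borel" for n
    using f[of "cball 0 (real n)"] borel_measurable_integrable unfolding set_integrable_def
    by fastforce
  fix x :: 'a
  obtain N :: nat where N: "norm x \<le> N" using real_arch_simple by blast
  show "(\<lambda>n. indicator (cball 0 (real n)) x *\<^sub>R f x) \<longlonglongrightarrow> f x"
    by (rule tendsto_eventually, rule eventually_sequentiallyI[of N]) (use N in auto)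
qed

lemma set_integrable_continuous_compact:
  fixes f :: "'a::euclidean_space \<Rightarrow> 'b::{banach, second_countable_topology}"
  assumes "continuous_on UNIV f" "compact K"
  shows "set_integrable lborel K f"
  unfolding set_integrable_def
  by (intro borel_integrable_compact assms continuous_on_subset[OF assms(1)]) auto

lemma C1_test_ball:
  fixes c :: "'a::euclidean_space"
  assumes "0 < r"
  shows "\<exists>\<phi> D. C1_test \<phi> D \<and> (\<forall>x. 0 \<le> \<phi> x) \<and> ball c r = {x. 0 < \<phi> x}"
proof -
  define s where "s x = max 0 (r\<^sup>2 - (x - c) \<bullet> (x - c))" for x
  define \<phi> where "\<phi> x = (s x)\<^sup>2" for x
  define D where "D x = (- 4 * s x) *\<^sub>R (x - c)" for x
  \<comment> \<open>squaring makes the positive part continuously differentiable\<close>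
  have sq: "((\<lambda>u::real. (max 0 u)\<^sup>2) has_real_derivative (2 * max 0 u)) (at u)" for u
  proof (cases "u = 0")
    case True
    have "((\<lambda>y::real. (max 0 y)\<^sup>2 / y) \<longlongrightarrow> 0) (at 0)"
    proof (rule tendsto_rabs_zero_cancel, rule tendsto_sandwich[OF _ _ tendsto_const])
      show "((\<lambda>y::real. \<bar>y\<bar>) \<longlongrightarrow> 0) (at 0)" by (auto intro!: tendsto_eq_intros)
    qed (auto simp: eventually_at_filter max_def power2_eq_square intro!: always_eventually)
    then show ?thesis using True by (simp add: has_field_derivative_iff)
  next
    case False
    show ?thesis
    proof (cases "u > 0")
      case True
      have "((\<lambda>u::real. u\<^sup>2) has_real_derivative (2 * u)) (at u)" by (auto intro!: derivative_eq_intros)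
      then have "((\<lambda>u::real. (max 0 u)\<^sup>2) has_real_derivative (2 * u)) (at u)"
        by (rule has_field_derivative_transform_within_open[where S="{0<..}"]) (use True in auto)
      then show ?thesis using True by simp
    next
      case F: False
      have "((\<lambda>u::real. (max 0 u)\<^sup>2) has_real_derivative 0) (at u)"
        by (rule has_field_derivative_transform_within_open[where S="{..<0}" and f="\<lambda>_. 0"])
          (use F False in auto)
      then show ?thesis using F by simp
    qed
  qed
  have g: "GDERIV (\<lambda>x. r\<^sup>2 - (x - c) \<bullet> (x - c)) x :> (- 2) *\<^sub>R (x - c)" for x
    unfolding gderiv_def
    by (auto intro!: derivative_eq_intros simp: inner_commute algebra_simps)
  have "GDERIV \<phi> x :> D x" for x
    using GDERIV_DERIV_compose[OF g sq, of x] by (simp add: \<phi>_def[abs_def] D_def s_def)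
  moreover have "continuous_on UNIV D"
    unfolding D_def s_def by (intro continuous_intros)
  moreover have B: "ball c r = {x. 0 < \<phi> x}"
    using assms unfolding \<phi>_def s_def
    by (auto simp: dist_norm norm_minus_commute max_def power2_norm_eq_inner[symmetric] power_strict_mono
        intro: power2_less_imp_less dest: power_strict_mono[of _ _ 2])
  moreover have "compact (closure {x. \<phi> x \<noteq> 0})"
  proof -
    have "{x. \<phi> x \<noteq> 0} = ball c r" unfolding B by (auto simp: \<phi>_def)
    then show ?thesis using bounded_ball by (simp add: compact_closure)
  qed
  moreover have "\<forall>x. 0 \<le> \<phi> x" by (simp add: \<phi>_def)
  ultimately show ?thesis unfolding C1_test_def by blast
qed

text \<open>The fundamental lemma of the calculus of variations. For a nonnegative test function \<open>\<phi>\<close>, the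
  functions \<open>n\<phi> / (1 + n\<phi>)\<close> are test functions and increase to the indicator of \<open>{\<phi> > 0}\<close>, so that \<open>u\<close>
  integrates to zero over this set. Such sets are closed under intersection, because the product of two test
  functions is one, and they contain all balls; hence the positive and the negative part of \<open>u\<close>
  are densities of the same measure.\<close>

lemma AE_zero_if_orthogonal_to_C1_tests:
  fixes u :: "'a::euclidean_space \<Rightarrow> real"
  assumes u: "\<And>K. compact K \<Longrightarrow> set_integrable lborel K u"
    and orth: "\<And>\<phi> D. C1_test \<phi> D \<Longrightarrow> (\<integral>x. u x * \<phi> x \<partial>lborel) = 0"
  shows "AE x in lborel. u x = 0"
proof -
  have um [measurable]: "u \<in> borel_measurable borel" by (rule borel_measurable_locally_integrable[OF u])
  define \<E> where "\<E> = {{x. 0 < \<phi> x} | \<phi>. (\<exists>D. C1_test \<phi> D) \<and> (\<forall>x::'a. 0 \<le> \<phi> x)}"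
  have openE: "open U" if "U \<in> \<E>" for U
    using that unfolding \<E>_def
    by (auto intro!: open_Collect_less C1_testD continuous_on_const)
  have E_int: "integrable lborel (\<lambda>x. u x * indicator U x) \<and> (\<integral>x. u x * indicator U x \<partial>lborel) = 0" if UE: "U \<in> \<E>" for U
  proof -
    obtain \<phi> D where U: "U = {x. 0 < \<phi> x}" and \<phi>: "C1_test \<phi> D" "\<And>x. 0 \<le> \<phi> x"
      using UE unfolding \<E>_def by blast
    obtain R where R: "0 < R" "\<And>x. x \<notin> cball 0 R \<Longrightarrow> \<phi> x = 0" using C1_test_support[OF \<phi>(1)] by metis
    have pm [measurable]: "\<phi> \<in> borel_measurable borel"
      using C1_testD(2)[OF \<phi>(1)] by (rule borel_measurable_continuous_onI)
    have dom: "integrable lborel (\<lambda>x. \<bar>u x\<bar> * indicator (cball 0 R) x)"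
      using integrable_abs[OF u[of "cball 0 R", unfolded set_integrable_def]] by (simp add: abs_mult mult.commute)
    have UR: "U \<subseteq> cball 0 R" using U R(2) by force
    have Um [measurable]: "U \<in> sets borel" using openE[OF that] by simp
    have "integrable lborel (\<lambda>x. u x * indicator U x)"
      by (rule Bochner_Integration.integrable_bound[OF dom])
         (use UR in \<open>auto intro!: AE_I2 simp: indicator_def\<close>)
    have lim: "(\<lambda>n. \<integral>x. u x * (real n * \<phi> x / (1 + real n * \<phi> x)) \<partial>lborel) \<longlonglongrightarrow> (\<integral>x. u x * indicator U x \<partial>lborel)"
    proof (rule integral_dominated_convergence[OF _ _ dom])
      show "AE x in lborel. (\<lambda>n. u x * (real n * \<phi> x / (1 + real n * \<phi> x))) \<longlonglongrightarrow> u x * indicator U x"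
      proof (rule AE_I2)
        fix x
        have "(\<lambda>n. real n * \<phi> x / (1 + real n * \<phi> x)) \<longlonglongrightarrow> indicator U x"
        proof (cases "0 < \<phi> x")
          case True
          have "(\<lambda>n. 1 - 1 / (1 + real n * \<phi> x)) \<longlonglongrightarrow> 1 - 0"
            using True
            by (intro tendsto_intros tendsto_divide_0[OF tendsto_const] filterlim_at_top_imp_at_infinity
                filterlim_tendsto_add_at_top[OF tendsto_const] filterlim_at_top_mult_tendsto_pos[OF tendsto_const]
                filterlim_real_sequentially)
          moreover have "1 - 1 / (1 + real n * \<phi> x) = real n * \<phi> x / (1 + real n * \<phi> x)" for n
            using \<phi>(2)[of x] by (simp add: field_simps add_nonneg_eq_0_iff)
          ultimately show ?thesis using True U by simp
        next
          case False
          then show ?thesis using \<phi>(2)[of x] U by (simp add: not_less order.antisym)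
        qed
        then show "(\<lambda>n. u x * (real n * \<phi> x / (1 + real n * \<phi> x))) \<longlonglongrightarrow> u x * indicator U x"
          by (intro tendsto_intros)
      qed
      show "AE x in lborel. norm (u x * (real n * \<phi> x / (1 + real n * \<phi> x))) \<le> \<bar>u x\<bar> * indicator (cball 0 R) x" for n
      proof (rule AE_I2)
        fix x
        have "0 < 1 + real n * \<phi> x" using \<phi>(2)[of x] by (simp add: add_pos_nonneg)
        then have "\<bar>real n * \<phi> x / (1 + real n * \<phi> x)\<bar> \<le> indicator (cball 0 R) x"
          using \<phi>(2)[of x] R(2)[of x] by (auto simp: indicator_def divide_simps add_nonneg_eq_0_iff)
        then show "norm (u x * (real n * \<phi> x / (1 + real n * \<phi> x))) \<le> \<bar>u x\<bar> * indicator (cball 0 R) x"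
          unfolding real_norm_def abs_mult by (rule mult_left_mono) simp
      qed
    qed measurable
    have "(\<integral>x. u x * (real n * \<phi> x / (1 + real n * \<phi> x)) \<partial>lborel) = 0" for n
    proof -
      have nz: "1 + real n * \<phi> x \<noteq> 0" for x using \<phi>(2)[of x] by (simp add: add_nonneg_eq_0_iff)
      have d: "GDERIV (\<lambda>x. real n / (1 + real n * \<phi> x)) x :> (- (real n)\<^sup>2 / (1 + real n * \<phi> x)\<^sup>2) *\<^sub>R D x" for x
      proof -
        have "((\<lambda>z. real n / (1 + real n * z)) has_real_derivative (- (real n)\<^sup>2 / (1 + real n * \<phi> x)\<^sup>2)) (at (\<phi> x))"
          using nz[of x] by (auto intro!: derivative_eq_intros simp: power2_eq_square)
        from GDERIV_DERIV_compose[OF C1_testD(1)[OF \<phi>(1)] this] show ?thesis .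
      qed
      have "continuous_on UNIV (\<lambda>x. (- (real n)\<^sup>2 / (1 + real n * \<phi> x)\<^sup>2) *\<^sub>R D x)"
        using nz by (intro continuous_intros C1_testD[OF \<phi>(1)]) auto
      from orth[OF C1_test_mult[OF \<phi>(1) d this]] show ?thesis by (simp add: mult.commute)
    qed
    with lim have "(\<integral>x. u x * indicator U x \<partial>lborel) = 0" by (simp add: LIMSEQ_const_iff)
    then show ?thesis using \<open>integrable lborel (\<lambda>x. u x * indicator U x)\<close> by simp
  qed
  have E_sub: "ball c r \<in> \<E>" if "0 < r" for c r
    using C1_test_ball[OF that, of c] unfolding \<E>_def by blast
  have int_nn: "(\<integral>\<^sup>+x. ennreal (v x) * indicator U x \<partial>lborel) = (\<integral>\<^sup>+x. ennreal (v x * indicator U x) \<partial>lborel)"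
    for U and v :: "'a \<Rightarrow> real"
    by (intro nn_integral_cong) (auto simp: indicator_def)
  let ?P = "density lborel (\<lambda>x. ennreal (u x))" and ?N = "density lborel (\<lambda>x. ennreal (- u x))"
  have sigma: "sets borel = sigma_sets UNIV \<E>"
  proof -
    have "sigma_sets UNIV \<E> \<subseteq> sigma_sets UNIV {S. open S}"
      using openE by (intro sigma_sets_mono') auto
    moreover have "S \<in> sigma_sets UNIV \<E>" if "open S" for S
    proof -
      let ?F = "{ball c r | c r. 0 < r \<and> ball c r \<subseteq> S}"
      have FS: "\<Union>?F = S"
      proof (intro equalityI subsetI)
        fix x assume "x \<in> S"
        then obtain e where "0 < e" "ball x e \<subseteq> S" using \<open>open S\<close> open_contains_ball by blast
        then show "x \<in> \<Union>?F" by (intro UnionI[of "ball x e"]) auto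
      qed blast
      have "open B" if "B \<in> ?F" for B using that by auto
      from Lindelof[OF this] obtain F' where F': "F' \<subseteq> ?F" "countable F'" "\<Union>F' = \<Union>?F"
        by blast
      have "B \<in> sigma_sets UNIV \<E>" if "B \<in> F'" for B
        using that F'(1) E_sub by blast
      from sigma_sets_UNION[OF F'(2) this] show ?thesis using F'(3) FS by simp
    qed
    then have "sigma_sets UNIV {S. open S} \<subseteq> sigma_sets UNIV \<E>"
      by (intro sigma_sets_mono) auto
    ultimately show ?thesis by (auto simp: borel_def)
  qed
  have "?P = ?N"
  proof (rule measure_eqI_generator_eq[where E=\<E> and \<Omega>=UNIV and A="\<lambda>i. ball 0 (Suc i)"])
    show "Int_stable \<E>"
    proof (rule Int_stableI)
      fix U V assume "U \<in> \<E>" "V \<in> \<E>"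
      then obtain \<phi> D \<psi> D' where "U = {x. 0 < \<phi> x}" "C1_test \<phi> D" "\<And>x. 0 \<le> \<phi> x"
        and "V = {x. 0 < \<psi> x}" "C1_test \<psi> D'" "\<And>x. 0 \<le> \<psi> x"
        unfolding \<E>_def by blast
      moreover from this have "U \<inter> V = {x. 0 < \<phi> x * \<psi> x}"
        by (auto simp: zero_less_mult_iff) (meson not_less)+
      ultimately show "U \<inter> V \<in> \<E>"
        unfolding \<E>_def using C1_test_mult[of \<phi> D \<psi> D'] C1_testD[of \<psi> D']
        by (auto intro!: exI[of _ "\<lambda>x. \<phi> x * \<psi> x"])
    qed
    show "range (\<lambda>i. ball 0 (real (Suc i))) \<subseteq> \<E>" using E_sub by (auto simp del: of_nat_Suc)
    show "(\<Union>i. ball 0 (real (Suc i))) = (UNIV::'a set)"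
    proof (intro equalityI subsetI UNIV_I)
      fix x :: 'a
      obtain n :: nat where "norm x < n" using reals_Archimedean2 by blast
      then show "x \<in> (\<Union>i. ball 0 (real (Suc i)))" by (intro UN_I[of n]) auto
    qed
    have fin: "emeasure ?P U \<noteq> \<infinity> \<and> emeasure ?P U = emeasure ?N U" if U: "U \<in> \<E>" for U
    proof -
      have [measurable]: "U \<in> sets borel" using openE[OF U] by simp
      define A where "A = (\<integral>\<^sup>+x. ennreal (u x * indicator U x) \<partial>lborel)"
      define B where "B = (\<integral>\<^sup>+x. ennreal (- (u x * indicator U x)) \<partial>lborel)"
      have AB: "A \<noteq> \<infinity>" "B \<noteq> \<infinity>" "enn2real A = enn2real B"
        using E_int[OF U] real_lebesgue_integral_def[of lborel "\<lambda>x. u x * indicator U x"]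
        unfolding A_def B_def real_integrable_def by auto
      then have "A = B" by (metis ennreal_enn2real_if infinity_ennreal_def)
      moreover have "emeasure ?P U = A" by (simp add: emeasure_density int_nn A_def)
      moreover have "emeasure ?N U = B"
        using int_nn[of "\<lambda>x. - u x" U] by (simp add: emeasure_density B_def)
      ultimately show ?thesis using AB by simp
    qed
    show "emeasure ?P U = emeasure ?N U" if "U \<in> \<E>" for U using fin[OF that] by simp
    show "emeasure ?P (ball 0 (real (Suc i))) \<noteq> \<infinity>" for i
      using fin[OF E_sub[of "real (Suc i)" 0]] by auto
  qed (auto simp: sigma)
  then have "AE x in lborel. ennreal (u x) = ennreal (- u x)"
    by (subst (asm) sigma_finite_measure.density_unique_iff[OF sigma_finite_lborel]) auto
  then show ?thesis
    by eventually_elim (metis ennreal_eq_0_iff ennreal_neg linorder_linear neg_0_le_iff_le neg_le_0_iff_le order_antisym)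
qed

lemma has_weak_gradient_iff:
  "has_weak_gradient h g \<longleftrightarrow>
     (\<forall>K. compact K \<longrightarrow> set_integrable lborel K h \<and> set_integrable lborel K g) \<and>
     (\<forall>\<phi> D. C1_test \<phi> D \<longrightarrow> (\<integral>x. h x *\<^sub>R D x \<partial>lborel) = - (\<integral>x. \<phi> x *\<^sub>R g x \<partial>lborel))"
  unfolding has_weak_gradient_def C1_test_def by simp

lemma has_weak_gradient_unique:
  assumes g: "has_weak_gradient h g" "has_weak_gradient h g'"
  shows "AE x in lborel. g x = (g' x :: 'a::euclidean_space)"
proof -
  have li: "set_integrable lborel K g" "set_integrable lborel K g'" if "compact K" for K
    using g that unfolding has_weak_gradient_iff by blast+
  have "AE x in lborel. (g x - g' x) \<bullet> b = 0" for b
  proof (rule AE_zero_if_orthogonal_to_C1_tests)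
    show "set_integrable lborel K (\<lambda>x. (g x - g' x) \<bullet> b)" if "compact K" for K
      using integrable_inner_left[OF set_integral_diff(1)[OF li[OF that], unfolded set_integrable_def], of b]
      unfolding set_integrable_def by simp
    fix \<phi> D assume \<phi>: "C1_test \<phi> (D :: 'a \<Rightarrow> 'a)"
    obtain R where R: "0 < R" "\<And>x. x \<notin> cball 0 R \<Longrightarrow> \<phi> x = 0" using C1_test_support[OF \<phi>] by metis
    have i: "integrable lborel (\<lambda>x. \<phi> x *\<^sub>R f x)" if "\<And>K. compact K \<Longrightarrow> set_integrable lborel K f" for f :: "'a \<Rightarrow> 'a"
      using integrable_locally_times_compact_support[OF that C1_testD(2)[OF \<phi>] R(2)
          bounded_bilinear.flip[OF bounded_bilinear_scaleR]] .
    have "(\<integral>x. ((g x - g' x) \<bullet> b) * \<phi> x \<partial>lborel) = (\<integral>x. (\<phi> x *\<^sub>R g x - \<phi> x *\<^sub>R g' x) \<bullet> b \<partial>lborel)"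
      by (intro Bochner_Integration.integral_cong) (auto simp: algebra_simps)
    also have "\<dots> = (\<integral>x. \<phi> x *\<^sub>R g x - \<phi> x *\<^sub>R g' x \<partial>lborel) \<bullet> b"
      using i[OF li(1)] i[OF li(2)] by (intro integral_inner_left) auto
    also have "(\<integral>x. \<phi> x *\<^sub>R g x - \<phi> x *\<^sub>R g' x \<partial>lborel) = (\<integral>x. \<phi> x *\<^sub>R g x \<partial>lborel) - (\<integral>x. \<phi> x *\<^sub>R g' x \<partial>lborel)"
      using i[OF li(1)] i[OF li(2)] by (rule Bochner_Integration.integral_diff)
    also have "(\<integral>x. \<phi> x *\<^sub>R g x \<partial>lborel) = (\<integral>x. \<phi> x *\<^sub>R g' x \<partial>lborel)"
    proof -
      have "- (\<integral>x. \<phi> x *\<^sub>R g x \<partial>lborel) = (\<integral>x. h x *\<^sub>R D x \<partial>lborel)"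
        "- (\<integral>x. \<phi> x *\<^sub>R g' x \<partial>lborel) = (\<integral>x. h x *\<^sub>R D x \<partial>lborel)"
        using g[unfolded has_weak_gradient_iff] \<phi> by (metis (no_types, lifting))+
      then show ?thesis by (metis neg_equal_iff_equal)
    qed
    finally show "(\<integral>x. ((g x - g' x) \<bullet> b) * \<phi> x \<partial>lborel) = 0" by simp
  qed
  then have "AE x in lborel. \<forall>b\<in>Basis. (g x - g' x) \<bullet> b = 0"
    by (subst AE_finite_all) auto
  then show ?thesis
    by eventually_elim (simp add: euclidean_eq_iff[where 'a='a] inner_diff_left)
qed

lemma weak_gradient_AE:
  assumes "has_weak_gradient h g"
  shows "AE x in lborel. weak_gradient h x = g x"
  using has_weak_gradient_unique[OF _ assms] someI[of "has_weak_gradient h", OF assms]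
  unfolding weak_gradient_def by blast

text \<open>Radon--Nikodym derivatives are only determined almost everywhere, and the ratio of two posteriors
  differs from the original ratio by a constant factor; both are covered here.\<close>

lemma has_weak_gradient_AE_scale:
  assumes h: "has_weak_gradient h g" and eq: "AE x in lborel. h' x = c * h x"
    and [measurable]: "h' \<in> borel_measurable borel"
  shows "has_weak_gradient h' (\<lambda>x. c *\<^sub>R g x)"
proof -
  have li: "set_integrable lborel K h" "set_integrable lborel K g" if "compact K" for K
    using h that unfolding has_weak_gradient_iff by blast+
  have hm: "h \<in> borel_measurable borel" by (rule borel_measurable_locally_integrable[OF li(1)])
  show ?thesis
    unfolding has_weak_gradient_iff
  proof (intro conjI allI impI)
    fix K :: "'a set" assume K: "compact K"
    then have [measurable]: "K \<in> sets borel" by (rule borel_compact)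
    show "set_integrable lborel K (\<lambda>x. c *\<^sub>R g x)"
      using integrable_scaleR_right[OF li(2)[OF K, unfolded set_integrable_def], of c]
      unfolding set_integrable_def by (simp add: mult.commute)
    have "set_integrable lborel K (\<lambda>x. c * h x)"
      using li(1)[OF K] by (rule set_integrable_mult_right)
    then show "set_integrable lborel K h'"
      unfolding set_integrable_def
      by (rule integrable_cong_AE_imp) (use eq in \<open>auto elim!: eventually_mono\<close>)
  next
    fix \<phi> D assume \<phi>: "C1_test \<phi> (D :: 'a \<Rightarrow> 'a)"
    have [measurable]: "D \<in> borel_measurable borel"
      using C1_testD(3)[OF \<phi>] by (rule borel_measurable_continuous_onI)
    note hm[measurable]
    have "(\<integral>x. h' x *\<^sub>R D x \<partial>lborel) = (\<integral>x. c *\<^sub>R (h x *\<^sub>R D x) \<partial>lborel)"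
      by (rule integral_cong_AE) (use eq in \<open>auto elim!: eventually_mono\<close>)
    also have "\<dots> = c *\<^sub>R (\<integral>x. h x *\<^sub>R D x \<partial>lborel)" by (simp del: scaleR_scaleR)
    also have "(\<integral>x. h x *\<^sub>R D x \<partial>lborel) = - (\<integral>x. \<phi> x *\<^sub>R g x \<partial>lborel)"
      using h \<phi> unfolding has_weak_gradient_iff by blast
    also have "c *\<^sub>R - (\<integral>x. \<phi> x *\<^sub>R g x \<partial>lborel) = - (\<integral>x. c *\<^sub>R (\<phi> x *\<^sub>R g x) \<partial>lborel)"
      by (simp del: scaleR_scaleR)
    also have "(\<integral>x. c *\<^sub>R (\<phi> x *\<^sub>R g x) \<partial>lborel) = (\<integral>x. \<phi> x *\<^sub>R c *\<^sub>R g x \<partial>lborel)"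
      by (simp add: mult.commute)
    finally show "(\<integral>x. h' x *\<^sub>R D x \<partial>lborel) = - (\<integral>x. \<phi> x *\<^sub>R c *\<^sub>R g x \<partial>lborel)" .
  qed
qed

text \<open>The integral of a difference quotient vanishes by the translation invariance of Lebesgue measure,
  and the difference quotients converge dominatedly to the directional derivative.\<close>

lemma integral_gradient_C1_test:
  assumes \<phi>: "C1_test \<phi> (D :: 'a \<Rightarrow> 'a::euclidean_space)"
  shows "integrable lborel D" "(\<integral>x. D x \<partial>lborel) = 0"
proof -
  obtain R where R: "0 < R" "\<And>x. x \<notin> cball 0 R \<Longrightarrow> \<phi> x = 0" "\<And>x. x \<notin> cball 0 R \<Longrightarrow> D x = 0"
    using C1_test_support[OF \<phi>] by metis
  note cont = C1_testD(2,3)[OF \<phi>]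
  have one: "set_integrable lborel K (\<lambda>x::'a. 1::real)" if "compact K" for K
    using that by (intro set_integrable_continuous_compact) auto
  show int: "integrable lborel D"
    using integrable_locally_times_compact_support[OF one cont(2) R(3) bounded_bilinear_scaleR] by simp
  have int\<phi>: "integrable lborel \<phi>"
    using integrable_locally_times_compact_support[OF one cont(1) R(2) bounded_bilinear_scaleR] by simp
  obtain C where C: "\<And>x. norm (D x) \<le> C"
  proof -
    have "bounded (D ` cball 0 R)"
      using cont by (intro compact_imp_bounded compact_continuous_image compact_cball)
        (rule continuous_on_subset, auto)
    then obtain C where "\<And>x. x \<in> cball 0 R \<Longrightarrow> norm (D x) \<le> C" unfolding bounded_iff by blast
    then have "norm (D x) \<le> max C 0" for x using R(3)[of x] by (cases "x \<in> cball 0 R") force+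
    then show ?thesis using that by blast
  qed
  have [measurable]: "\<phi> \<in> borel_measurable borel" "D \<in> borel_measurable borel"
    using cont by (auto intro: borel_measurable_continuous_onI)
  have "(\<integral>x. D x \<partial>lborel) \<bullet> b = 0" if b: "b \<in> Basis" for b
  proof -
    \<comment> \<open>step sizes at most 1, so that all translated supports lie in one ball\<close>
    define s where "s n = 1 / real (Suc n)" for n
    have s: "0 < s n" "s n \<le> 1" for n by (auto simp: s_def)
    have s0: "s \<longlonglongrightarrow> 0" unfolding s_def by (rule LIMSEQ_inverse_real_of_nat[unfolded inverse_eq_divide])
    define q where "q n x = (\<phi> (x + s n *\<^sub>R b) - \<phi> x) / s n" for n x
    have "(\<lambda>n. \<integral>x. q n x \<partial>lborel) \<longlonglongrightarrow> (\<integral>x. b \<bullet> D x \<partial>lborel)"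
    proof (rule integral_dominated_convergence)
      show "integrable lborel (\<lambda>x::'a. C * indicator (cball 0 (R + 1)) x)"
        by (intro integrable_mult_right integrable_real_indicator)
        (auto simp: emeasure_bounded_finite[unfolded infinity_ennreal_def])
      show "q n \<in> borel_measurable lborel" for n unfolding q_def by measurable
      show "AE x in lborel. (\<lambda>n. q n x) \<longlonglongrightarrow> b \<bullet> D x"
      proof (rule AE_I2)
        fix x
        have "((\<lambda>t. x + t *\<^sub>R b) has_derivative (\<lambda>t. t *\<^sub>R b)) (at 0)"
          by (auto intro!: derivative_eq_intros)
        moreover have "(\<phi> has_derivative (\<lambda>h. h \<bullet> D x)) (at (x + 0 *\<^sub>R b))"
          using C1_testD(1)[OF \<phi>, of x] by (simp add: gderiv_def)
        ultimately have "((\<lambda>t. \<phi> (x + t *\<^sub>R b)) has_derivative (\<lambda>t. (t *\<^sub>R b) \<bullet> D x)) (at 0)"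
          by (rule has_derivative_compose)
        then have "((\<lambda>t. \<phi> (x + t *\<^sub>R b)) has_real_derivative (b \<bullet> D x)) (at 0)"
          unfolding has_field_derivative_def
          by (rule has_derivative_eq_rhs) (simp add: fun_eq_iff mult.commute)
        then have "((\<lambda>h. (\<phi> (x + h *\<^sub>R b) - \<phi> x) / h) \<longlongrightarrow> b \<bullet> D x) (at 0)"
          by (simp add: DERIV_def)
        from this[unfolded tendsto_at_iff_sequentially, rule_format, of s]
        show "(\<lambda>n. q n x) \<longlonglongrightarrow> b \<bullet> D x"
          using s0 s(1) by (simp add: q_def comp_def less_le)
      qed
      show "AE x in lborel. norm (q n x) \<le> C * indicator (cball 0 (R + 1)) x" for n
      proof (rule AE_I2)
        fix x
        show "norm (q n x) \<le> C * indicator (cball 0 (R + 1)) x"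
        proof (cases "x \<in> cball 0 (R + 1)")
          case True
          have "norm (\<phi> (x + s n *\<^sub>R b) - \<phi> x) \<le> C * norm ((x + s n *\<^sub>R b) - x)"
          proof (rule differentiable_bound[of UNIV \<phi> "\<lambda>z h. h \<bullet> D z"])
            show "(\<phi> has_derivative (\<lambda>h. h \<bullet> D z)) (at z within UNIV)" for z
              using C1_testD(1)[OF \<phi>, of z] by (simp add: gderiv_def)
            show "onorm (\<lambda>h. h \<bullet> D z) \<le> C" for z
            proof (rule onorm_bound)
              show "0 \<le> C" using C norm_ge_zero order_trans by blast
              show "norm (h \<bullet> D z) \<le> C * norm h" for h
                using Cauchy_Schwarz_ineq2[of h "D z"] mult_left_mono[OF C[of z] norm_ge_zero[of h]]
                by (simp add: mult.commute)
            qed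
          qed auto
          then show ?thesis using True s(1)[of n] b by (simp add: q_def divide_simps)
        next
          case False
          have "R + 1 < norm x" using False by simp
          moreover have "norm x \<le> norm (x + s n *\<^sub>R b) + s n"
            using norm_triangle_ineq4[of "x + s n *\<^sub>R b" "s n *\<^sub>R b"] s(1)[of n] b by simp
          ultimately have "\<phi> (x + s n *\<^sub>R b) = 0" "\<phi> x = 0" using s(2)[of n] by (auto intro!: R(2))
          then show ?thesis using False by (simp add: q_def)
        qed
      qed
    qed measurable
    moreover have "(\<integral>x. q n x \<partial>lborel) = 0" for n
    proof -
      have d: "distr lborel borel (\<lambda>x. x + s n *\<^sub>R b) = (lborel :: 'a measure)"
      proof -
        have "(\<lambda>x. x + s n *\<^sub>R b) = (+) (s n *\<^sub>R b)" by (simp add: fun_eq_iff add.commute)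
        then show ?thesis using lborel_distr_plus[of "s n *\<^sub>R b"] by simp
      qed
      have "integrable (distr lborel borel (\<lambda>x. x + s n *\<^sub>R b)) \<phi>" using int\<phi> by (simp add: d)
      then have "integrable lborel (\<lambda>x. \<phi> (x + s n *\<^sub>R b))" by (subst (asm) integrable_distr_eq) auto
      moreover have "(\<integral>x. \<phi> (x + s n *\<^sub>R b) \<partial>lborel) = (\<integral>x. \<phi> x \<partial>lborel)"
        by (subst (2) d[symmetric], subst integral_distr) auto
      ultimately show ?thesis unfolding q_def using int\<phi> by simp
    qed
    ultimately have "(\<integral>x. b \<bullet> D x \<partial>lborel) = 0" by (simp add: LIMSEQ_const_iff)
    then show ?thesis using int by (simp add: inner_commute)
  qed
  then show "(\<integral>x. D x \<partial>lborel) = 0"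
    by (subst euclidean_eq_iff) simp
qed

text \<open>Integration by parts: the gradient of the product of \<open>u\<close> with a test function integrates to zero.\<close>

lemma has_weak_gradient_C1:
  fixes u :: "'a::euclidean_space \<Rightarrow> real"
  assumes u: "\<And>x. GDERIV u x :> G x" "continuous_on UNIV G"
  shows "has_weak_gradient u G"
  unfolding has_weak_gradient_iff
proof (intro conjI allI impI)
  note cu = GDERIV_imp_continuous[OF u(1)]
  show liu: "set_integrable lborel K u" and liG: "set_integrable lborel K G" if "compact K" for K
    using that u(2) cu by (auto intro: set_integrable_continuous_compact)
  fix \<phi> D assume \<phi>: "C1_test \<phi> (D :: 'a \<Rightarrow> 'a)"
  obtain R where R: "0 < R" "\<And>x. x \<notin> cball 0 R \<Longrightarrow> \<phi> x = 0" "\<And>x. x \<notin> cball 0 R \<Longrightarrow> D x = 0"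
    using C1_test_support[OF \<phi>] by metis
  have "integrable lborel (\<lambda>x. \<phi> x *\<^sub>R G x)"
    using integrable_locally_times_compact_support[OF liG C1_testD(2)[OF \<phi>] R(2)
          bounded_bilinear.flip[OF bounded_bilinear_scaleR]] .
  moreover have "integrable lborel (\<lambda>x. u x *\<^sub>R D x)"
    using integrable_locally_times_compact_support[OF liu C1_testD(3)[OF \<phi>] R(3) bounded_bilinear_scaleR] .
  ultimately have "(\<integral>x. \<phi> x *\<^sub>R G x \<partial>lborel) + (\<integral>x. u x *\<^sub>R D x \<partial>lborel) = 0"
    using integral_gradient_C1_test(2)[OF C1_test_mult[OF \<phi> u]]
    by (subst Bochner_Integration.integral_add[symmetric])
  then show "(\<integral>x. u x *\<^sub>R D x \<partial>lborel) = - (\<integral>x. \<phi> x *\<^sub>R G x \<partial>lborel)"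
    by (simp add: add_eq_0_iff)
qed

section \<open>From the log-Sobolev inequality to a bound on means\<close>

text \<open>A finite bound on the Fisher information rules out the case in which the entropy is infinite by
  convention, so that the inequality also yields the integrability of the entropy density.\<close>

lemma log_sobolev_entropy_bound:
  assumes ls: "log_sobolev \<rho> c" and \<nu>: "prob_space \<nu>" "sets \<nu> = sets borel"
    and FI: "FI \<nu> \<rho> \<le> ennreal K" "0 \<le> K"
  shows "absolutely_continuous \<rho> \<nu>" "integrable \<nu> (entropy_density (exp 1) \<rho> \<nu>)"
    "(\<integral>x. entropy_density (exp 1) \<rho> \<nu> x \<partial>\<nu>) \<le> c / 2 * K"
proof -
  have c: "0 < c" using ls by (simp add: log_sobolev_def)
  have "KL \<nu> \<rho> \<le> ennreal (c / 2) * FI \<nu> \<rho>" using ls \<nu> by (simp add: log_sobolev_def)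
  also have "\<dots> \<le> ennreal (c / 2) * ennreal K" using FI by (intro mult_left_mono) auto
  also have "\<dots> = ennreal (c / 2 * K)" using c FI by (intro ennreal_mult[symmetric]) auto
  finally have le: "KL \<nu> \<rho> \<le> ennreal (c / 2 * K)" .
  have P: "absolutely_continuous \<rho> \<nu> \<and> integrable \<nu> (entropy_density (exp 1) \<rho> \<nu>)"
  proof (rule ccontr)
    assume "\<not> ?thesis"
    then have "KL \<nu> \<rho> = \<infinity>" by (auto simp: KL_def)
    with le show False by (simp add: top_unique)
  qed
  then show "absolutely_continuous \<rho> \<nu>" "integrable \<nu> (entropy_density (exp 1) \<rho> \<nu>)" by auto
  from P le have "ennreal (KL_divergence (exp 1) \<rho> \<nu>) \<le> ennreal (c / 2 * K)" by (simp add: KL_def)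
  moreover have "0 \<le> c / 2 * K" using c FI by simp
  ultimately show "(\<integral>x. entropy_density (exp 1) \<rho> \<nu> x \<partial>\<nu>) \<le> c / 2 * K"
    by (simp add: KL_divergence_def ennreal_le_iff)
qed

text \<open>Weak gradients are unique up to Lebesgue null sets; this carries them over to a measure that is
  equivalent to Lebesgue measure.\<close>

lemma AE_density_lborel_pos:
  assumes "\<rho> = density lborel (\<lambda>x. ennreal (p x))" "p \<in> borel_measurable borel" "\<And>x. 0 < p x"
  shows "(AE x in \<rho>. P x) \<longleftrightarrow> (AE x in lborel. P x)"
  unfolding assms(1) using assms(2,3) by (subst AE_density) auto

text \<open>A probability measure that is equivalent to Lebesgue measure, satisfies a log-Sobolev inequality and
  has exponential moments in a fixed direction \<open>v\<close>; the moments make the Laplace transform below smooth.\<close>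

locale log_sobolev_exp_moments = prob_space \<rho> for \<rho> :: "'a::euclidean_space measure" +
  fixes p :: "'a \<Rightarrow> real" and c :: real and v :: 'a
  assumes \<rho>_density: "\<rho> = density lborel (\<lambda>x. ennreal (p x))"
    and p_meas: "p \<in> borel_measurable borel" and p_pos: "\<And>x. 0 < p x"
    and lsi: "log_sobolev \<rho> c"
    and exp_integrable: "\<And>a. integrable \<rho> (\<lambda>x. exp (a * (v \<bullet> x)))"
    and v_norm: "norm v = 1"
begin

lemma sets_\<rho> [simp, measurable_cong]: "sets \<rho> = sets borel" by (simp add: \<rho>_density)
lemma space_\<rho> [simp]: "space \<rho> = UNIV" by (simp add: \<rho>_density)

lemma inner_exp_bound:
  assumes "\<bar>a - a0\<bar> < 1"
  shows "\<bar>v \<bullet> x\<bar> * exp (a * (v \<bullet> x)) \<le> exp ((a0 + 2) * (v \<bullet> x)) + exp ((a0 - 2) * (v \<bullet> x))"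
proof -
  let ?X = "v \<bullet> x"
  have "(a - a0) * ?X \<le> \<bar>?X\<bar>"
  proof -
    have "(a - a0) * ?X \<le> \<bar>a - a0\<bar> * \<bar>?X\<bar>" by (metis abs_ge_self abs_mult)
    also have "\<dots> \<le> 1 * \<bar>?X\<bar>" using assms by (intro mult_right_mono) auto
    finally show ?thesis by simp
  qed
  then have "a * ?X \<le> a0 * ?X + \<bar>?X\<bar>" by (simp add: algebra_simps)
  moreover have "\<bar>?X\<bar> \<le> exp \<bar>?X\<bar>" using exp_ge_add_one_self[of "\<bar>?X\<bar>"] by linarith
  ultimately have "\<bar>?X\<bar> * exp (a * ?X) \<le> exp \<bar>?X\<bar> * exp (a0 * ?X + \<bar>?X\<bar>)"
    by (intro mult_mono) auto
  also have "\<dots> = exp (a0 * ?X + 2 * \<bar>?X\<bar>)" by (simp flip: exp_add)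
  also have "\<dots> \<le> exp ((a0 + 2) * ?X) + exp ((a0 - 2) * ?X)"
    by (cases "0 \<le> ?X") (auto simp: algebra_simps add_increasing add_increasing2)
  finally show ?thesis .
qed

lemma inner_exp_integrable: "integrable \<rho> (\<lambda>x. (v \<bullet> x) * exp (a * (v \<bullet> x)))"
proof (rule Bochner_Integration.integrable_bound)
  show "integrable \<rho> (\<lambda>x. exp ((a + 2) * (v \<bullet> x)) + exp ((a - 2) * (v \<bullet> x)))"
    by (intro Bochner_Integration.integrable_add exp_integrable)
  show "AE x in \<rho>. norm ((v \<bullet> x) * exp (a * (v \<bullet> x))) \<le> norm (exp ((a + 2) * (v \<bullet> x)) + exp ((a - 2) * (v \<bullet> x)))"
    using inner_exp_bound[of a a] by (intro AE_I2) (simp add: abs_mult)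
qed measurable

definition Z where "Z a = (\<integral>x. exp (a * (v \<bullet> x)) \<partial>\<rho>)"
definition Z' where "Z' a = (\<integral>x. (v \<bullet> x) * exp (a * (v \<bullet> x)) \<partial>\<rho>)"

lemma Z_pos: "0 < Z a"
proof -
  have "Z a \<noteq> 0"
  proof
    assume "Z a = 0"
    then have "AE x in \<rho>. exp (a * (v \<bullet> x)) = 0"
      unfolding Z_def using integral_nonneg_eq_0_iff_AE[OF exp_integrable[of a]] by simp
    then have "AE x in \<rho>. False" by simp
    then show False by (simp add: AE_False)
  qed
  moreover have "0 \<le> Z a" unfolding Z_def by (intro Bochner_Integration.integral_nonneg) auto
  ultimately show ?thesis by simp
qed

lemma Z_0: "Z 0 = 1" using prob_space by (simp add: Z_def)
lemma Z'_0: "Z' 0 = (\<integral>x. v \<bullet> x \<partial>\<rho>)" by (simp add: Z'_def)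

lemma Z_deriv: "(Z has_real_derivative Z' a) (at a)"
proof -
  have "GDERIV (\<lambda>a. \<integral>x. exp (a * (v \<bullet> x)) \<partial>\<rho>) a :> (\<integral>x. (v \<bullet> x) * exp (a * (v \<bullet> x)) \<partial>\<rho>)"
  proof (rule GDERIV_integral[of 1 _ _ _ "\<lambda>x a. (v \<bullet> x) * exp (a * (v \<bullet> x))"
      "\<lambda>x. exp ((a + 2) * (v \<bullet> x)) + exp ((a - 2) * (v \<bullet> x))"])
    show "norm ((v \<bullet> x) * exp (b * (v \<bullet> x))) \<le> exp ((a + 2) * (v \<bullet> x)) + exp ((a - 2) * (v \<bullet> x))"
      if "b \<in> ball a 1" for x b
      using that inner_exp_bound[of b a x] by (simp add: abs_mult dist_real_def abs_minus_commute)
  qed (auto intro!: exp_integrable derivative_eq_intros)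
  then show ?thesis by (simp add: Z_def[abs_def] Z'_def)
qed

definition tilt where "tilt a = density \<rho> (\<lambda>x. ennreal (exp (a * (v \<bullet> x)) / Z a))"

lemma prob_space_tilt: "prob_space (tilt a)"
proof
  have "emeasure (tilt a) (space (tilt a)) = (\<integral>\<^sup>+x. ennreal (exp (a * (v \<bullet> x)) / Z a) \<partial>\<rho>)"
    unfolding tilt_def by (simp add: emeasure_density)
  also have "\<dots> = ennreal (\<integral>x. exp (a * (v \<bullet> x)) / Z a \<partial>\<rho>)"
    using Z_pos[of a] exp_integrable[of a] by (intro nn_integral_eq_integral) (auto intro!: AE_I2)
  also have "(\<integral>x. exp (a * (v \<bullet> x)) / Z a \<partial>\<rho>) = 1"
    using Z_pos[of a] by (simp flip: Z_def)
  finally show "emeasure (tilt a) (space (tilt a)) = 1" by simp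
qed

text \<open>The log-density of the tilted measure is affine with slope \<open>a v\<close>.\<close>

lemma FI_tilt: "FI (tilt a) \<rho> \<le> ennreal (a\<^sup>2)"
proof -
  interpret T: prob_space "tilt a" by (rule prob_space_tilt)
  have AE: "AE x in tilt a. P x" if "AE x in lborel. P x" for P
    using that AE_density_lborel_pos[OF \<rho>_density p_meas p_pos, of P] unfolding tilt_def
    by (subst AE_density) (auto elim: eventually_mono)
  define u where "u x = exp (a / 2 * (v \<bullet> x))" for x
  define G where "G x = (a / 2 * exp (a / 2 * (v \<bullet> x))) *\<^sub>R v" for x
  have "AE x in \<rho>. ennreal (exp (a * (v \<bullet> x)) / Z a) = RN_deriv \<rho> (tilt a) x"
    by (rule RN_deriv_unique) (auto simp: tilt_def)
  then have "AE x in lborel. sqrt_ratio (tilt a) \<rho> x = (1 / sqrt (Z a)) * u x"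
    unfolding AE_density_lborel_pos[OF \<rho>_density p_meas p_pos]
  proof eventually_elim
    fix x assume "ennreal (exp (a * (v \<bullet> x)) / Z a) = RN_deriv \<rho> (tilt a) x"
    then have "sqrt_ratio (tilt a) \<rho> x = sqrt (exp (a * (v \<bullet> x)) / Z a)"
      unfolding sqrt_ratio_def using Z_pos[of a] by (metis divide_nonneg_pos enn2real_ennreal exp_ge_zero)
    moreover have "exp (a * (v \<bullet> x)) = (u x)\<^sup>2"
      by (simp add: u_def power2_eq_square flip: exp_add)
    ultimately show "sqrt_ratio (tilt a) \<rho> x = (1 / sqrt (Z a)) * u x"
      by (simp add: real_sqrt_divide u_def)
  qed
  note eq = this
  have "has_weak_gradient u G"
  proof (rule has_weak_gradient_C1)
    show "GDERIV u x :> G x" for x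
      unfolding gderiv_def u_def G_def
      by (auto intro!: derivative_eq_intros simp: inner_commute)
    show "continuous_on UNIV G" unfolding G_def by (intro continuous_intros)
  qed
  from has_weak_gradient_AE_scale[OF this eq]
  have wg: "has_weak_gradient (sqrt_ratio (tilt a) \<rho>) (\<lambda>x. (1 / sqrt (Z a)) *\<^sub>R G x)"
    unfolding sqrt_ratio_def using measurable_cong_sets[OF sets_\<rho> refl] by simp
  have "AE x in lborel. grad_log_ratio (tilt a) \<rho> x = a *\<^sub>R v"
    using weak_gradient_AE[OF wg] eq
    by eventually_elim (use Z_pos[of a] in \<open>simp add: grad_log_ratio_def G_def u_def\<close>)
  then have "(\<integral>\<^sup>+x. ennreal ((norm (grad_log_ratio (tilt a) \<rho> x))\<^sup>2) \<partial>tilt a) = (\<integral>\<^sup>+x. ennreal (a\<^sup>2) \<partial>tilt a)"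
    by (intro nn_integral_cong_AE AE) (auto elim!: eventually_mono simp: v_norm)
  moreover have "absolutely_continuous \<rho> (tilt a)"
    unfolding tilt_def by (rule absolutely_continuousI_density) measurable
  ultimately show ?thesis
    using wg by (auto simp: FI_def weakly_differentiable_def T.emeasure_space_1)
qed

text \<open>The log-Sobolev inequality for the tilted measure. Its left-hand side is the relative entropy, and it
  equals \<open>a\<^sup>2\<close> times the derivative of \<open>ln (Z a) / a\<close>.\<close>

lemma entropy_tilt: "a * (Z' a / Z a) - ln (Z a) \<le> c / 2 * a\<^sup>2"
proof -
  interpret T: prob_space "tilt a" by (rule prob_space_tilt)
  have "(\<integral>x. entropy_density (exp 1) \<rho> (tilt a) x \<partial>tilt a) \<le> c / 2 * a\<^sup>2"
    by (rule log_sobolev_entropy_bound[OF lsi prob_space_tilt _ FI_tilt]) (simp_all add: tilt_def)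
  moreover have "(\<integral>x. entropy_density (exp 1) \<rho> (tilt a) x \<partial>tilt a)
      = a * (Z' a / Z a) - ln (Z a)"
  proof -
    have "(\<integral>x. entropy_density (exp 1) \<rho> (tilt a) x \<partial>tilt a)
      = (\<integral>x. exp (a * (v \<bullet> x)) / Z a * log (exp 1) (exp (a * (v \<bullet> x)) / Z a) \<partial>\<rho>)"
      using KL_density[of "exp 1" "\<lambda>x. exp (a * (v \<bullet> x)) / Z a"] Z_pos[of a]
      by (simp add: KL_divergence_def tilt_def)
    also have "\<dots> = (\<integral>x. (a / Z a) * ((v \<bullet> x) * exp (a * (v \<bullet> x))) - (ln (Z a) / Z a) * exp (a * (v \<bullet> x)) \<partial>\<rho>)"
      using Z_pos[of a] by (intro Bochner_Integration.integral_cong) (auto simp: log_def ln_div field_simps)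
    also have "\<dots> = (a / Z a) * Z' a - (ln (Z a) / Z a) * Z a"
      using inner_exp_integrable[of a] exp_integrable[of a]
      by (subst Bochner_Integration.integral_diff) (auto simp: Z_def Z'_def)
    finally show ?thesis using Z_pos[of a] by simp
  qed
  ultimately show ?thesis by simp
qed

text \<open>The Herbst argument: the entropy inequality says that \<open>ln (Z t) / t - c t / 2\<close> is nonincreasing for
  \<open>t > 0\<close>, and its limit at \<open>0\<close> is the derivative of \<open>ln Z\<close> there, that is, the mean.\<close>

lemma herbst_laplace_bound:
  assumes a: "0 < a"
  shows "ln (Z a) \<le> a * (\<integral>x. v \<bullet> x \<partial>\<rho>) + c / 2 * a\<^sup>2"
proof -
  define g where "g t = ln (Z t) / t - c / 2 * t" for t
  have dln: "((\<lambda>t. ln (Z t)) has_real_derivative Z' t / Z t) (at t)" for t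
    using DERIV_chain2[OF DERIV_ln_divide[OF Z_pos] Z_deriv, of t] by simp
  have anti: "g a \<le> g b" if "0 < b" "b < a" for b
  proof (rule DERIV_nonpos_imp_nonincreasing[of b a g])
    show "b \<le> a" using that by simp
    fix t assume t: "b \<le> t" "t \<le> a"
    then have "0 < t" using that by simp
    have "(g has_real_derivative ((Z' t / Z t * t - ln (Z t) * 1) / (t * t) - c / 2 * 1)) (at t)"
      unfolding g_def using \<open>0 < t\<close>
      by (intro DERIV_diff DERIV_divide DERIV_cmult dln DERIV_ident) auto
    moreover have "(Z' t / Z t * t - ln (Z t) * 1) / (t * t) - c / 2 * 1 \<le> 0"
      using entropy_tilt[of t] \<open>0 < t\<close> by (simp add: field_simps power2_eq_square)
    ultimately show "\<exists>y. (g has_real_derivative y) (at t) \<and> y \<le> 0" by blast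
  qed
  have "((\<lambda>t. ln (Z t) / t) \<longlongrightarrow> Z' 0) (at 0)"
    using dln[of 0] by (simp add: has_field_derivative_iff Z_0)
  then have "((\<lambda>t. ln (Z t) / t - c / 2 * t) \<longlongrightarrow> Z' 0 - c / 2 * 0) (at 0)"
    by (intro tendsto_intros)
  then have lim: "(g \<longlongrightarrow> Z' 0) (at_right 0)"
    unfolding g_def by (simp add: filterlim_at_split)
  have "g a \<le> Z' 0"
  proof (rule tendsto_lowerbound[OF lim])
    show "\<forall>\<^sub>F b in at_right 0. g a \<le> g b"
      using anti a by (auto simp: eventually_at_right_field intro!: exI[of _ a])
  qed simp
  then show ?thesis using a unfolding g_def Z'_0 by (simp add: field_simps power2_eq_square)
qed

text \<open>Gibbs' inequality between \<open>\<nu>\<close> and the tilted measure: \<open>ln q \<le> q - 1\<close> for the ratio \<open>q\<close> of their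
  densities, and \<open>q\<close> has \<open>\<nu>\<close>-integral at most 1.\<close>

lemma donsker_varadhan:
  assumes \<nu>: "prob_space \<nu>" "sets \<nu> = sets borel" and ac: "absolutely_continuous \<rho> \<nu>"
    and ent: "integrable \<nu> (entropy_density (exp 1) \<rho> \<nu>)" and X: "integrable \<nu> (\<lambda>x. v \<bullet> x)"
  shows "a * (\<integral>x. v \<bullet> x \<partial>\<nu>) - ln (Z a) \<le> (\<integral>x. entropy_density (exp 1) \<rho> \<nu> x \<partial>\<nu>)"
proof -
  interpret N: prob_space \<nu> by fact
  note [measurable_cong] = \<nu>(2)
  define r where "r = RN_deriv \<rho> \<nu>"
  have [measurable]: "r \<in> borel_measurable borel"
    using borel_measurable_RN_deriv[of \<rho> \<nu>] measurable_cong_sets[OF sets_\<rho> refl] by (simp add: r_def)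
  have \<nu>_eq: "density \<rho> r = \<nu>" unfolding r_def by (rule density_RN_deriv[OF ac]) (simp add: \<nu>)
  have fin: "AE x in \<rho>. r x \<noteq> \<infinity>" unfolding r_def
    by (rule RN_deriv_finite[OF _ ac]) (simp_all add: \<nu> N.sigma_finite_measure_axioms)
  have pos: "AE x in \<nu>. 0 < enn2real (r x)"
    unfolding \<nu>_eq[symmetric]
    by (subst AE_density) (use fin in \<open>auto elim!: eventually_mono simp: enn2real_positive_iff less_top\<close>)
  define q where "q x = exp (a * (v \<bullet> x)) / (Z a * enn2real (r x))" for x
  have q_nonneg: "0 \<le> q x" for x using Z_pos[of a] by (simp add: q_def)
  have [measurable]: "q \<in> borel_measurable borel" unfolding q_def by measurable
  have "(\<integral>\<^sup>+x. ennreal (q x) \<partial>\<nu>) = (\<integral>\<^sup>+x. r x * ennreal (q x) \<partial>\<rho>)"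
    unfolding \<nu>_eq[symmetric] by (subst nn_integral_density) auto
  also have "\<dots> \<le> (\<integral>\<^sup>+x. ennreal (exp (a * (v \<bullet> x)) / Z a) \<partial>\<rho>)"
  proof (rule nn_integral_mono_AE, use fin in eventually_elim)
    fix x assume "r x \<noteq> \<infinity>"
    then obtain s where s: "r x = ennreal s" "0 \<le> s" by (cases "r x") auto
    have "r x * ennreal (q x) = ennreal (s * q x)" using s q_nonneg by (simp add: ennreal_mult)
    also have "\<dots> \<le> ennreal (exp (a * (v \<bullet> x)) / Z a)"
      using s Z_pos[of a] by (intro ennreal_leI) (simp add: q_def)
    finally show "r x * ennreal (q x) \<le> ennreal (exp (a * (v \<bullet> x)) / Z a)" .
  qed
  also have "\<dots> = emeasure (tilt a) (space (tilt a))"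
    unfolding tilt_def by (simp add: emeasure_density)
  also have "\<dots> = 1" using prob_space.emeasure_space_1[OF prob_space_tilt] .
  finally have q_le: "(\<integral>\<^sup>+x. ennreal (q x) \<partial>\<nu>) \<le> 1" .
  have q_int: "integrable \<nu> q"
    using q_nonneg q_le by (intro integrableI_bounded) (auto simp: order_le_less_trans)
  have "(\<integral>x. q x \<partial>\<nu>) \<le> 1"
    using q_le nn_integral_eq_integral[OF q_int] q_nonneg by simp
  have "(\<integral>x. a * (v \<bullet> x) - ln (Z a) - entropy_density (exp 1) \<rho> \<nu> x \<partial>\<nu>) \<le> (\<integral>x. q x - 1 \<partial>\<nu>)"
  proof (rule integral_mono_AE)
    show "AE x in \<nu>. a * (v \<bullet> x) - ln (Z a) - entropy_density (exp 1) \<rho> \<nu> x \<le> q x - 1"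
      using pos
    proof eventually_elim
      fix x assume r: "0 < enn2real (r x)"
      then have "0 < q x" using Z_pos[of a] by (simp add: q_def)
      moreover have "ln (q x) = a * (v \<bullet> x) - ln (Z a) - entropy_density (exp 1) \<rho> \<nu> x"
        using r Z_pos[of a] by (simp add: q_def ln_div ln_mult entropy_density_def r_def[symmetric] log_def)
      ultimately show "a * (v \<bullet> x) - ln (Z a) - entropy_density (exp 1) \<rho> \<nu> x \<le> q x - 1"
        using ln_le_minus_one[of "q x"] by simp
    qed
  qed (use q_int ent X in auto)
  also have "\<dots> \<le> 0" using \<open>(\<integral>x. q x \<partial>\<nu>) \<le> 1\<close> q_int by (simp add: N.prob_space)
  finally show ?thesis using ent X by (simp add: N.prob_space)
qed

text \<open>Duality gives \<open>a d \<le> c L\<^sup>2 / 2 + c a\<^sup>2 / 2\<close> for the difference \<open>d\<close> of the means and all \<open>a > 0\<close>; the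
  optimal choice is \<open>a = L\<close>. If \<open>L = 0\<close>, no \<open>a > 0\<close> is optimal and \<open>a = d / c\<close> refutes \<open>d > 0\<close>.\<close>

lemma linear_mean_difference:
  assumes \<nu>: "prob_space \<nu>" "sets \<nu> = sets borel" and X: "integrable \<nu> (\<lambda>x. v \<bullet> x)"
    and FI: "FI \<nu> \<rho> \<le> ennreal (L\<^sup>2)" and L: "0 \<le> L"
  shows "(\<integral>x. v \<bullet> x \<partial>\<nu>) - (\<integral>x. v \<bullet> x \<partial>\<rho>) \<le> c * L"
proof -
  define d where "d = (\<integral>x. v \<bullet> x \<partial>\<nu>) - (\<integral>x. v \<bullet> x \<partial>\<rho>)"
  have c: "0 < c" using lsi by (simp add: log_sobolev_def)
  note ent = log_sobolev_entropy_bound[OF lsi \<nu> FI]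
  have key: "a * d \<le> c / 2 * L\<^sup>2 + c / 2 * a\<^sup>2" if "0 < a" for a
    using donsker_varadhan[OF \<nu> ent(1,2) X, of a] ent(3) herbst_laplace_bound[OF that] L
    by (simp add: d_def algebra_simps)
  show ?thesis
  proof (cases "L = 0")
    case True
    have "d \<le> 0"
    proof (rule ccontr)
      assume "\<not> d \<le> 0"
      with key[of "d / c"] c True show False by (simp add: field_simps power2_eq_square)
    qed
    then show ?thesis using True by (simp add: d_def)
  next
    case False
    with key[of L] L have "L * d \<le> L * (c * L)" by (simp add: power2_eq_square algebra_simps)
    then show ?thesis using False L by (simp add: d_def)
  qed
qed

end

section \<open>Posterior measures and the scores of the noised laws\<close>

lemma ou_kernel_pos: "0 < t \<Longrightarrow> 0 < ou_kernel t x y"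
  by (simp add: ou_kernel_def gauss_density_def)

lemma ou_kernel_nonneg: "0 < t \<Longrightarrow> 0 \<le> ou_kernel t x y"
  by (rule ou_kernel_bound(1))

lemma GDERIV_ou_kernel:
  assumes t: "0 < t"
  shows "GDERIV (ou_kernel t x) y :>
    (- ou_kernel t x y / (1 - exp (- 2 * t))) *\<^sub>R (y - exp (- t) *\<^sub>R x)"
proof -
  define V where "V = 1 - exp (- 2 * t)"
  have V: "0 < V" using t by (simp add: V_def)
  define K where "K = (2 * pi * V) powr (- (real DIM('a) / 2))"
  define m where "m = exp (- t) *\<^sub>R x"
  have eq: "ou_kernel t x = (\<lambda>y. K * exp (- ((y - m) \<bullet> (y - m)) / (2 * V)))"
    by (auto simp: fun_eq_iff ou_kernel_def gauss_density_def K_def V_def m_def power2_norm_eq_inner)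
  have "GDERIV (\<lambda>y. (y - m) \<bullet> (y - m)) y :> 2 *\<^sub>R (y - m)"
    unfolding gderiv_def
    by (auto intro!: derivative_eq_intros simp: inner_commute algebra_simps)
  moreover have "((\<lambda>z. K * exp (- z / (2 * V))) has_real_derivative
      (- (K * exp (- z / (2 * V))) / (2 * V))) (at z)" for z
    using V by (auto intro!: derivative_eq_intros)
  ultimately have "GDERIV (\<lambda>y. K * exp (- ((y - m) \<bullet> (y - m)) / (2 * V))) y :>
     (- (K * exp (- ((y - m) \<bullet> (y - m)) / (2 * V))) / (2 * V)) *\<^sub>R (2 *\<^sub>R (y - m))"
    by (rule GDERIV_DERIV_compose)
  then show ?thesis unfolding eq V_def[symmetric] m_def[symmetric] by simp
qed

text \<open>A linear factor times a Gaussian is bounded; the bound has to be uniform in both variables, in order to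
  dominate the differentiation under the integral.\<close>

lemma grad_ou_kernel_bounded:
  assumes t: "0 < t"
  obtains W where "\<And>x y :: 'a::euclidean_space.
    norm ((- ou_kernel t x y / (1 - exp (- 2 * t))) *\<^sub>R (y - exp (- t) *\<^sub>R x)) \<le> W"
proof -
  define V where "V = 1 - exp (- 2 * t)"
  have V: "0 < V" using t by (simp add: V_def)
  define K where "K = (2 * pi * V) powr (- (real DIM('a) / 2))"
  have "norm ((- ou_kernel t x y / V) *\<^sub>R (y - exp (- t) *\<^sub>R x)) \<le> K / V * (1 + V / 2)" for x y :: 'a
  proof -
    define r where "r = norm (y - exp (- t) *\<^sub>R x)"
    define z where "z = r\<^sup>2 / (2 * V)"
    have z: "0 \<le> z" using V by (simp add: z_def)
    have k: "ou_kernel t x y = K * exp (- z)"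
      by (simp add: ou_kernel_def gauss_density_def K_def V_def r_def z_def)
    \<comment> \<open>with \<open>z = r\<^sup>2 / (2V)\<close> this is the inequality of arithmetic and geometric means\<close>
    have "r \<le> z + V / 2"
    proof -
      have "0 \<le> (r - V)\<^sup>2 / (2 * V)" using V by simp
      then show ?thesis using V by (simp add: z_def field_simps power2_eq_square)
    qed
    also have "\<dots> \<le> (1 + V / 2) * (1 + z)"
    proof -
      have "(1 + V / 2) * (1 + z) = 1 + z + V / 2 + V * z / 2" by (simp add: field_simps)
      then show ?thesis using mult_nonneg_nonneg[OF less_imp_le[OF V] z] by linarith
    qed
    also have "\<dots> \<le> (1 + V / 2) * exp z" using V by (intro mult_left_mono) auto
    finally have "r * exp (- z) \<le> (1 + V / 2) * exp z * exp (- z)" by (rule mult_right_mono) simp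
    then have r: "r * exp (- z) \<le> 1 + V / 2" by (simp add: mult.assoc flip: exp_add)
    have "norm ((- ou_kernel t x y / V) *\<^sub>R (y - exp (- t) *\<^sub>R x)) = K / V * (r * exp (- z))"
      using V by (simp add: k r_def[symmetric] K_def abs_mult)
    also have "\<dots> \<le> K / V * (1 + V / 2)"
      using r V by (intro mult_left_mono) (auto simp: K_def)
    finally show ?thesis .
  qed
  then show ?thesis using that unfolding V_def by blast
qed

text \<open>For fixed \<open>y\<close> the kernel is also a Gaussian in \<open>x\<close>; hence all posteriors have all exponential moments,
  whatever the tails of the prior are.\<close>

lemma exp_norm_ou_kernel_bounded:
  assumes t: "0 < t" and b: "0 \<le> b"
  obtains W where "\<And>x :: 'a::euclidean_space. exp (b * norm x) * ou_kernel t x y \<le> W"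
proof -
  define V where "V = 1 - exp (- 2 * t)"
  have V: "0 < V" using t by (simp add: V_def)
  define K where "K = (2 * pi * V) powr (- (real DIM('a) / 2))"
  define \<beta> where "\<beta> = b * exp t"
  have \<beta>: "0 \<le> \<beta>" using b by (simp add: \<beta>_def)
  have "exp (b * norm x) * ou_kernel t x y \<le> K * exp (\<beta> * norm y + V * \<beta>\<^sup>2 / 2)" for x :: 'a
  proof -
    define r where "r = norm (y - exp (- t) *\<^sub>R x)"
    have k: "ou_kernel t x y = K * exp (- r\<^sup>2 / (2 * V))"
      by (simp add: ou_kernel_def gauss_density_def K_def V_def r_def)
    have "norm (exp (- t) *\<^sub>R x) \<le> norm y + r"
      unfolding r_def using norm_triangle_ineq4[of y "y - exp (- t) *\<^sub>R x"] by simp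
    then have "\<beta> * (exp (- t) * norm x) \<le> \<beta> * (norm y + r)" using \<beta> by (intro mult_left_mono) auto
    moreover have "\<beta> * (exp (- t) * norm x) = b * norm x"
      by (simp add: \<beta>_def mult.assoc[symmetric] exp_minus)
    ultimately have "b * norm x \<le> \<beta> * norm y + \<beta> * r" by (metis distrib_left)
    moreover have "\<beta> * r - r\<^sup>2 / (2 * V) \<le> V * \<beta>\<^sup>2 / 2"
    proof -
      have "0 \<le> (r - V * \<beta>)\<^sup>2 / (2 * V)" using V by simp
      then show ?thesis using V by (simp add: field_simps power2_eq_square)
    qed
    ultimately have "b * norm x + - r\<^sup>2 / (2 * V) \<le> \<beta> * norm y + V * \<beta>\<^sup>2 / 2" by simp
    then have "exp (b * norm x) * exp (- r\<^sup>2 / (2 * V)) \<le> exp (\<beta> * norm y + V * \<beta>\<^sup>2 / 2)"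
      by (simp flip: exp_add)
    then have "K * (exp (b * norm x) * exp (- r\<^sup>2 / (2 * V))) \<le> K * exp (\<beta> * norm y + V * \<beta>\<^sup>2 / 2)"
      by (rule mult_left_mono) (simp add: K_def)
    then show ?thesis by (simp add: k mult_ac)
  qed
  then show ?thesis using that by blast
qed

lemma ou_kernel_measurable_fst [measurable]:
  "(\<lambda>x. ou_kernel t x y) \<in> borel_measurable (borel :: 'a::euclidean_space measure)"
  unfolding ou_kernel_def gauss_density_def by measurable

context
  fixes \<rho> :: "'a::euclidean_space measure" and t :: real
  assumes \<rho>: "prob_space \<rho>" "sets \<rho> = sets borel" and t: "0 < t"
begin

interpretation prob_space \<rho> by (rule \<rho>)

lemmas [measurable_cong] = \<rho>(2)

lemma space_prob_borel: "space \<rho> = UNIV" using sets_eq_imp_space_eq[OF \<rho>(2)] by simp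

lemma integrable_ou_kernel: "integrable \<rho> (\<lambda>x. ou_kernel t x y)"
proof (rule integrable_const_bound)
  show "AE x in \<rho>. norm (ou_kernel t x y) \<le> (2 * pi * (1 - exp (- 2 * t))) powr (- (real DIM('a) / 2))"
    using ou_kernel_bound[OF t, where 'a='a] by (intro AE_I2) simp
qed measurable

lemma ou_density_pos: "0 < ou_density t \<rho> y"
proof -
  have "ou_density t \<rho> y \<noteq> 0"
  proof
    assume "ou_density t \<rho> y = 0"
    then have "AE x in \<rho>. ou_kernel t x y = 0"
      unfolding ou_density_def
      using integral_nonneg_eq_0_iff_AE[OF integrable_ou_kernel[of y]] ou_kernel_nonneg[OF t, where 'a='a] by simp
    then have "AE x in \<rho>. False"
      by (rule eventually_mono) (metis less_irrefl ou_kernel_pos[OF t])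
    then show False by (simp add: AE_False)
  qed
  moreover have "0 \<le> ou_density t \<rho> y"
    unfolding ou_density_def using ou_kernel_nonneg[OF t, where 'a='a] by (intro Bochner_Integration.integral_nonneg) auto
  ultimately show ?thesis by simp
qed

lemma prob_space_ou_posterior: "prob_space (ou_posterior \<rho> y t)"
proof
  have "emeasure (ou_posterior \<rho> y t) (space (ou_posterior \<rho> y t))
      = (\<integral>\<^sup>+x. ennreal (ou_kernel t x y / ou_density t \<rho> y) \<partial>\<rho>)"
    unfolding ou_posterior_def by (simp add: emeasure_density space_prob_borel)
  also have "\<dots> = ennreal (\<integral>x. ou_kernel t x y / ou_density t \<rho> y \<partial>\<rho>)"
    using ou_density_pos[of y] integrable_ou_kernel[of y] ou_kernel_nonneg[OF t, where 'a='a]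
    by (intro nn_integral_eq_integral) (auto intro!: AE_I2)
  also have "(\<integral>x. ou_kernel t x y / ou_density t \<rho> y \<partial>\<rho>) = 1"
    using ou_density_pos[of y] by (simp flip: ou_density_def)
  finally show "emeasure (ou_posterior \<rho> y t) (space (ou_posterior \<rho> y t)) = 1" by simp
qed

lemma sets_ou_posterior: "sets (ou_posterior \<rho> y t) = sets borel"
  by (simp add: ou_posterior_def \<rho>)

lemma integrable_ou_posterior:
  fixes f :: "'a \<Rightarrow> 'b::{banach, second_countable_topology}"
  assumes [measurable]: "f \<in> borel_measurable borel" and f: "\<And>x. norm (f x) \<le> exp (b * norm x)" and b: "0 \<le> b"
  shows "integrable (ou_posterior \<rho> y t) f"
    and "(\<integral>x. f x \<partial>ou_posterior \<rho> y t) = (\<integral>x. ou_kernel t x y *\<^sub>R f x \<partial>\<rho>) /\<^sub>R ou_density t \<rho> y"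
    and "integrable \<rho> (\<lambda>x. ou_kernel t x y *\<^sub>R f x)"
proof -
  obtain W where W: "\<And>x :: 'a. exp (b * norm x) * ou_kernel t x y \<le> W"
    using exp_norm_ou_kernel_bounded[OF t b] by metis
  show i: "integrable \<rho> (\<lambda>x. ou_kernel t x y *\<^sub>R f x)"
  proof (rule integrable_const_bound[where B=W])
    show "AE x in \<rho>. norm (ou_kernel t x y *\<^sub>R f x) \<le> W"
    proof (rule AE_I2)
      fix x
      have "norm (ou_kernel t x y *\<^sub>R f x) = norm (f x) * ou_kernel t x y"
        using ou_kernel_bound(1)[OF t, of x y] by simp
      also have "\<dots> \<le> exp (b * norm x) * ou_kernel t x y"
        using f ou_kernel_nonneg[OF t, where 'a='a] by (intro mult_right_mono) auto
      also have "\<dots> \<le> W" by (rule W)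
      finally show "norm (ou_kernel t x y *\<^sub>R f x) \<le> W" .
    qed
  qed measurable
  have nn: "AE x in \<rho>. 0 \<le> ou_kernel t x y / ou_density t \<rho> y"
    using ou_kernel_nonneg[OF t, where 'a='a] ou_density_pos[of y] by (intro AE_I2) auto
  have eq: "(ou_kernel t x y / ou_density t \<rho> y) *\<^sub>R f x = (ou_kernel t x y *\<^sub>R f x) /\<^sub>R ou_density t \<rho> y" for x
    by (simp add: divide_inverse mult.commute)
  show "integrable (ou_posterior \<rho> y t) f"
    unfolding ou_posterior_def using nn i
    by (subst integrable_density) (auto simp: eq simp del: scaleR_scaleR)
  show "(\<integral>x. f x \<partial>ou_posterior \<rho> y t) = (\<integral>x. ou_kernel t x y *\<^sub>R f x \<partial>\<rho>) /\<^sub>R ou_density t \<rho> y"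
    unfolding ou_posterior_def using nn
    by (subst integral_density) (auto simp: eq simp del: scaleR_scaleR)
qed

lemma integrable_id_ou_posterior: "integrable (ou_posterior \<rho> y t) (\<lambda>x. x)"
  and integral_id_ou_posterior:
    "(\<integral>x. x \<partial>ou_posterior \<rho> y t) = (\<integral>x. ou_kernel t x y *\<^sub>R x \<partial>\<rho>) /\<^sub>R ou_density t \<rho> y"
  and integrable_ou_kernel_scaleR: "integrable \<rho> (\<lambda>x. ou_kernel t x y *\<^sub>R x)"
proof -
  have "norm x \<le> exp (1 * norm x)" for x :: 'a
    using exp_ge_add_one_self[of "norm x"] unfolding mult_1 by linarith
  note * = integrable_ou_posterior[of "\<lambda>x. x", OF _ this]
  show "integrable (ou_posterior \<rho> y t) (\<lambda>x. x)"
    "(\<integral>x. x \<partial>ou_posterior \<rho> y t) = (\<integral>x. ou_kernel t x y *\<^sub>R x \<partial>\<rho>) /\<^sub>R ou_density t \<rho> y"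
    "integrable \<rho> (\<lambda>x. ou_kernel t x y *\<^sub>R x)"
    by (rule *; simp)+
qed

lemma GDERIV_ou_density:
  "GDERIV (ou_density t \<rho>) y :>
    (\<integral>x. (- ou_kernel t x y / (1 - exp (- 2 * t))) *\<^sub>R (y - exp (- t) *\<^sub>R x) \<partial>\<rho>)"
proof -
  obtain W where W: "\<And>x y :: 'a.
    norm ((- ou_kernel t x y / (1 - exp (- 2 * t))) *\<^sub>R (y - exp (- t) *\<^sub>R x)) \<le> W"
    using grad_ou_kernel_bounded[OF t] by metis
  show ?thesis
    unfolding ou_density_def[abs_def]
    by (rule GDERIV_integral[of 1 _ _ _ _ "\<lambda>_. W"])
      (use W GDERIV_ou_kernel[OF t] integrable_ou_kernel in auto)
qed

text \<open>Tweedie's formula: the gradient of the logarithm of the kernel is affine in \<open>x\<close>, and differentiating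
  \<open>log q\<^sub>t\<^sup>\<rho>\<close> averages it over the posterior, which weights \<open>\<rho>\<close> by that kernel.\<close>

lemma GDERIV_ln_ou_density:
  "GDERIV (\<lambda>y. ln (ou_density t \<rho> y)) y :>
     (exp (- t) *\<^sub>R (\<integral>x. x \<partial>ou_posterior \<rho> y t) - y) /\<^sub>R (1 - exp (- 2 * t))"
proof -
  define V where "V = 1 - exp (- 2 * t)"
  have V: "0 < V" using t by (simp add: V_def)
  let ?q = "ou_density t \<rho> y"
  have "GDERIV (\<lambda>y. ln (ou_density t \<rho> y)) y :>
     (1 / ?q) *\<^sub>R (\<integral>x. (- ou_kernel t x y / V) *\<^sub>R (y - exp (- t) *\<^sub>R x) \<partial>\<rho>)"
    unfolding V_def using DERIV_ln_divide[OF ou_density_pos] by (rule GDERIV_DERIV_compose[OF GDERIV_ou_density])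
  also have "(\<integral>x. (- ou_kernel t x y / V) *\<^sub>R (y - exp (- t) *\<^sub>R x) \<partial>\<rho>)
    = (\<integral>x. (exp (- t) / V) *\<^sub>R (ou_kernel t x y *\<^sub>R x) - ou_kernel t x y *\<^sub>R (y /\<^sub>R V) \<partial>\<rho>)"
    by (intro Bochner_Integration.integral_cong) (auto simp: algebra_simps divide_inverse)
  also have "\<dots> = (exp (- t) / V) *\<^sub>R (\<integral>x. ou_kernel t x y *\<^sub>R x \<partial>\<rho>) - ?q *\<^sub>R (y /\<^sub>R V)"
    using integrable_ou_kernel_scaleR[of y] integrable_ou_kernel[of y]
    by (subst Bochner_Integration.integral_diff) (auto simp: ou_density_def simp del: scaleR_scaleR)
  also have "(\<integral>x. ou_kernel t x y *\<^sub>R x \<partial>\<rho>) = ?q *\<^sub>R (\<integral>x. x \<partial>ou_posterior \<rho> y t)"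
    using ou_density_pos[of y] by (simp add: integral_id_ou_posterior)
  also have "(1 / ?q) *\<^sub>R ((exp (- t) / V) *\<^sub>R (?q *\<^sub>R (\<integral>x. x \<partial>ou_posterior \<rho> y t)) - ?q *\<^sub>R (y /\<^sub>R V))
    = (exp (- t) *\<^sub>R (\<integral>x. x \<partial>ou_posterior \<rho> y t) - y) /\<^sub>R V"
  proof -
    have "1 / ?q * (exp (- t) / V * ?q) = inverse V * exp (- t)" "1 / ?q * (?q * inverse V) = inverse V"
      using ou_density_pos[of y] V by (auto simp: field_simps)
    then show ?thesis by (simp only: scaleR_diff_right scaleR_scaleR)
  qed
  finally show ?thesis unfolding V_def .
qed

end

text \<open>Both posteriors arise from their priors by the same weight up to normalisation, so that their density
  ratio is the ratio of the priors times the constant \<open>q\<^sub>t\<^sup>\<mu>(y) / q\<^sub>t\<^sup>\<nu>(y)\<close>. Logarithmic gradients do not see the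
  constant, and a pointwise bound on them survives the passage from \<open>\<nu>\<close> to its posterior.\<close>

lemma FI_ou_posterior_le:
  fixes \<mu> \<nu> :: "'a::euclidean_space measure"
  assumes \<mu>: "prob_space \<mu>" "\<mu> = density lborel (\<lambda>x. ennreal (m x))"
    and m: "m \<in> borel_measurable borel" "\<And>x. 0 < m x"
    and \<nu>: "prob_space \<nu>" "sets \<nu> = sets borel" and t: "0 < t"
    and ac: "absolutely_continuous \<mu> \<nu>" and wd: "weakly_differentiable (sqrt_ratio \<nu> \<mu>)"
    and L: "AE x in \<nu>. norm (grad_log_ratio \<nu> \<mu> x) \<le> L" "0 \<le> L"
  shows "FI (ou_posterior \<nu> y t) (ou_posterior \<mu> y t) \<le> ennreal (L\<^sup>2)"
proof -
  interpret M: prob_space \<mu> by fact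
  interpret N: prob_space \<nu> by fact
  have s\<mu>: "sets \<mu> = sets borel" by (simp add: \<mu>(2))
  define \<rho> where "\<rho> = ou_posterior \<mu> y t"
  define \<nu>' where "\<nu>' = ou_posterior \<nu> y t"
  interpret R: prob_space \<rho> unfolding \<rho>_def by (rule prob_space_ou_posterior[OF \<mu>(1) s\<mu> t])
  interpret N': prob_space \<nu>' unfolding \<nu>'_def by (rule prob_space_ou_posterior[OF \<nu> t])
  have s\<rho>: "sets \<rho> = sets borel" unfolding \<rho>_def by (rule sets_ou_posterior[OF \<mu>(1) s\<mu> t])
  define a where "a = ou_density t \<mu> y"
  define b where "b = ou_density t \<nu> y"
  have ab: "0 < a" "0 < b"
    using ou_density_pos[OF \<mu>(1) s\<mu> t] ou_density_pos[OF \<nu> t] by (auto simp: a_def b_def)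
  define r where "r = RN_deriv \<mu> \<nu>"
  have [measurable]: "r \<in> borel_measurable borel"
    unfolding r_def by (subst measurable_cong_sets[OF s\<mu>[symmetric] refl]) simp
  have \<nu>_eq: "density \<mu> r = \<nu>" unfolding r_def by (rule M.density_RN_deriv[OF ac]) (simp add: \<nu> s\<mu>)
  have \<rho>_eq: "\<rho> = density \<mu> (\<lambda>x. ennreal (ou_kernel t x y / a))"
    by (simp add: \<rho>_def a_def ou_posterior_def)
  have \<nu>'_eq: "\<nu>' = density \<nu> (\<lambda>x. ennreal (ou_kernel t x y / b))"
    by (simp add: \<nu>'_def b_def ou_posterior_def)
  have meas: "(\<lambda>x. ennreal (ou_kernel t x y / a)) \<in> borel_measurable \<mu>"
    "(\<lambda>x. ennreal (ou_kernel t x y / b)) \<in> borel_measurable \<mu>"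
    "(\<lambda>x. r x * ennreal (a / b)) \<in> borel_measurable \<mu>" "r \<in> borel_measurable \<mu>"
    by (simp_all add: measurable_cong_sets[OF s\<mu> refl])
  have dens: "density \<rho> (\<lambda>x. r x * ennreal (a / b)) = \<nu>'"
  proof -
    have "density \<rho> (\<lambda>x. r x * ennreal (a / b))
      = density \<mu> (\<lambda>x. ennreal (ou_kernel t x y / a) * (r x * ennreal (a / b)))"
      unfolding \<rho>_eq by (rule density_density_eq) (fact meas)+
    also have "\<dots> = density \<mu> (\<lambda>x. r x * ennreal (ou_kernel t x y / b))"
    proof (rule density_cong)
      have "ennreal (ou_kernel t x y / a) * (r x * ennreal (a / b)) = r x * ennreal (ou_kernel t x y / b)" for x
      proof -
        have "ennreal (ou_kernel t x y / a) * ennreal (a / b) = ennreal (ou_kernel t x y / a * (a / b))"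
          using ab ou_kernel_nonneg[OF t, where 'a='a] by (intro ennreal_mult[symmetric]) auto
        also have "ou_kernel t x y / a * (a / b) = ou_kernel t x y / b" using ab by simp
        finally show ?thesis by (simp add: mult.left_commute)
      qed
      then show "AE x in \<mu>. ennreal (ou_kernel t x y / a) * (r x * ennreal (a / b)) = r x * ennreal (ou_kernel t x y / b)"
        by simp
    qed (simp_all add: measurable_cong_sets[OF s\<mu> refl])
    also have "\<dots> = \<nu>'" unfolding \<nu>'_eq \<nu>_eq[symmetric] by (rule density_density_eq[symmetric]) (fact meas)+
    finally show ?thesis .
  qed
  have AE_\<mu>: "(AE x in \<mu>. P x) \<longleftrightarrow> (AE x in lborel. P x)" for P
    by (rule AE_density_lborel_pos[OF \<mu>(2) m])
  have AE_\<rho>: "(AE x in \<rho>. P x) \<longleftrightarrow> (AE x in lborel. P x)" for P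
    unfolding \<rho>_eq AE_\<mu>[symmetric] using ab ou_kernel_pos[OF t, where 'a='a] by (subst AE_density[OF meas(1)]) auto
  have meas\<rho>: "(\<lambda>x. r x * ennreal (a / b)) \<in> borel_measurable \<rho>"
    by (simp add: measurable_cong_sets[OF s\<rho> refl])
  have meas\<nu>: "(\<lambda>x. ennreal (ou_kernel t x y / b)) \<in> borel_measurable \<nu>"
    by (simp add: measurable_cong_sets[OF \<nu>(2) refl])
  have AE_\<nu>': "AE x in \<nu>'. P x" if "AE x in lborel. P x" for P
    unfolding dens[symmetric] using that AE_\<rho>[of P]
    by (subst AE_density[OF meas\<rho>]) (auto elim: eventually_mono)
  define g where "g = weak_gradient (sqrt_ratio \<nu> \<mu>)"
  have g: "has_weak_gradient (sqrt_ratio \<nu> \<mu>) g"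
    using wd unfolding weakly_differentiable_def g_def weak_gradient_def by (rule someI_ex)
  have "AE x in \<rho>. r x * ennreal (a / b) = RN_deriv \<rho> \<nu>' x"
    by (rule R.RN_deriv_unique[OF _ dens]) (simp add: measurable_cong_sets[OF s\<rho> refl])
  then have eq: "AE x in lborel. sqrt_ratio \<nu>' \<rho> x = sqrt (a / b) * sqrt_ratio \<nu> \<mu> x"
    unfolding AE_\<rho>
  proof eventually_elim
    fix x assume *: "r x * ennreal (a / b) = RN_deriv \<rho> \<nu>' x"
    show "sqrt_ratio \<nu>' \<rho> x = sqrt (a / b) * sqrt_ratio \<nu> \<mu> x"
      unfolding sqrt_ratio_def *[symmetric] r_def[symmetric] enn2real_mult real_sqrt_mult
      using ab by simp
  qed
  have wg: "has_weak_gradient (sqrt_ratio \<nu>' \<rho>) (\<lambda>x. sqrt (a / b) *\<^sub>R g x)"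
  proof (rule has_weak_gradient_AE_scale[OF g eq])
    have [measurable]: "RN_deriv \<rho> \<nu>' \<in> borel_measurable borel"
      by (subst measurable_cong_sets[OF s\<rho>[symmetric] refl]) simp
    show "sqrt_ratio \<nu>' \<rho> \<in> borel_measurable borel"
      unfolding sqrt_ratio_def by measurable
  qed
  have "AE x in lborel. grad_log_ratio \<nu>' \<rho> x = grad_log_ratio \<nu> \<mu> x"
    using weak_gradient_AE[OF wg] eq
    by eventually_elim (use ab in \<open>simp add: grad_log_ratio_def g_def\<close>)
  then have "AE x in \<nu>'. grad_log_ratio \<nu>' \<rho> x = grad_log_ratio \<nu> \<mu> x" by (rule AE_\<nu>')
  moreover have "AE x in \<nu>'. norm (grad_log_ratio \<nu> \<mu> x) \<le> L"
    unfolding \<nu>'_eq using L by (subst AE_density[OF meas\<nu>]) (auto elim: eventually_mono)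
  ultimately have "AE x in \<nu>'. ennreal ((norm (grad_log_ratio \<nu>' \<rho> x))\<^sup>2) \<le> ennreal (L\<^sup>2)"
    by eventually_elim (auto intro!: ennreal_leI power_mono)
  then have "(\<integral>\<^sup>+x. ennreal ((norm (grad_log_ratio \<nu>' \<rho> x))\<^sup>2) \<partial>\<nu>') \<le> (\<integral>\<^sup>+x. ennreal (L\<^sup>2) \<partial>\<nu>')"
    by (rule nn_integral_mono_AE)
  also have "\<dots> = ennreal (L\<^sup>2)" by (simp add: N'.emeasure_space_1)
  finally have "(\<integral>\<^sup>+x. ennreal ((norm (grad_log_ratio \<nu>' \<rho> x))\<^sup>2) \<partial>\<nu>') \<le> ennreal (L\<^sup>2)" .
  moreover have "absolutely_continuous \<rho> \<nu>'"
    unfolding dens[symmetric] by (rule absolutely_continuousI_density)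
      (simp add: measurable_cong_sets[OF s\<rho> refl])
  moreover have "weakly_differentiable (sqrt_ratio \<nu>' \<rho>)" using wg by (auto simp: weakly_differentiable_def)
  ultimately show ?thesis by (simp add: FI_def flip: \<rho>_def \<nu>'_def)
qed

text \<open>The one-dimensional bound, in the direction in which the two means differ.\<close>

lemma posterior_mean_difference:
  fixes \<mu> \<nu> :: "'a::euclidean_space measure"
  assumes \<mu>: "prob_space \<mu>" "\<mu> = density lborel (\<lambda>x. ennreal (m x))"
    and m: "m \<in> borel_measurable borel" "\<And>x. 0 < m x"
    and \<nu>: "prob_space \<nu>" "sets \<nu> = sets borel" and t: "0 < t"
    and ac: "absolutely_continuous \<mu> \<nu>" and wd: "weakly_differentiable (sqrt_ratio \<nu> \<mu>)"
    and L: "AE x in \<nu>. norm (grad_log_ratio \<nu> \<mu> x) \<le> L" "0 \<le> L"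
    and lsi: "log_sobolev (ou_posterior \<mu> y t) c"
  shows "norm ((\<integral>x. x \<partial>ou_posterior \<mu> y t) - (\<integral>x. x \<partial>ou_posterior \<nu> y t)) \<le> c * L"
proof -
  have s\<mu>: "sets \<mu> = sets borel" by (simp add: \<mu>(2))
  have c: "0 < c" using lsi by (simp add: log_sobolev_def)
  define \<rho> where "\<rho> = ou_posterior \<mu> y t"
  define \<nu>' where "\<nu>' = ou_posterior \<nu> y t"
  define d where "d = (\<integral>x. x \<partial>\<nu>') - (\<integral>x. x \<partial>\<rho>)"
  have ii: "integrable \<nu>' (\<lambda>x. x)" "integrable \<rho> (\<lambda>x. x)"
    unfolding \<nu>'_def \<rho>_def
    by (rule integrable_id_ou_posterior[OF \<nu> t]) (rule integrable_id_ou_posterior[OF \<mu>(1) s\<mu> t])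
  have "norm d \<le> c * L"
  proof (cases "d = 0")
    case False
    define v where "v = sgn d"
    interpret P: prob_space \<rho> unfolding \<rho>_def by (rule prob_space_ou_posterior[OF \<mu>(1) s\<mu> t])
    interpret S: log_sobolev_exp_moments \<rho> "\<lambda>x. m x * (ou_kernel t x y / ou_density t \<mu> y)" c v
    proof
      have "ennreal (m x) * ennreal (ou_kernel t x y / ou_density t \<mu> y)
          = ennreal (m x * (ou_kernel t x y / ou_density t \<mu> y))" for x
        using m(2)[of x] ou_kernel_nonneg[OF t, of x y] ou_density_pos[OF \<mu>(1) s\<mu> t, of y]
        by (intro ennreal_mult[symmetric]) auto
      moreover have "\<rho> = density lborel (\<lambda>x. ennreal (m x) * ennreal (ou_kernel t x y / ou_density t \<mu> y))"
        unfolding \<rho>_def ou_posterior_def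
        by (subst (1) \<mu>(2), rule density_density_eq) (use m in auto)
      ultimately show "\<rho> = density lborel (\<lambda>x. ennreal (m x * (ou_kernel t x y / ou_density t \<mu> y)))"
        by simp
      show "(\<lambda>x. m x * (ou_kernel t x y / ou_density t \<mu> y)) \<in> borel_measurable borel"
        using m(1) by measurable
      show "0 < m x * (ou_kernel t x y / ou_density t \<mu> y)" for x
        using m(2)[of x] ou_kernel_pos[OF t, of x y] ou_density_pos[OF \<mu>(1) s\<mu> t, of y] by simp
      show "log_sobolev \<rho> c" using lsi by (simp add: \<rho>_def)
      show v1: "norm v = 1" using False by (simp add: v_def norm_sgn)
      show "integrable \<rho> (\<lambda>x. exp (a * (v \<bullet> x)))" for a
        unfolding \<rho>_def
      proof (rule integrable_ou_posterior(1)[OF \<mu>(1) s\<mu> t, where b="\<bar>a\<bar>"])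
        fix x
        have "a * (v \<bullet> x) \<le> \<bar>a\<bar> * \<bar>v \<bullet> x\<bar>" by (metis abs_ge_self abs_mult)
        also have "\<dots> \<le> \<bar>a\<bar> * norm x"
          using Cauchy_Schwarz_ineq2[of v x] v1 by (intro mult_left_mono) auto
        finally show "norm (exp (a * (v \<bullet> x))) \<le> exp (\<bar>a\<bar> * norm x)" by simp
      qed auto
    qed
    have "(\<integral>x. v \<bullet> x \<partial>\<nu>') - (\<integral>x. v \<bullet> x \<partial>\<rho>) \<le> c * L"
    proof (rule S.linear_mean_difference)
      show "prob_space \<nu>'" "sets \<nu>' = sets borel"
        unfolding \<nu>'_def by (rule prob_space_ou_posterior[OF \<nu> t], rule sets_ou_posterior[OF \<nu> t])
      show "integrable \<nu>' (\<lambda>x. v \<bullet> x)" using ii by simp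
      show "FI \<nu>' \<rho> \<le> ennreal (L\<^sup>2)"
        unfolding \<nu>'_def \<rho>_def by (rule FI_ou_posterior_le[OF \<mu> m \<nu> t ac wd L])
      show "0 \<le> L" by fact
    qed
    moreover have "(\<integral>x. v \<bullet> x \<partial>\<nu>') - (\<integral>x. v \<bullet> x \<partial>\<rho>) = v \<bullet> d"
      using ii by (simp add: d_def inner_diff_right)
    moreover have "v \<bullet> d = norm d"
      using False by (simp add: v_def sgn_div_norm power2_norm_eq_inner[symmetric] power2_eq_square)
    ultimately show ?thesis by simp
  qed (use c L in simp)
  then show ?thesis unfolding d_def \<rho>_def \<nu>'_def by (simp add: norm_minus_commute)
qed

lemma GDERIV_unique: "GDERIV f x :> D \<Longrightarrow> GDERIV f x :> D' \<Longrightarrow> D = D'"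
proof -
  assume "GDERIV f x :> D" "GDERIV f x :> D'"
  then have "(\<lambda>h. h \<bullet> D) = (\<lambda>h. h \<bullet> D')" unfolding gderiv_def by (rule has_derivative_unique)
  then have "(D - D') \<bullet> D = (D - D') \<bullet> D'" by meson
  then have "(D - D') \<bullet> (D - D') = 0" by (simp add: inner_diff_right)
  then show ?thesis by simp
qed

lemma grad_eq: "GDERIV f x :> D \<Longrightarrow> grad f x = D"
  unfolding grad_def using GDERIV_unique by (intro the_equality) blast+

text \<open>Tweedie's formula turns the difference of the scores into that of the posterior means; the factor
  \<open>e\<^sup>-\<^sup>t / (1 - e\<^sup>-\<^sup>2\<^sup>t) = e\<^sup>t / (e\<^sup>2\<^sup>t - 1)\<close> is the one in the integrand of \<open>\<eta>\<^sub>\<infinity>\<close>.\<close>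

lemma score_difference:
  fixes \<mu> \<nu> :: "'a::euclidean_space measure"
  assumes \<mu>: "prob_space \<mu>" "\<mu> = density lborel (\<lambda>x. ennreal (m x))"
    and m: "m \<in> borel_measurable borel" "\<And>x. 0 < m x"
    and \<nu>: "prob_space \<nu>" "sets \<nu> = sets borel" and t: "0 < t"
    and ac: "absolutely_continuous \<mu> \<nu>" and wd: "weakly_differentiable (sqrt_ratio \<nu> \<mu>)"
    and L: "AE x in \<nu>. norm (grad_log_ratio \<nu> \<mu> x) \<le> L" "0 \<le> L"
    and lsi: "log_sobolev (ou_posterior \<mu> y t) c"
  shows "norm (grad (\<lambda>x. ln (ou_density t \<mu> x)) y - grad (\<lambda>x. ln (ou_density t \<nu> x)) y)
     \<le> exp t * c / (exp (2 * t) - 1) * L"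
proof -
  have s\<mu>: "sets \<mu> = sets borel" by (simp add: \<mu>(2))
  define V where "V = 1 - exp (- 2 * t)"
  have V: "0 < V" using t by (simp add: V_def)
  let ?D = "(\<integral>x. x \<partial>ou_posterior \<mu> y t) - (\<integral>x. x \<partial>ou_posterior \<nu> y t)"
  have "grad (\<lambda>x. ln (ou_density t \<mu> x)) y - grad (\<lambda>x. ln (ou_density t \<nu> x)) y = (exp (- t) / V) *\<^sub>R ?D"
    unfolding grad_eq[OF GDERIV_ln_ou_density[OF \<mu>(1) s\<mu> t]] grad_eq[OF GDERIV_ln_ou_density[OF \<nu> t]] V_def[symmetric]
    by (simp add: algebra_simps divide_inverse)
  then have "norm (grad (\<lambda>x. ln (ou_density t \<mu> x)) y - grad (\<lambda>x. ln (ou_density t \<nu> x)) y)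
    = exp (- t) / V * norm ?D" using V by simp
  also have "\<dots> \<le> exp (- t) / V * (c * L)"
    using V posterior_mean_difference[OF assms] by (intro mult_left_mono) auto
  also have "exp (- t) / V = exp t / (exp (2 * t) - 1)"
  proof -
    have "exp (2 * t) * V = exp (2 * t) - 1" by (simp add: V_def algebra_simps flip: exp_add)
    moreover have "exp (2 * t) * exp (- t) = exp t" by (simp flip: exp_add)
    ultimately show ?thesis by (metis exp_not_eq_zero mult_divide_mult_cancel_left)
  qed
  finally show ?thesis by simp
qed

section \<open>Continuity of the probability flow and measurability of the Kim--Milman map\<close>

lemma abs_exp_diff_le: "\<bar>exp p - exp q\<bar> \<le> \<bar>p - q\<bar> * exp (max p q :: real)"
proof (induction p q rule: linorder_wlog)
  case (le p q)
  have "exp q * (1 + (p - q)) \<le> exp q * exp (p - q)"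
    using exp_ge_add_one_self[of "p - q"] by (intro mult_left_mono) auto
  then have "exp q - exp p \<le> (q - p) * exp q" by (simp add: algebra_simps flip: exp_add)
  then show ?case using le by (simp add: max_def)
qed (simp add: max.commute abs_minus_commute)

lemma norm_quotient_diff_le:
  fixes N N' :: "'a::real_normed_vector"
  assumes "0 < D0" "D0 \<le> D" "D0 \<le> D'"
  shows "norm (N /\<^sub>R D - N' /\<^sub>R D') \<le> norm (N - N') / D0 + norm N' * \<bar>D - D'\<bar> / D0\<^sup>2"
proof -
  have pos: "0 < D" "0 < D'" using assms by auto
  have "N /\<^sub>R D - N' /\<^sub>R D' = (N - N') /\<^sub>R D + (inverse D - inverse D') *\<^sub>R N'"
    by (simp add: algebra_simps)
  then have "norm (N /\<^sub>R D - N' /\<^sub>R D') \<le> norm ((N - N') /\<^sub>R D) + norm ((inverse D - inverse D') *\<^sub>R N')"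
    by (simp only: norm_triangle_ineq)
  also have "norm ((N - N') /\<^sub>R D) \<le> norm (N - N') / D0"
    using pos assms
    by (simp add: divide_inverse mult.commute) (intro mult_right_mono le_imp_inverse_le; simp)
  also have "norm ((inverse D - inverse D') *\<^sub>R N') \<le> norm N' * \<bar>D - D'\<bar> / D0\<^sup>2"
  proof -
    have "inverse D - inverse D' = (D' - D) / (D * D')" using pos by (simp add: field_simps)
    then have "norm ((inverse D - inverse D') *\<^sub>R N') = norm N' * \<bar>D - D'\<bar> / (D * D')"
      using pos by (simp add: abs_mult abs_minus_commute)
    also have "\<dots> \<le> norm N' * \<bar>D - D'\<bar> / (D0 * D0)"
      using pos assms by (intro divide_left_mono mult_mono) auto
    finally show ?thesis by (simp add: power2_eq_square)
  qed
  finally show ?thesis by simp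
qed

text \<open>In \<open>y\<close>, the posteriors form an exponential family with natural parameter proportional to \<open>y\<close>: the
  factor that depends on \<open>y\<close> alone cancels in the posterior mean.\<close>

lemma ou_kernel_exponential_family:
  assumes "0 < s"
  shows "ou_kernel s x y = gauss_density 0 (1 - exp (- 2 * s)) y
    * exp (exp (- s) / (1 - exp (- 2 * s)) * (y \<bullet> x) - (exp (- s))\<^sup>2 / (2 * (1 - exp (- 2 * s))) * (norm x)\<^sup>2)"
proof -
  define V where "V = 1 - exp (- 2 * s)"
  have V: "0 < V" using assms by (simp add: V_def)
  have "- (norm (y - exp (- s) *\<^sub>R x))\<^sup>2 / (2 * V)
    = - (norm (y - 0))\<^sup>2 / (2 * V) + (exp (- s) / V * (y \<bullet> x) - (exp (- s))\<^sup>2 / (2 * V) * (norm x)\<^sup>2)"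
    using V unfolding power2_norm_eq_inner
    by (simp add: inner_diff inner_commute field_simps power2_eq_square)
  then show ?thesis
    unfolding ou_kernel_def gauss_density_def V_def[symmetric] by (simp only: exp_add mult.assoc)
qed

text \<open>The posterior mean is a quotient \<open>N / D\<close> of integrals against the exponential weights
  \<open>exp (c (y \<bullet> x) - a |x|\<^sup>2)\<close>. For \<open>s\<close> in a compact subinterval of \<open>(0,\<infinity>)\<close> and \<open>y\<close> in a ball, the weights lie
  between the fixed functions \<open>e0\<close> and \<open>E\<close>, whose parameters are uniform bounds for \<open>c\<close> and \<open>a\<close>; this
  makes the Lipschitz constant uniform in \<open>s\<close>.\<close>

lemma score_locally_lipschitz:
  fixes \<rho> :: "'a::euclidean_space measure"
  assumes \<rho>: "prob_space \<rho>" "sets \<rho> = sets borel" and s0: "0 < s0" and R: "0 \<le> R"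
  obtains \<Lambda> where "0 \<le> \<Lambda>"
    "\<And>s y y'. s0 \<le> s \<Longrightarrow> s \<le> s1 \<Longrightarrow> y \<in> cball 0 R \<Longrightarrow> y' \<in> cball 0 R \<Longrightarrow>
      norm (grad (\<lambda>x. ln (ou_density s \<rho> x)) y - grad (\<lambda>x. ln (ou_density s \<rho> x)) y') \<le> \<Lambda> * norm (y - y')"
proof -
  interpret prob_space \<rho> by fact
  note mc = measurable_cong_sets[OF \<rho>(2) refl]
  define V0 where "V0 = 1 - exp (- 2 * s0)"
  have V0: "0 < V0" using s0 by (simp add: V0_def)
  define C where "C = 1 / V0"
  have C: "0 < C" using V0 by (simp add: C_def)
  define a0 where "a0 = exp (- 2 * s1) / 2"
  have a0: "0 < a0" by (simp add: a0_def)
  define E where "E x = exp (C * R * norm x - a0 * (norm x)\<^sup>2)" for x :: 'a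
  \<comment> \<open>dominates all the integrands below, which are \<open>E\<close> times at most two factors \<open>|x|\<close>\<close>
  define M where "M x = (1 + norm x)\<^sup>2 * E x" for x :: 'a
  define U where "U = (\<integral>x. M x \<partial>\<rho>)"
  define e0 where "e0 x = exp (- (C * R * norm x) - 1 / (2 * V0) * (norm x)\<^sup>2)" for x :: 'a
  define D0 where "D0 = (\<integral>x. e0 x \<partial>\<rho>)"
  have [measurable]: "E \<in> borel_measurable borel" "M \<in> borel_measurable borel" "e0 \<in> borel_measurable borel"
    unfolding E_def[abs_def] M_def[abs_def] e0_def[abs_def] by measurable
  have M_bound: "M x \<le> exp ((2 + C * R)\<^sup>2 / (4 * a0))" for x
  proof -
    have "1 + norm x \<le> exp (norm x)" by (rule exp_ge_add_one_self)
    then have "(1 + norm x)\<^sup>2 \<le> (exp (norm x))\<^sup>2" by (intro power_mono) auto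
    then have "M x \<le> (exp (norm x))\<^sup>2 * E x" unfolding M_def by (intro mult_right_mono) (auto simp: E_def)
    also have "\<dots> = exp ((2 + C * R) * norm x - a0 * (norm x)\<^sup>2)"
      by (simp add: E_def power2_eq_square algebra_simps flip: exp_add)
    also have "(2 + C * R) * norm x - a0 * (norm x)\<^sup>2 \<le> (2 + C * R)\<^sup>2 / (4 * a0)"
    proof -
      have "0 \<le> (2 * a0 * norm x - (2 + C * R))\<^sup>2 / (4 * a0)" using a0 by simp
      also have "\<dots> = a0 * (norm x)\<^sup>2 - (2 + C * R) * norm x + (2 + C * R)\<^sup>2 / (4 * a0)"
        using a0 by (simp add: power2_diff add_divide_distrib diff_divide_distrib) (simp add: power2_eq_square)
      finally show ?thesis by simp
    qed
    finally show ?thesis by simp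
  qed
  have M_int: "integrable \<rho> M"
    by (rule integrable_const_bound[where B="exp ((2 + C * R)\<^sup>2 / (4 * a0))"])
       (use M_bound in \<open>auto intro!: AE_I2 simp: M_def E_def abs_mult mc\<close>)
  have M_ge: "E x \<le> M x" "norm x * E x \<le> M x" "norm x * (norm x * E x) \<le> M x" for x
    unfolding M_def mult.assoc[symmetric]
    by (auto intro!: mult_right_mono simp: E_def power2_eq_square algebra_simps
        intro: order_trans[of _ "norm x * 2"])
  have int_by_M: "integrable \<rho> f" "norm (\<integral>x. f x \<partial>\<rho>) \<le> k * U"
    if "f \<in> borel_measurable borel" "\<And>x. norm (f x) \<le> k * M x" for f :: "'a \<Rightarrow> 'b::{banach,second_countable_topology}" and k
  proof -
    have [measurable]: "f \<in> borel_measurable borel" by fact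
    show i: "integrable \<rho> f"
      by (rule Bochner_Integration.integrable_bound[of _ "\<lambda>x. k * M x"])
         (use M_int in \<open>auto intro!: AE_I2 order_trans[OF that(2)] simp: mc\<close>)
    have "norm (\<integral>x. f x \<partial>\<rho>) \<le> (\<integral>x. k * M x \<partial>\<rho>)"
      using i M_int that(2)
      by (intro order_trans[OF Bochner_Integration.integral_norm_bound] integral_mono) auto
    then show "norm (\<integral>x. f x \<partial>\<rho>) \<le> k * U" using M_int by (simp add: U_def)
  qed
  have e0_le: "e0 x \<le> 1" for x
  proof -
    have "0 \<le> C * R * norm x" "0 \<le> 1 / (2 * V0) * (norm x)\<^sup>2" using C R V0 by auto
    then show ?thesis by (simp add: e0_def del: times_divide_eq_left)
  qed
  have e0_int: "integrable \<rho> e0"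
    by (rule integrable_const_bound[where B=1]) (use e0_le in \<open>auto simp: e0_def mc\<close>)
  have D0: "0 < D0"
  proof -
    have "D0 \<noteq> 0"
    proof
      assume "D0 = 0"
      then have "AE x in \<rho>. e0 x = 0"
        unfolding D0_def using integral_nonneg_eq_0_iff_AE[OF e0_int] by (simp add: e0_def)
      then have "AE x in \<rho>. False" by (rule eventually_mono) (simp add: e0_def)
      then show False by (simp add: AE_False)
    qed
    moreover have "0 \<le> D0"
      unfolding D0_def by (intro Bochner_Integration.integral_nonneg) (simp add: e0_def)
    ultimately show ?thesis by simp
  qed
  have U: "0 \<le> U" unfolding U_def by (intro Bochner_Integration.integral_nonneg) (simp add: M_def E_def)
  define \<Lambda> where "\<Lambda> = (C * U / D0 + U * (C * U) / D0\<^sup>2 + 1) / V0"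
  show ?thesis
  proof (rule that[of \<Lambda>])
    show "0 \<le> \<Lambda>" using U D0 V0 C by (auto simp: \<Lambda>_def intro!: divide_nonneg_pos add_nonneg_nonneg)
    fix s y y' assume s: "s0 \<le> s" "s \<le> s1" and y: "y \<in> cball (0::'a) R" "y' \<in> cball (0::'a) R"
    have s_pos: "0 < s" using s s0 by simp
    define \<alpha> where "\<alpha> = exp (- s)"
    define V where "V = 1 - exp (- 2 * s)"
    have \<alpha>: "0 < \<alpha>" "\<alpha> \<le> 1" using s_pos by (auto simp: \<alpha>_def)
    have V: "V0 \<le> V" "V \<le> 1" "0 < V" using s s_pos by (auto simp: V0_def V_def)
    define c where "c = \<alpha> / V"
    have c: "0 < c" "c \<le> C" using \<alpha> V V0 by (auto simp: c_def C_def intro!: frac_le)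
    define a where "a = \<alpha>\<^sup>2 / (2 * V)"
    have a: "a0 \<le> a" "a \<le> 1 / (2 * V0)"
    proof -
      have "exp (- 2 * s1) \<le> \<alpha>\<^sup>2" using s by (simp add: \<alpha>_def power2_eq_square flip: exp_add)
      then have "exp (- 2 * s1) / 2 \<le> \<alpha>\<^sup>2 / (2 * V)"
        using V by (intro frac_le) auto
      then show "a0 \<le> a" by (simp add: a0_def a_def)
      have "\<alpha>\<^sup>2 \<le> 1" using \<alpha> by (simp add: power_le_one)
      then show "a \<le> 1 / (2 * V0)" unfolding a_def using V V0 by (intro frac_le) auto
    qed
    define e where "e z x = exp (c * (z \<bullet> x) - a * (norm x)\<^sup>2)" for z x :: 'a
    have [measurable]: "e z \<in> borel_measurable borel" for z unfolding e_def[abs_def] by measurable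
    define D where "D z = (\<integral>x. e z x \<partial>\<rho>)" for z
    define N where "N z = (\<integral>x. e z x *\<^sub>R x \<partial>\<rho>)" for z
    have inner: "\<bar>c * (z \<bullet> x)\<bar> \<le> C * R * norm x" if "z \<in> cball 0 R" for x z
    proof -
      have "\<bar>c * (z \<bullet> x)\<bar> \<le> c * (norm z * norm x)"
        using c Cauchy_Schwarz_ineq2[of z x] by (simp add: abs_mult)
      also have "\<dots> \<le> C * (R * norm x)" using that c C R by (intro mult_mono) auto
      finally show ?thesis by (simp add: mult.assoc)
    qed
    have e_le: "e z x \<le> E x" and e_ge: "e0 x \<le> e z x" if "z \<in> cball 0 R" for x z
    proof -
      have "a0 * (norm x)\<^sup>2 \<le> a * (norm x)\<^sup>2" "a * (norm x)\<^sup>2 \<le> 1 / (2 * V0) * (norm x)\<^sup>2"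
        using a by (auto intro!: mult_right_mono simp del: times_divide_eq_left)
      with inner[OF that, of x] show "e z x \<le> E x" "e0 x \<le> e z x"
        unfolding e_def E_def e0_def by (auto simp del: times_divide_eq_left)
    qed
    have e_nonneg: "0 \<le> e z x" for z x by (simp add: e_def)
    have e_diff: "\<bar>e y x - e y' x\<bar> \<le> C * norm (y - y') * (norm x * E x)" for x
    proof -
      have "\<bar>e y x - e y' x\<bar> \<le> \<bar>c * (y \<bullet> x) - c * (y' \<bullet> x)\<bar> * max (e y x) (e y' x)"
        using abs_exp_diff_le[of "c * (y \<bullet> x) - a * (norm x)\<^sup>2" "c * (y' \<bullet> x) - a * (norm x)\<^sup>2"]
        unfolding e_def by (simp add: max_def split: if_splits)
      also have "\<dots> \<le> (C * (norm (y - y') * norm x)) * E x"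
      proof (rule mult_mono)
        have "\<bar>c * (y \<bullet> x) - c * (y' \<bullet> x)\<bar> = c * \<bar>(y - y') \<bullet> x\<bar>"
          using c by (simp add: inner_diff_left abs_mult flip: right_diff_distrib)
        also have "\<dots> \<le> C * (norm (y - y') * norm x)"
          using c C Cauchy_Schwarz_ineq2[of "y - y'" x] by (intro mult_mono) auto
        finally show "\<bar>c * (y \<bullet> x) - c * (y' \<bullet> x)\<bar> \<le> C * (norm (y - y') * norm x)" .
      qed (use e_le y C e_nonneg in \<open>auto simp: le_max_iff_disj\<close>)
      finally show ?thesis by (simp add: mult_ac)
    qed
    have intD: "integrable \<rho> (e z)" if "z \<in> cball 0 R" for z
    proof (rule int_by_M(1))
      show "norm (e z x) \<le> 1 * M x" for x
        using order_trans[OF e_le[OF that] M_ge(1)] e_nonneg by simp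
    qed measurable
    have Nb: "integrable \<rho> (\<lambda>x. e z x *\<^sub>R x)" "norm (N z) \<le> 1 * U" if "z \<in> cball 0 R" for z
    proof -
      have "norm (e z x *\<^sub>R x) \<le> 1 * M x" for x
        using order_trans[OF mult_right_mono[OF e_le[OF that, of x] norm_ge_zero[of x]]] M_ge(2)[of x] e_nonneg[of z x]
        by (simp add: mult.commute)
      then show "integrable \<rho> (\<lambda>x. e z x *\<^sub>R x)" "norm (N z) \<le> 1 * U"
        unfolding N_def by (intro int_by_M; measurable)+
    qed
    have D_ge: "D0 \<le> D z" if "z \<in> cball 0 R" for z
      unfolding D0_def D_def using e0_int intD[OF that] e_ge[OF that] by (rule integral_mono)
    have Dd: "\<bar>D y - D y'\<bar> \<le> C * norm (y - y') * U"
    proof -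
      have "norm (\<integral>x. e y x - e y' x \<partial>\<rho>) \<le> (C * norm (y - y')) * U"
      proof (rule int_by_M(2))
        fix x
        have "C * norm (y - y') * (norm x * E x) \<le> C * norm (y - y') * M x"
          using M_ge C by (intro mult_left_mono) auto
        with e_diff[of x] show "norm (e y x - e y' x) \<le> C * norm (y - y') * M x" by simp
      qed measurable
      then show ?thesis unfolding D_def using intD y by simp
    qed
    have Nd: "norm (N y - N y') \<le> C * norm (y - y') * U"
    proof -
      have "norm (\<integral>x. (e y x - e y' x) *\<^sub>R x \<partial>\<rho>) \<le> (C * norm (y - y')) * U"
      proof (rule int_by_M(2))
        fix x
        have "norm ((e y x - e y' x) *\<^sub>R x) = \<bar>e y x - e y' x\<bar> * norm x" by simp
        also have "\<dots> \<le> C * norm (y - y') * (norm x * E x) * norm x"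
          using e_diff[of x] by (rule mult_right_mono) simp
        also have "\<dots> = C * norm (y - y') * (norm x * (norm x * E x))" by simp
        also have "\<dots> \<le> C * norm (y - y') * M x"
          using M_ge(3)[of x] C by (intro mult_left_mono) auto
        finally show "norm ((e y x - e y' x) *\<^sub>R x) \<le> C * norm (y - y') * M x" .
      qed measurable
      then show ?thesis unfolding N_def using Nb(1) y by (simp add: scaleR_diff_left)
    qed
    have mean: "(\<integral>x. x \<partial>ou_posterior \<rho> z s) = N z /\<^sub>R D z" for z
    proof -
      define g where "g = gauss_density 0 V z"
      have g: "0 < g" using V by (simp add: g_def gauss_density_def)
      have k: "ou_kernel s x z = g * e z x" for x
        using ou_kernel_exponential_family[OF s_pos, of x z]
        by (simp add: g_def e_def c_def a_def V_def \<alpha>_def)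
      have "(\<integral>x. x \<partial>ou_posterior \<rho> z s) = (\<integral>x. g *\<^sub>R (e z x *\<^sub>R x) \<partial>\<rho>) /\<^sub>R (\<integral>x. g * e z x \<partial>\<rho>)"
        unfolding integral_id_ou_posterior[OF \<rho> s_pos] ou_density_def k by simp
      also have "\<dots> = (g *\<^sub>R N z) /\<^sub>R (g * D z)"
        unfolding N_def D_def by (simp del: scaleR_scaleR)
      also have "\<dots> = N z /\<^sub>R D z" using g by simp
      finally show ?thesis .
    qed
    have score: "grad (\<lambda>x. ln (ou_density s \<rho> x)) z = (\<alpha> *\<^sub>R (N z /\<^sub>R D z) - z) /\<^sub>R V" for z
      using grad_eq[OF GDERIV_ln_ou_density[OF \<rho> s_pos, of z]] by (simp add: mean \<alpha>_def V_def)
    have "grad (\<lambda>x. ln (ou_density s \<rho> x)) y - grad (\<lambda>x. ln (ou_density s \<rho> x)) y'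
        = (\<alpha> *\<^sub>R (N y /\<^sub>R D y - N y' /\<^sub>R D y') - (y - y')) /\<^sub>R V"
      unfolding score by (simp add: algebra_simps)
    then have "norm (grad (\<lambda>x. ln (ou_density s \<rho> x)) y - grad (\<lambda>x. ln (ou_density s \<rho> x)) y')
      = norm (\<alpha> *\<^sub>R (N y /\<^sub>R D y - N y' /\<^sub>R D y') - (y - y')) / V"
      using V by (simp add: divide_inverse mult.commute)
    also have "\<dots> \<le> (norm (N y /\<^sub>R D y - N y' /\<^sub>R D y') + norm (y - y')) / V0"
    proof (rule frac_le)
      have "norm (\<alpha> *\<^sub>R (N y /\<^sub>R D y - N y' /\<^sub>R D y') - (y - y'))
        \<le> \<alpha> * norm (N y /\<^sub>R D y - N y' /\<^sub>R D y') + norm (y - y')"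
        using norm_triangle_ineq4[of "\<alpha> *\<^sub>R (N y /\<^sub>R D y - N y' /\<^sub>R D y')" "y - y'"] \<alpha> by simp
      also have "\<alpha> * norm (N y /\<^sub>R D y - N y' /\<^sub>R D y') \<le> 1 * norm (N y /\<^sub>R D y - N y' /\<^sub>R D y')"
        using \<alpha> by (intro mult_right_mono) auto
      finally show "norm (\<alpha> *\<^sub>R (N y /\<^sub>R D y - N y' /\<^sub>R D y') - (y - y'))
        \<le> norm (N y /\<^sub>R D y - N y' /\<^sub>R D y') + norm (y - y')" by simp
    qed (use V V0 in auto)
    also have "\<dots> \<le> (C * norm (y - y') * U / D0 + U * (C * norm (y - y') * U) / D0\<^sup>2 + norm (y - y')) / V0"
    proof (intro divide_right_mono add_right_mono)
      have "norm (N y /\<^sub>R D y - N y' /\<^sub>R D y') \<le> norm (N y - N y') / D0 + norm (N y') * \<bar>D y - D y'\<bar> / D0\<^sup>2"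
        by (rule norm_quotient_diff_le[OF D0 D_ge[OF y(1)] D_ge[OF y(2)]])
      also have "\<dots> \<le> C * norm (y - y') * U / D0 + U * (C * norm (y - y') * U) / D0\<^sup>2"
        using Nd Dd Nb(2)[OF y(2)] D0 U by (intro add_mono divide_right_mono mult_mono) auto
      finally show "norm (N y /\<^sub>R D y - N y' /\<^sub>R D y') \<le> \<dots>" .
    qed (use V0 in auto)
    also have "\<dots> = \<Lambda> * norm (y - y')"
      by (simp add: \<Lambda>_def algebra_simps add_divide_distrib)
    finally show "norm (grad (\<lambda>x. ln (ou_density s \<rho> x)) y - grad (\<lambda>x. ln (ou_density s \<rho> x)) y') \<le> \<Lambda> * norm (y - y')" .
  qed
qed

lemma gronwall_lipschitz:
  fixes w :: "real \<Rightarrow> 'a::euclidean_space"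
  assumes T: "0 \<le> T" and w: "continuous_on {0..T} w"
    and w': "\<And>t. 0 < t \<Longrightarrow> t < T \<Longrightarrow> (w has_vector_derivative w' t) (at t)"
    and lip: "\<And>t. 0 < t \<Longrightarrow> t < T \<Longrightarrow> norm (w' t) \<le> \<Lambda> * norm (w t)"
  shows "norm (w T) \<le> exp (\<Lambda> * T) * norm (w 0)"
proof -
  have "norm (w T) \<le> exp (integral {0..T} (\<lambda>_. \<Lambda>)) * norm (w 0)
      + integral {0..T} (\<lambda>u. exp (integral {u..T} (\<lambda>_. \<Lambda>)) * 0)"
  proof (rule gronwall_norm[OF T w w'])
    show "(\<lambda>_. \<Lambda>) absolutely_integrable_on {0..T}" "(\<lambda>_. 0::real) absolutely_integrable_on {0..T}"
      by (auto intro: absolutely_integrable_continuous_real)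
    fix t assume t: "0 < t" "t < T"
    have "w t \<bullet> w' t \<le> norm (w t) * norm (w' t)" by (rule norm_cauchy_schwarz)
    also have "\<dots> \<le> norm (w t) * (\<Lambda> * norm (w t))" using lip[OF t] by (rule mult_left_mono) simp
    finally show "w t \<bullet> w' t \<le> \<Lambda> * (norm (w t))\<^sup>2 + 0 * norm (w t)" by (simp add: power2_eq_square mult_ac)
  qed auto
  then show ?thesis using T by (simp add: mult.commute)
qed

text \<open>On a ball slightly larger than the one containing the trajectory from \<open>x0\<close>, the field is Lipschitz.
  A trajectory that starts sufficiently close to \<open>x0\<close> cannot reach distance 1 from it by time \<open>\<tau>\<close>, since
  up to the first such time Gronwall's inequality keeps the distance below 1.\<close>

lemma flow_continuous:
  fixes F :: "real \<Rightarrow> 'a::euclidean_space \<Rightarrow> 'a" and X :: "'a \<Rightarrow> real \<Rightarrow> 'a"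
  assumes \<tau>: "0 \<le> \<tau>"
    and lip: "\<And>R. 0 \<le> R \<Longrightarrow> \<exists>\<Lambda>\<ge>0. \<forall>t\<in>{0..\<tau>}. \<forall>y\<in>cball 0 R. \<forall>y'\<in>cball 0 R. norm (F t y - F t y') \<le> \<Lambda> * norm (y - y')"
    and cont: "\<And>x. continuous_on {0..\<tau>} (X x)" and init: "\<And>x. X x 0 = x"
    and ode: "\<And>x t. 0 < t \<Longrightarrow> t < \<tau> \<Longrightarrow> (X x has_vector_derivative F t (X x t)) (at t)"
  shows "continuous_on UNIV (\<lambda>x. X x \<tau>)"
proof (rule continuous_at_imp_continuous_on, rule ballI)
  fix x0
  obtain R where R: "0 < R" "\<And>t. t \<in> {0..\<tau>} \<Longrightarrow> norm (X x0 t) \<le> R"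
  proof -
    have "bounded (X x0 ` {0..\<tau>})" by (intro compact_imp_bounded compact_continuous_image cont) simp
    then show ?thesis using that unfolding bounded_pos by blast
  qed
  obtain \<Lambda> where \<Lambda>: "0 \<le> \<Lambda>" "\<And>t y y'. t \<in> {0..\<tau>} \<Longrightarrow> y \<in> cball 0 (R + 1) \<Longrightarrow> y' \<in> cball 0 (R + 1) \<Longrightarrow>
     norm (F t y - F t y') \<le> \<Lambda> * norm (y - y')"
    using lip[of "R + 1"] R by auto
  have close: "norm (X x \<tau> - X x0 \<tau>) \<le> exp (\<Lambda> * \<tau>) * norm (x - x0)"
    if small: "exp (\<Lambda> * \<tau>) * norm (x - x0) < 1" for x
  proof -
    define w where "w t = X x t - X x0 t" for t
    have wc: "continuous_on {0..\<tau>} w" unfolding w_def by (intro continuous_intros cont)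
    have grow: "norm (w t) \<le> exp (\<Lambda> * t) * norm (w 0)"
      if t: "0 \<le> t" "t \<le> \<tau>" and below: "\<And>r. 0 < r \<Longrightarrow> r < t \<Longrightarrow> norm (w r) \<le> 1" for t
    proof (rule gronwall_lipschitz[OF t(1)])
      show "continuous_on {0..t} w" using wc by (rule continuous_on_subset) (use t in auto)
      fix r assume r: "0 < r" "r < t"
      show "(w has_vector_derivative (F r (X x r) - F r (X x0 r))) (at r)"
        unfolding w_def using r t by (intro has_vector_derivative_diff ode) auto
      have "norm (X x0 r) \<le> R" using R(2)[of r] r t by simp
      moreover have "norm (X x r) \<le> norm (X x0 r) + norm (w r)"
        unfolding w_def using norm_triangle_sub by blast
      ultimately show "norm (F r (X x r) - F r (X x0 r)) \<le> \<Lambda> * norm (w r)"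
        unfolding w_def using below[OF r] r t by (intro \<Lambda>(2)) (auto simp: w_def)
    qed
    have small': "exp (\<Lambda> * t) * norm (w 0) < 1" if "t \<le> \<tau>" for t
    proof -
      have "exp (\<Lambda> * t) * norm (w 0) \<le> exp (\<Lambda> * \<tau>) * norm (w 0)"
        using that \<Lambda>(1) by (intro mult_right_mono) (auto intro: mult_left_mono)
      then show ?thesis using small by (simp add: w_def init)
    qed
    have below: "norm (w t) < 1" if t: "t \<in> {0..\<tau>}" for t
    proof (rule ccontr)
      assume "\<not> norm (w t) < 1"
      define S where "S = {0..\<tau>} \<inter> (\<lambda>r. norm (w r)) -` {1..}"
      have "closed S"
        unfolding S_def by (intro continuous_closed_preimage continuous_on_norm wc) auto
      moreover have "t \<in> S" using t \<open>\<not> norm (w t) < 1\<close> by (simp add: S_def)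
      moreover have bb: "bdd_below S" unfolding S_def by (auto intro: bdd_belowI[of _ 0])
      ultimately have m: "Inf S \<in> S" by (intro closed_contains_Inf) auto
      \<comment> \<open>the first time at distance 1\<close>
      define t1 where "t1 = Inf S"
      have t1: "0 \<le> t1" "t1 \<le> \<tau>" "1 \<le> norm (w t1)" using m by (auto simp: S_def t1_def)
      have "norm (w r) \<le> 1" if "0 < r" "r < t1" for r
      proof (rule ccontr)
        assume "\<not> norm (w r) \<le> 1"
        then have "r \<in> S" using that t1 by (simp add: S_def)
        then show False using cInf_lower[OF _ bb] that by (force simp: t1_def)
      qed
      with grow[OF t1(1,2)] small'[OF t1(2)] t1(3) show False by force
    qed
    have "norm (w \<tau>) \<le> exp (\<Lambda> * \<tau>) * norm (w 0)"
      using \<tau> below by (intro grow) (auto intro: less_imp_le)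
    then show ?thesis by (simp add: w_def init)
  qed
  show "isCont (\<lambda>x. X x \<tau>) x0"
    unfolding continuous_at_eps_delta
  proof (intro allI impI)
    fix \<epsilon> :: real assume eps: "0 < \<epsilon>"
    define d where "d = min 1 \<epsilon> / exp (\<Lambda> * \<tau>)"
    have "dist (X x \<tau>) (X x0 \<tau>) < \<epsilon>" if "dist x x0 < d" for x
    proof -
      have "exp (\<Lambda> * \<tau>) * norm (x - x0) < min 1 \<epsilon>"
        using that by (simp add: d_def dist_norm pos_less_divide_eq mult.commute)
      with close[of x] show ?thesis by (simp add: dist_norm)
    qed
    moreover have "0 < d" using eps by (simp add: d_def)
    ultimately show "\<exists>d>0. \<forall>x. dist x x0 < d \<longrightarrow> dist (X x \<tau>) (X x0 \<tau>) < \<epsilon>" by blast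
  qed
qed

lemma km_ode_exists:
  assumes "km_well_defined \<rho>" "0 < T"
  shows "\<exists>X. km_ode \<rho> T X \<and> X 0 = x \<and> X T = km_map_upto \<rho> T x"
proof -
  have "\<exists>!y. km_endpoint \<rho> T x y" using assms by (simp add: km_well_defined_def)
  then have "km_endpoint \<rho> T x (km_map_upto \<rho> T x)" unfolding km_map_upto_def by (rule theI')
  then show ?thesis by (simp add: km_endpoint_def)
qed

lemma km_odeD:
  assumes "km_ode \<rho> T X"
  shows "continuous_on {0..T} X"
    and "0 < t \<Longrightarrow> t < T \<Longrightarrow>
      (X has_vector_derivative X t + grad (\<lambda>x. ln (ou_density (T - t) \<rho> x)) (X t)) (at t)"
proof -
  show "continuous_on {0..T} X" using assms by (simp add: km_ode_def)
  assume t: "0 < t" "t < T"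
  then have "(X has_vector_derivative X t + grad (\<lambda>x. ln (ou_density (T - t) \<rho> x)) (X t)) (at t within {0..T})"
    using assms unfolding km_ode_def by auto
  then show "(X has_vector_derivative X t + grad (\<lambda>x. ln (ou_density (T - t) \<rho> x)) (X t)) (at t)"
    using at_within_Icc_at[OF t] by simp
qed

lemma km_map_tendsto:
  assumes "km_well_defined \<rho>"
  shows "((\<lambda>T. km_map_upto \<rho> T x) \<longlongrightarrow> km_map \<rho> x) at_top"
proof -
  have "uniform_limit {x} (km_map_upto \<rho>) (km_map \<rho>) at_top"
    using assms compact_sing[of x] unfolding km_well_defined_def by blast
  then show ?thesis by (rule tendsto_uniform_limitI) simp
qed

text \<open>At the final time the score need not be Lipschitz, nor even exist, so that continuity is only available
  for the flow up to times \<open>\<tau> n < T\<close>; the endpoint map is the pointwise limit of these flows.\<close>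

lemma km_map_upto_measurable:
  fixes \<rho> :: "'a::euclidean_space measure"
  assumes \<rho>: "prob_space \<rho>" "sets \<rho> = sets borel" and wd: "km_well_defined \<rho>" and T: "0 < T"
  shows "km_map_upto \<rho> T \<in> borel_measurable borel"
proof -
  obtain X where X: "\<And>x. km_ode \<rho> T (X x)" "\<And>x. X x 0 = x" "\<And>x. X x T = km_map_upto \<rho> T x"
    using km_ode_exists[OF wd T] by metis
  define \<tau> where "\<tau> n = T * (1 - 1 / real (Suc n))" for n
  have \<tau>: "0 \<le> \<tau> n" "\<tau> n < T" for n
    using T by (auto simp: \<tau>_def divide_simps)
  have \<tau>_lim: "\<tau> \<longlonglongrightarrow> T"
  proof -
    have "\<tau> \<longlonglongrightarrow> T * (1 - 0)"
      unfolding \<tau>_def by (intro tendsto_intros LIMSEQ_inverse_real_of_nat[unfolded inverse_eq_divide])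
    then show ?thesis by simp
  qed
  have c: "continuous_on UNIV (\<lambda>x. X x (\<tau> n))" for n
  proof (rule flow_continuous[OF \<tau>(1), where F="\<lambda>t (y :: 'a). y + grad (\<lambda>x. ln (ou_density (T - t) \<rho> x)) y"])
    fix R :: real assume R: "0 \<le> R"
    have "0 < T - \<tau> n" using \<tau>[of n] by simp
    from score_locally_lipschitz[OF \<rho> this R, of T] obtain \<Lambda> where \<Lambda>: "0 \<le> \<Lambda>"
      "\<And>s y y'. T - \<tau> n \<le> s \<Longrightarrow> s \<le> T \<Longrightarrow> y \<in> cball 0 R \<Longrightarrow> y' \<in> cball 0 R \<Longrightarrow>
      norm (grad (\<lambda>x. ln (ou_density s \<rho> x)) y - grad (\<lambda>x. ln (ou_density s \<rho> x)) y') \<le> \<Lambda> * norm (y - y')"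
      by metis
    show "\<exists>\<Lambda>\<ge>0. \<forall>t\<in>{0..\<tau> n}. \<forall>y\<in>cball 0 R. \<forall>y'\<in>cball 0 R.
      norm (y + grad (\<lambda>x. ln (ou_density (T - t) \<rho> x)) y - (y' + grad (\<lambda>x. ln (ou_density (T - t) \<rho> x)) y')) \<le> \<Lambda> * norm (y - y')"
    proof (intro exI[of _ "1 + \<Lambda>"] conjI ballI)
      show "0 \<le> 1 + \<Lambda>" using \<Lambda>(1) by simp
      fix t y y' assume *: "t \<in> {0..\<tau> n}" "y \<in> cball (0::'a) R" "y' \<in> cball (0::'a) R"
      let ?g = "grad (\<lambda>x. ln (ou_density (T - t) \<rho> x))"
      have "norm (y + ?g y - (y' + ?g y')) \<le> norm (y - y') + norm (?g y - ?g y')"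
        using norm_triangle_ineq[of "y - y'" "?g y - ?g y'"] by (simp add: algebra_simps)
      also have "\<dots> \<le> norm (y - y') + \<Lambda> * norm (y - y')"
        using * by (intro add_left_mono \<Lambda>(2)) auto
      finally show "norm (y + ?g y - (y' + ?g y')) \<le> (1 + \<Lambda>) * norm (y - y')" by (simp add: algebra_simps)
    qed
  next
    fix x
    show "continuous_on {0..\<tau> n} (X x)"
      using km_odeD(1)[OF X(1)] by (rule continuous_on_subset) (use \<tau>[of n] in auto)
    show "X x 0 = x" by (rule X)
    fix t assume "0 < t" "t < \<tau> n"
    then show "(X x has_vector_derivative (X x t + grad (\<lambda>x. ln (ou_density (T - t) \<rho> x)) (X x t))) (at t)"
      using km_odeD(2)[OF X(1)] \<tau>[of n] by simp
  qed
  have lim: "(\<lambda>n. X x (\<tau> n)) \<longlonglongrightarrow> km_map_upto \<rho> T x" for x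
  proof -
    have "(\<lambda>n. X x (\<tau> n)) \<longlonglongrightarrow> X x T"
      using km_odeD(1)[OF X(1)] \<tau>_lim
      by (rule continuous_on_tendsto_compose) (use T \<tau> in \<open>auto intro!: always_eventually less_imp_le\<close>)
    then show ?thesis by (simp add: X)
  qed
  show ?thesis
    by (rule borel_measurable_LIMSEQ_metric[OF borel_measurable_continuous_onI[OF c] lim])
qed

lemma km_map_measurable:
  fixes \<rho> :: "'a::euclidean_space measure"
  assumes \<rho>: "prob_space \<rho>" "sets \<rho> = sets borel" and wd: "km_well_defined \<rho>"
  shows "km_map \<rho> \<in> borel_measurable borel"
proof (rule borel_measurable_LIMSEQ_metric)
  show "km_map_upto \<rho> (real (Suc n)) \<in> borel_measurable borel" for n
    by (rule km_map_upto_measurable[OF \<rho> wd]) simp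
  show "(\<lambda>n. km_map_upto \<rho> (real (Suc n)) x) \<longlonglongrightarrow> km_map \<rho> x" for x
    by (rule filterlim_compose[OF km_map_tendsto[OF wd]])
       (rule filterlim_compose[OF filterlim_real_sequentially filterlim_Suc])
qed

section \<open>Comparison of the two flows\<close>

lemma has_hessian_grad:
  assumes "has_hessian F H x"
  shows "GDERIV F x :> grad F x" "(grad F has_derivative H) (at x)"
proof -
  obtain g where g: "\<forall>\<^sub>F z in nhds x. GDERIV F z :> g z" "(g has_derivative H) (at x)"
    using assms by (auto simp: has_hessian_def)
  have eq: "\<forall>\<^sub>F z in nhds x. g z = grad F z"
    using g(1) by (rule eventually_mono) (simp add: grad_eq)
  then have gx: "g x = grad F x" by (rule eventually_nhds_x_imp_x)
  show "GDERIV F x :> grad F x"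
    using eventually_nhds_x_imp_x[OF g(1)] gx by simp
  show "(grad F has_derivative H) (at x)"
    using g(2) eventually_at_filter[THEN iffD2, OF eventually_mono[OF eq]] gx
    by (auto intro: has_derivative_transform_eventually)
qed

text \<open>The mean value theorem along the segment from \<open>y\<close> to \<open>x\<close>.\<close>

lemma grad_one_sided_lipschitz:
  fixes F :: "'a::euclidean_space \<Rightarrow> real"
  assumes "\<And>x. \<exists>H. has_hessian F H x \<and> loewner_le H (\<lambda>v. c *\<^sub>R v)"
  shows "(x - y) \<bullet> (grad F x - grad F y) \<le> c * (norm (x - y))\<^sup>2"
proof -
  obtain H where H: "\<And>z. has_hessian F (H z) z" "\<And>z. loewner_le (H z) (\<lambda>v. c *\<^sub>R v)"
    using assms by metis
  define \<phi> where "\<phi> t = (x - y) \<bullet> grad F (y + t *\<^sub>R (x - y))" for t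
  have lin: "linear (H z)" for z
    using has_derivative_linear[OF has_hessian_grad(2)[OF H(1)]] .
  have d: "(\<phi> has_real_derivative (x - y) \<bullet> H (y + t *\<^sub>R (x - y)) (x - y)) (at t)" for t
  proof -
    have "((\<lambda>t. y + t *\<^sub>R (x - y)) has_derivative (\<lambda>h. h *\<^sub>R (x - y))) (at t)"
      by (auto intro!: derivative_eq_intros)
    from has_derivative_compose[OF this has_hessian_grad(2)[OF H(1)]]
    have "((\<lambda>t. grad F (y + t *\<^sub>R (x - y))) has_derivative
        (\<lambda>h. h *\<^sub>R H (y + t *\<^sub>R (x - y)) (x - y))) (at t)"
      by (simp add: linear_scale[OF lin])
    from has_derivative_inner_right[OF this, of "x - y"]
    show ?thesis
      unfolding \<phi>_def has_field_derivative_def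
      by (rule has_derivative_eq_rhs) (simp add: fun_eq_iff mult.commute)
  qed
  obtain \<xi> where "\<phi> 1 - \<phi> 0 = (1 - 0) * ((x - y) \<bullet> H (y + \<xi> *\<^sub>R (x - y)) (x - y))"
    using MVT2[of 0 1 \<phi>, OF _ d] by auto
  moreover have "(x - y) \<bullet> H (y + \<xi> *\<^sub>R (x - y)) (x - y) \<le> (x - y) \<bullet> (c *\<^sub>R (x - y))"
    using H(2) unfolding loewner_le_def by blast
  moreover have "\<phi> 1 - \<phi> 0 = (x - y) \<bullet> (grad F x - grad F y)"
    by (simp add: \<phi>_def inner_diff_right)
  ultimately show ?thesis by (simp add: power2_norm_eq_inner)
qed

lemma GDERIV_ln_std_gauss: "GDERIV (\<lambda>x. ln (gauss_density 0 1 x)) y :> - (y :: 'a::euclidean_space)"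
proof -
  define K where "K = (2 * pi * 1 :: real) powr (- (real DIM('a) / 2))"
  have K: "0 < K" by (simp add: K_def)
  have "gauss_density 0 1 x = K * exp (- (x \<bullet> x) / 2)" for x :: 'a
    by (simp add: gauss_density_def K_def power2_norm_eq_inner)
  then have eq: "(\<lambda>x::'a. ln (gauss_density 0 1 x)) = (\<lambda>x. ln K + (- 1 / 2) * (x \<bullet> x))"
    using K by (simp add: fun_eq_iff ln_mult)
  show ?thesis
    unfolding eq gderiv_def
    by (auto intro!: derivative_eq_intros simp: inner_commute fun_eq_iff)
qed

text \<open>The drift \<open>x + \<nabla> log q\<^sub>s\<^sup>\<mu>(x)\<close> is the gradient of \<open>log Q\<^sub>s[\<mu>/\<gamma>]\<close>, because \<open>- x\<close> is the gradient of the
  logarithm of the Gaussian density.\<close>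

lemma drift_one_sided_lipschitz:
  fixes \<mu> :: "'a::euclidean_space measure"
  assumes \<mu>: "prob_space \<mu>" "sets \<mu> = sets borel" "\<mu> = density std_gauss (\<lambda>x. ennreal (f x))"
    and f: "f \<in> borel_measurable borel" "\<And>x. 0 < f x" and s: "0 < s"
    and hess: "\<And>x. \<exists>H. has_hessian (\<lambda>x. ln (ou_semigroup s f x)) H x \<and> loewner_le H (\<lambda>v. c *\<^sub>R v)"
  shows "(x - y) \<bullet> ((x + grad (\<lambda>x. ln (ou_density s \<mu> x)) x) - (y + grad (\<lambda>x. ln (ou_density s \<mu> x)) y))
    \<le> c * (norm (x - y))\<^sup>2"
proof -
  have "grad (\<lambda>x. ln (ou_semigroup s f x)) z = z + grad (\<lambda>x. ln (ou_density s \<mu> x)) z" for z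
  proof (rule grad_eq)
    have "ln (ou_semigroup s f x) = ln (ou_density s \<mu> x) - ln (gauss_density 0 1 x)" for x
    proof -
      have "0 < gauss_density 0 1 x" by (simp add: gauss_density_def)
      moreover have "ou_semigroup s f x = ou_density s \<mu> x / gauss_density 0 1 x"
        unfolding \<mu>(3) by (rule ou_semigroup_eq_density_ratio[OF f(1) less_imp_le[OF f(2)] s])
      ultimately show ?thesis using ou_density_pos[OF \<mu>(1,2) s, of x] by (simp add: ln_div)
    qed
    moreover have "GDERIV (\<lambda>x. ln (ou_density s \<mu> x)) z :> grad (\<lambda>x. ln (ou_density s \<mu> x)) z"
      using GDERIV_ln_ou_density[OF \<mu>(1,2) s, of z] grad_eq by metis
    from GDERIV_diff[OF this GDERIV_ln_std_gauss]
    have "GDERIV (\<lambda>x. ln (ou_density s \<mu> x) - ln (gauss_density 0 1 x)) z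
      :> z + grad (\<lambda>x. ln (ou_density s \<mu> x)) z"
      by (simp add: add.commute[of z])
    ultimately show "GDERIV (\<lambda>x. ln (ou_semigroup s f x)) z :> z + grad (\<lambda>x. ln (ou_density s \<mu> x)) z"
      by simp
  qed
  with grad_one_sided_lipschitz[OF hess, of x y] show ?thesis by simp
qed

lemma has_integral_reverse:
  fixes f :: "real \<Rightarrow> real"
  assumes "(f has_integral I) {a..b}"
  shows "((\<lambda>u. f (T - u)) has_integral I) {T - b..T - a}"
proof (cases "a \<le> b")
  case True
  have "(\<lambda>x. (1 / - 1) *\<^sub>R x + - ((1 / - 1) *\<^sub>R T)) ` cbox a b = {T - b..T - a}"
    by (auto simp: image_iff intro: bexI[of _ "T - _"])
  with has_integral_affinity[OF assms[folded cbox_interval], of "-1" T] show ?thesis by simp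
next
  case False
  then show ?thesis using assms by simp
qed

lemma absolutely_integrable_reverse:
  fixes f :: "real \<Rightarrow> real"
  assumes f: "f absolutely_integrable_on {0..T}"
  shows "(\<lambda>u. f (T - u)) absolutely_integrable_on {0..T}"
proof -
  have "f integrable_on {0..T}" "(\<lambda>u. norm (f u)) integrable_on {0..T}"
    using f by (auto simp: absolutely_integrable_on_def)
  then obtain I J where "(f has_integral I) {0..T}" "((\<lambda>u. norm (f u)) has_integral J) {0..T}"
    by (auto simp: integrable_on_def)
  from this[THEN has_integral_reverse, of T]
  show ?thesis by (auto simp: absolutely_integrable_on_def integrable_on_def)
qed

text \<open>Gronwall's inequality in the time \<open>t\<close> of the flow, followed by the substitution \<open>s = T - t\<close>. The weight
  \<open>exp (\<integral>\<^sub>t\<^sup>T \<theta>\<^bsub>T - r\<^esub> dr)\<close> becomes \<open>exp (\<integral>\<^sub>0\<^sup>s \<theta>)\<close>, which does not depend on \<open>T\<close>.\<close>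

lemma km_map_upto_difference:
  fixes \<mu> \<nu> :: "'a::euclidean_space measure" and \<theta> h :: "real \<Rightarrow> real"
  assumes wd: "km_well_defined \<mu>" "km_well_defined \<nu>" and T: "0 < T"
    and \<theta>: "\<theta> absolutely_integrable_on {0..T}"
    and h: "h absolutely_integrable_on {0..T}" "\<And>s. 0 \<le> h s"
    and osl: "\<And>s x y. 0 < s \<Longrightarrow> (x - y) \<bullet> ((x + grad (\<lambda>x. ln (ou_density s \<mu> x)) x)
        - (y + grad (\<lambda>x. ln (ou_density s \<mu> x)) y)) \<le> \<theta> s * (norm (x - y))\<^sup>2"
    and diff: "\<And>s y. 0 < s \<Longrightarrow>
      norm (grad (\<lambda>x. ln (ou_density s \<mu> x)) y - grad (\<lambda>x. ln (ou_density s \<nu> x)) y) \<le> h s"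
  shows "norm (km_map_upto \<mu> T x - km_map_upto \<nu> T x)
    \<le> integral {0..T} (\<lambda>s. exp (integral {0..s} \<theta>) * h s)"
proof -
  obtain X where X: "km_ode \<mu> T X" "X 0 = x" "X T = km_map_upto \<mu> T x"
    using km_ode_exists[OF wd(1) T] by blast
  obtain Y where Y: "km_ode \<nu> T Y" "Y 0 = x" "Y T = km_map_upto \<nu> T x"
    using km_ode_exists[OF wd(2) T] by blast
  let ?G = "\<lambda>s y. grad (\<lambda>x. ln (ou_density s \<mu> x)) y" and ?N = "\<lambda>s y. grad (\<lambda>x. ln (ou_density s \<nu> x)) y"
  have "norm (X T - Y T) \<le> exp (integral {0..T} (\<lambda>t. \<theta> (T - t))) * norm (X 0 - Y 0)
    + integral {0..T} (\<lambda>u. exp (integral {u..T} (\<lambda>t. \<theta> (T - t))) * h (T - u))"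
  proof (rule gronwall_norm[where w="\<lambda>t. X t - Y t"
        and w'="\<lambda>t. (X t + ?G (T - t) (X t)) - (Y t + ?N (T - t) (Y t))"])
    show "continuous_on {0..T} (\<lambda>t. X t - Y t)"
      by (intro continuous_intros km_odeD(1)[OF X(1)] km_odeD(1)[OF Y(1)])
    fix t assume t: "0 < t" "t < T"
    show "((\<lambda>t. X t - Y t) has_vector_derivative (X t + ?G (T - t) (X t)) - (Y t + ?N (T - t) (Y t))) (at t)"
      by (intro has_vector_derivative_diff km_odeD(2)[OF X(1) t] km_odeD(2)[OF Y(1) t])
    let ?s = "T - t" and ?w = "X t - Y t"
    \<comment> \<open>only the drift of \<open>\<mu>\<close> is compared at two points; the scores are compared at \<open>Y t\<close>\<close>
    have "?w \<bullet> ((X t + ?G ?s (X t)) - (Y t + ?N ?s (Y t)))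
       = ?w \<bullet> ((X t + ?G ?s (X t)) - (Y t + ?G ?s (Y t))) + ?w \<bullet> (?G ?s (Y t) - ?N ?s (Y t))"
      by (simp add: inner_diff_right inner_add_right)
    also have "\<dots> \<le> \<theta> ?s * (norm ?w)\<^sup>2 + norm ?w * h ?s"
    proof (rule add_mono)
      show "?w \<bullet> ((X t + ?G ?s (X t)) - (Y t + ?G ?s (Y t))) \<le> \<theta> ?s * (norm ?w)\<^sup>2"
        using t by (intro osl) simp
      have "?w \<bullet> (?G ?s (Y t) - ?N ?s (Y t)) \<le> norm ?w * norm (?G ?s (Y t) - ?N ?s (Y t))"
        by (rule norm_cauchy_schwarz)
      also have "\<dots> \<le> norm ?w * h ?s" using t by (intro mult_left_mono diff) auto
      finally show "?w \<bullet> (?G ?s (Y t) - ?N ?s (Y t)) \<le> norm ?w * h ?s" .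
    qed
    finally show "?w \<bullet> ((X t + ?G ?s (X t)) - (Y t + ?N ?s (Y t))) \<le> \<theta> ?s * (norm ?w)\<^sup>2 + h ?s * norm ?w"
      by (simp add: mult.commute)
  qed (use T h absolutely_integrable_reverse[OF \<theta>] absolutely_integrable_reverse[OF h(1)] in auto)
  also have "integral {0..T} (\<lambda>u. exp (integral {u..T} (\<lambda>t. \<theta> (T - t))) * h (T - u))
    = integral {0..T} (\<lambda>s. exp (integral {0..s} \<theta>) * h s)"
  proof -
    have \<theta>i: "\<theta> integrable_on {0..s}" if "s \<le> T" for s
      using set_integrable_subset[OF \<theta>, of "{0..s}"] that
      by (auto intro: set_lebesgue_integral_eq_integral(1))
    have inner: "integral {u..T} (\<lambda>t. \<theta> (T - t)) = integral {0..T - u} \<theta>" if "u \<in> {0..T}" for u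
      using has_integral_reverse[OF integrable_integral[OF \<theta>i[of "T - u"]], of T] that
      by (auto intro: integral_unique)
    have c: "continuous_on {0..T} (\<lambda>s. exp (integral {0..s} \<theta>))"
      by (intro continuous_intros indefinite_integral_continuous_1 \<theta>i) simp
    have "(\<lambda>s. exp (integral {0..s} \<theta>) * h s) integrable_on {0..T}"
      using absolutely_integrable_continuous_mult[OF c h(1)]
      by (rule set_lebesgue_integral_eq_integral(1))
    from has_integral_reverse[OF integrable_integral[OF this], of T]
    have "integral {0..T} (\<lambda>u. exp (integral {0..T - u} \<theta>) * h (T - u))
      = integral {0..T} (\<lambda>s. exp (integral {0..s} \<theta>) * h s)"
      by (auto intro: integral_unique)
    moreover have "integral {0..T} (\<lambda>u. exp (integral {u..T} (\<lambda>t. \<theta> (T - t))) * h (T - u))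
      = integral {0..T} (\<lambda>u. exp (integral {0..T - u} \<theta>) * h (T - u))"
      by (intro integral_cong) (simp add: inner)
    ultimately show ?thesis by simp
  qed
  finally show ?thesis using X Y by simp
qed

context
  fixes \<theta> lam :: "real \<Rightarrow> real"
  assumes \<theta>: "\<And>T. 0 < T \<Longrightarrow> \<theta> absolutely_integrable_on {0..T}"
    and lam_meas: "lam \<in> borel_measurable (lebesgue_on {0<..})"
    and lam_pos: "\<And>t. 0 < t \<Longrightarrow> 0 < lam t"
begin

definition eta_integrand :: "real \<Rightarrow> real" where
  "eta_integrand T = exp T * lam T / (exp (2 * T) - 1) * exp (integral {0..T} \<theta>)"

lemma eta_integrand_pos: "0 < T \<Longrightarrow> 0 < eta_integrand T"
  by (simp add: eta_integrand_def lam_pos)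

lemma continuous_integral_theta: "continuous_on {0..} (\<lambda>s. integral {0..s} \<theta>)"
  unfolding continuous_on_eq_continuous_within
proof
  fix s :: real assume s: "s \<in> {0..}"
  have "\<theta> integrable_on {0..s + 1}"
    using \<theta>[of "s + 1"] s by (auto intro: set_lebesgue_integral_eq_integral(1))
  then have "continuous_on {0..s + 1} (\<lambda>s. integral {0..s} \<theta>)" by (rule indefinite_integral_continuous_1)
  then have "continuous (at s within {0..s + 1}) (\<lambda>s. integral {0..s} \<theta>)"
    using s by (simp add: continuous_on_eq_continuous_within)
  moreover have "at s within {0..s + 1} = at s within {0..}"
    by (rule at_within_nhd[of _ "{..<s + 1}"]) auto
  ultimately show "continuous (at s within {0..}) (\<lambda>s. integral {0..s} \<theta>)" by simp
qed

lemma eta_integrand_measurable: "eta_integrand \<in> borel_measurable (lebesgue_on {0<..})"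
proof -
  have c: "f \<in> borel_measurable (lebesgue_on {0<..})" if "continuous_on {0<..} f" for f :: "real \<Rightarrow> real"
    by (rule continuous_imp_measurable_on_sets_lebesgue[OF that]) simp
  have [measurable]: "(\<lambda>s. integral {0..s} \<theta>) \<in> borel_measurable (lebesgue_on {0<..})"
    by (rule c, rule continuous_on_subset[OF continuous_integral_theta]) auto
  have [measurable]: "(\<lambda>s::real. s) \<in> borel_measurable (lebesgue_on {0<..})"
    by (rule c) (rule continuous_on_id)
  note lam_meas [measurable]
  show ?thesis unfolding eta_integrand_def[abs_def] by measurable
qed

lemma eta_infty_eq: "eta_infty \<theta> lam = (\<integral>\<^sup>+T. ennreal (eta_integrand T) \<partial>lebesgue_on {0<..})"
  by (simp add: eta_infty_def eta_integrand_def)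

text \<open>Positivity matters if the Fisher information is infinite: the right-hand side of the theorem is then
  \<open>\<eta>\<^sub>\<infinity> \<cdot> \<infinity>\<close>, which would be \<open>0\<close> for \<open>\<eta>\<^sub>\<infinity> = 0\<close>.\<close>

lemma eta_infty_pos: "eta_infty \<theta> lam \<noteq> 0"
proof
  assume "eta_infty \<theta> lam = 0"
  then have "AE T in lebesgue_on {0<..}. ennreal (eta_integrand T) = 0"
    unfolding eta_infty_eq using eta_integrand_measurable
    by (subst (asm) nn_integral_0_iff_AE) auto
  moreover have "AE T in lebesgue_on {0<..}. ennreal (eta_integrand T) \<noteq> 0"
    by (rule AE_I2) (use eta_integrand_pos in \<open>force simp: ennreal_eq_0_iff\<close>)
  ultimately have "AE T in lebesgue_on {0 :: real<..}. False" by eventually_elim simp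
  then have "emeasure (lebesgue_on {0 :: real<..}) (space (lebesgue_on {0<..})) = 0"
    by (subst ae_filter_eq_bot_iff[symmetric]) (simp add: trivial_limit_def)
  then have "emeasure lebesgue {0 :: real<..} = 0" by (simp add: emeasure_restrict_space)
  moreover have "emeasure lebesgue {0<..1 :: real} \<le> emeasure lebesgue {0 :: real<..}"
    by (rule emeasure_mono) auto
  ultimately show False by simp
qed

text \<open>Finiteness of \<open>\<eta>\<^sub>\<infinity>\<close> makes the weighted kernel integrable, and on bounded intervals the weight is bounded
  below by a positive constant, so that the kernel itself is integrable.\<close>

lemma eta_kernel_integrable:
  assumes fin: "eta_infty \<theta> lam < \<infinity>" and T: "0 < T" and L: "0 \<le> L"
  defines "h \<equiv> \<lambda>s. if 0 < s then exp s * lam s / (exp (2 * s) - 1) * L else 0"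
  shows "h absolutely_integrable_on {0..T}"
    and "integral {0..T} (\<lambda>s. exp (integral {0..s} \<theta>) * h s) \<le> L * enn2real (eta_infty \<theta> lam)"
proof -
  have W0: "integrable (lebesgue_on {0<..}) eta_integrand"
    using fin eta_integrand_measurable unfolding eta_infty_eq
    by (intro integrableI_nonneg) (auto intro!: AE_I2 less_imp_le eta_integrand_pos)
  have W: "set_integrable lebesgue {0<..} eta_integrand"
    using W0 by (simp add: set_integrable_def integrable_restrict_space)
  have eta: "enn2real (eta_infty \<theta> lam) = (LINT s:{0<..}|lebesgue. eta_integrand s)"
  proof -
    have "eta_infty \<theta> lam = ennreal (LINT s|lebesgue_on {0<..}. eta_integrand s)"
      unfolding eta_infty_eq
      by (rule nn_integral_eq_integral[OF W0]) (auto intro!: AE_I2 less_imp_le eta_integrand_pos)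
    moreover have "0 \<le> (LINT s|lebesgue_on {0<..}. eta_integrand s)"
      by (rule integral_nonneg_AE) (auto intro!: AE_I2 less_imp_le eta_integrand_pos)
    ultimately show ?thesis
      by (simp add: set_lebesgue_integral_def integral_restrict_space)
  qed
  have eq: "exp (integral {0..s} \<theta>) * h s = L * (indicator {0<..} s * eta_integrand s)" for s
    by (simp add: h_def eta_integrand_def indicator_def)
  have Wi: "integrable lebesgue (\<lambda>s. indicator {0<..} s * eta_integrand s)"
    using W by (simp add: set_integrable_def)
  have Eh: "(\<lambda>s. exp (integral {0..s} \<theta>) * h s) absolutely_integrable_on {0..T}"
    unfolding eq set_integrable_def
    by (rule integrable_mult_indicator) (use Wi in auto)
  have "continuous_on {0..T} (\<lambda>s. exp (- integral {0..s} \<theta>))"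
    by (intro continuous_intros continuous_on_subset[OF continuous_integral_theta]) auto
  from absolutely_integrable_continuous_mult[OF this Eh]
  have "(\<lambda>s. exp (- integral {0..s} \<theta>) * (exp (integral {0..s} \<theta>) * h s)) absolutely_integrable_on {0..T}" .
  moreover have "exp (- integral {0..s} \<theta>) * (exp (integral {0..s} \<theta>) * h s) = h s" for s
    by (simp add: mult.assoc[symmetric] flip: exp_add)
  ultimately show "h absolutely_integrable_on {0..T}" by simp
  have "integral {0..T} (\<lambda>s. exp (integral {0..s} \<theta>) * h s)
    = (LINT s:{0..T}|lebesgue. L * (indicator {0<..} s * eta_integrand s))"
    using set_lebesgue_integral_eq_integral(2)[OF Eh, symmetric] unfolding eq .
  also have "\<dots> \<le> (LINT s|lebesgue. L * (indicator {0<..} s * eta_integrand s))"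
    unfolding set_lebesgue_integral_def
  proof (rule integral_mono)
    show "integrable lebesgue (\<lambda>s. indicat_real {0..T} s *\<^sub>R (L * (indicat_real {0<..} s * eta_integrand s)))"
      by (rule integrable_mult_indicator) (use Wi in auto)
    show "integrable lebesgue (\<lambda>s. L * (indicat_real {0<..} s * eta_integrand s))" using Wi by simp
    show "indicat_real {0..T} s *\<^sub>R (L * (indicat_real {0<..} s * eta_integrand s))
      \<le> L * (indicat_real {0<..} s * eta_integrand s)" for s
      using L less_imp_le[OF eta_integrand_pos[of s]] by (auto simp: indicator_def)
  qed
  also have "\<dots> = L * enn2real (eta_infty \<theta> lam)"
    unfolding eta set_lebesgue_integral_def by simp
  finally show "integral {0..T} (\<lambda>s. exp (integral {0..s} \<theta>) * h s) \<le> L * enn2real (eta_infty \<theta> lam)" .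
qed

end

lemma FI_infty_finiteD:
  assumes "FI_infty \<nu> \<mu> < \<infinity>"
  obtains L where "0 \<le> L" "absolutely_continuous \<mu> \<nu>" "weakly_differentiable (sqrt_ratio \<nu> \<mu>)"
    "AE x in \<nu>. norm (grad_log_ratio \<nu> \<mu> x) \<le> L" "ennreal_sqrt (FI_infty \<nu> \<mu>) = ennreal L"
proof -
  have P: "absolutely_continuous \<mu> \<nu>" "weakly_differentiable (sqrt_ratio \<nu> \<mu>)"
    and FI: "FI_infty \<nu> \<mu> = (Linf_norm \<nu> (grad_log_ratio \<nu> \<mu>))\<^sup>2"
    using assms by (auto simp: FI_infty_def split: if_splits)
  have "Linf_norm \<nu> (grad_log_ratio \<nu> \<mu>) \<noteq> \<infinity>"
    using assms unfolding FI by (auto simp: power2_eq_square)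
  then obtain L where L: "0 \<le> L" "Linf_norm \<nu> (grad_log_ratio \<nu> \<mu>) = ennreal L"
    by (cases "Linf_norm \<nu> (grad_log_ratio \<nu> \<mu>)") auto
  have "AE x in \<nu>. ennreal (norm (grad_log_ratio \<nu> \<mu> x)) \<le> ennreal L"
    using esssup_AE[of "\<lambda>x. ennreal (norm (grad_log_ratio \<nu> \<mu> x))" \<nu>] L(2) by (simp add: Linf_norm_def)
  then have "AE x in \<nu>. norm (grad_log_ratio \<nu> \<mu> x) \<le> L"
    by eventually_elim (use L(1) in simp)
  moreover have "ennreal_sqrt (FI_infty \<nu> \<mu>) = ennreal L"
    using L by (simp add: FI ennreal_sqrt_def ennreal_power)
  ultimately show ?thesis using that P L(1) by blast
qed

theorem theorem4p3:
  fixes \<mu> \<nu> :: "'a::euclidean_space measure"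
    and f :: "'a \<Rightarrow> real"
    and \<theta> lam :: "real \<Rightarrow> real"
  assumes "prob_space \<mu>" and "sets \<mu> = sets borel"
    and "f \<in> borel_measurable borel" and "\<And>x. 0 < f x"
    and "\<mu> = density std_gauss (\<lambda>x. ennreal (f x))"
    and "\<And>s x. 0 \<le> s \<Longrightarrow>
           \<exists>H. has_hessian (\<lambda>x. ln (ou_semigroup s f x)) H x \<and> loewner_le H (\<lambda>v. \<theta> s *\<^sub>R v)"
    and "\<And>y t. 0 < t \<Longrightarrow> log_sobolev (ou_posterior \<mu> y t) (lam t)"
    and "\<And>T. 0 < T \<Longrightarrow> \<theta> absolutely_integrable_on {0..T}"
    and "lam \<in> borel_measurable (lebesgue_on {0<..})"
    and "prob_space \<nu>" and "sets \<nu> = sets borel"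
    and "km_well_defined \<mu>" and "km_well_defined \<nu>"
  shows "Linf_norm std_gauss (\<lambda>x. km_map \<mu> x - km_map \<nu> x)
           \<le> eta_infty \<theta> lam * ennreal_sqrt (FI_infty \<nu> \<mu>)"
proof -
  note \<mu> = assms(1,2) and f = assms(3,4) and \<mu>_eq = assms(5) and hess = assms(6)
    and lsi = assms(7) and \<theta> = assms(8) and lam = assms(9) and \<nu> = assms(10,11) and wd = assms(12,13)
  have lam_pos: "0 < lam t" if "0 < t" for t using lsi[OF that] by (simp add: log_sobolev_def)
  note eta_pos = eta_infty_pos[OF \<theta> lam lam_pos]
  have sup_le: "Linf_norm std_gauss (\<lambda>x. km_map \<mu> x - km_map \<nu> x) \<le> ennreal B"
    if "\<And>T x. 0 < T \<Longrightarrow> norm (km_map_upto \<mu> T x - km_map_upto \<nu> T x) \<le> B" for B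
  proof -
    have le: "norm (km_map \<mu> x - km_map \<nu> x) \<le> B" for x
    proof (rule tendsto_upperbound)
      show "((\<lambda>T. norm (km_map_upto \<mu> T x - km_map_upto \<nu> T x)) \<longlongrightarrow> norm (km_map \<mu> x - km_map \<nu> x)) at_top"
        by (intro tendsto_intros km_map_tendsto wd)
      show "\<forall>\<^sub>F T in at_top. norm (km_map_upto \<mu> T x - km_map_upto \<nu> T x) \<le> B"
        using eventually_gt_at_top[of 0] by eventually_elim (rule that)
    qed simp
    have [measurable]: "km_map \<mu> \<in> borel_measurable borel" "km_map \<nu> \<in> borel_measurable borel"
      using km_map_measurable \<mu> \<nu> wd by blast+
    have "(\<lambda>x. ennreal (norm (km_map \<mu> x - km_map \<nu> x))) \<in> borel_measurable std_gauss"
      by (simp add: measurable_cong_sets[OF sets_std_gauss refl])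
    then show ?thesis
      unfolding Linf_norm_def by (rule esssup_I) (auto intro!: AE_I2 ennreal_leI le)
  qed
  show ?thesis
  proof (cases "FI_infty \<nu> \<mu> < \<infinity>")
    case False
    then have "ennreal_sqrt (FI_infty \<nu> \<mu>) = \<infinity>" by (simp add: ennreal_sqrt_def less_top)
    then show ?thesis using eta_pos by (simp add: ennreal_mult_top)
  next
    case True
    then obtain L where L: "0 \<le> L" "absolutely_continuous \<mu> \<nu>" "weakly_differentiable (sqrt_ratio \<nu> \<mu>)"
      "AE x in \<nu>. norm (grad_log_ratio \<nu> \<mu> x) \<le> L" "ennreal_sqrt (FI_infty \<nu> \<mu>) = ennreal L"
      by (rule FI_infty_finiteD)
    define m where "m x = gauss_density 0 1 x * f x" for x
    have gpos: "0 < gauss_density 0 1 x" for x :: 'a by (simp add: gauss_density_def)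
    have m: "m \<in> borel_measurable borel" "\<And>x. 0 < m x" using f gpos by (auto simp: m_def[abs_def])
    have \<mu>_dens: "\<mu> = density lborel (\<lambda>x. ennreal (m x))"
    proof -
      have "\<mu> = density lborel (\<lambda>x. ennreal (gauss_density 0 1 x) * ennreal (f x))"
        unfolding \<mu>_eq std_gauss_def by (rule density_density_eq) (use f in auto)
      then show ?thesis using gpos f by (simp add: m_def ennreal_mult less_imp_le)
    qed
    define h where "h L s = (if 0 < s then exp s * lam s / (exp (2 * s) - 1) * L else 0)" for L s :: real
    have h_nonneg: "0 \<le> h L s" for s using lam_pos L(1) by (simp add: h_def less_imp_le)
    have osl: "(x - y) \<bullet> ((x + grad (\<lambda>x. ln (ou_density s \<mu> x)) x)
        - (y + grad (\<lambda>x. ln (ou_density s \<mu> x)) y)) \<le> \<theta> s * (norm (x - y))\<^sup>2" if "0 < s" for s x y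
      using drift_one_sided_lipschitz[OF \<mu> \<mu>_eq f that hess] that by simp
    have diff: "norm (grad (\<lambda>x. ln (ou_density s \<mu> x)) y - grad (\<lambda>x. ln (ou_density s \<nu> x)) y) \<le> h L s"
      if "0 < s" for s y
      using score_difference[OF \<mu>(1) \<mu>_dens m \<nu> that L(2,3,4,1) lsi[OF that]] that by (simp add: h_def)
    have est: "norm (km_map_upto \<mu> T x - km_map_upto \<nu> T x)
        \<le> integral {0..T} (\<lambda>s. exp (integral {0..s} \<theta>) * h L s)"
      if "0 < T" "h L absolutely_integrable_on {0..T}" for T x
      by (rule km_map_upto_difference[OF wd that(1) \<theta>[OF that(1)] that(2) h_nonneg osl diff])
    show ?thesis
    proof (cases "eta_infty \<theta> lam < \<infinity>")
      case fin: True
      have "Linf_norm std_gauss (\<lambda>x. km_map \<mu> x - km_map \<nu> x) \<le> ennreal (L * enn2real (eta_infty \<theta> lam))"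
      proof (rule sup_le)
        fix T :: real and x :: 'a assume T: "0 < T"
        note K = eta_kernel_integrable[OF \<theta> lam lam_pos fin T L(1), folded h_def]
        show "norm (km_map_upto \<mu> T x - km_map_upto \<nu> T x) \<le> L * enn2real (eta_infty \<theta> lam)"
          using order_trans[OF est[OF T K(1)] K(2)] .
      qed
      also have "\<dots> = eta_infty \<theta> lam * ennreal L"
        using fin L(1) by (simp add: ennreal_mult less_top mult.commute)
      finally show ?thesis by (simp add: L(5))
    next
      case inf: False
      show ?thesis
      proof (cases "L = 0")
        \<comment> \<open>here \<open>\<eta>\<^sub>\<infinity> L = \<infinity> \<cdot> 0 = 0\<close>, so the two maps have to agree: the scores coincide\<close>
        case True
        then have h0: "h L = (\<lambda>_. 0)" by (auto simp: h_def)
        have "Linf_norm std_gauss (\<lambda>x. km_map \<mu> x - km_map \<nu> x) \<le> ennreal 0"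
        proof (rule sup_le)
          fix T :: real and x :: 'a assume T: "0 < T"
          have "h L absolutely_integrable_on {0..T}" by (simp add: h0 set_integrable_def)
          from est[OF T this] show "norm (km_map_upto \<mu> T x - km_map_upto \<nu> T x) \<le> 0" by (simp add: h0)
        qed
        then show ?thesis by simp
      next
        case False
        moreover have "eta_infty \<theta> lam = \<top>" using inf by (simp add: less_top[symmetric])
        ultimately show ?thesis using L by (simp add: ennreal_top_mult)
      qed
    qed
  qed
qed

end
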